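(* Let $Q\in L^2([0,1];\mathbb{C}^{n\times n})$ and let the boundary conditions $Cy(0)+Dy(1)=0$ be weakly $B$-regular. Then the system of root functions of the boundary value problem $$-iBy'+Q(x)y=\lambda y,\qquad Cy(0)+Dy(1)=0,$$ (that is, of the operator $L_{C,D}(Q)$) is complete and minimal in $L^2([0,1];\mathbb{C}^n)$.
   Context: Setting. $B=\operatorname{diag}(b_1^{-1}I_{n_1},\dots,b_r^{-1}I_{n_r})\in\mathbb{C}^{n\times n}$, $n=n_1+\dots+n_r$, is a nonsingular diagonal matrix with complex entries, $b_j\neq b_k$ for $j\neq k$. $C,D\in\mathbb{C}^{n\times n}$ satisfy the maximality condition $\operatorname{rank}(C\ D)=n$, where $(C\ D)$ is the $n\times 2n$ block matrix. $L_{C,D}(Q)$ is the operator in $L^2([0,1];\mathbb{C}^n)$ acting by $Ly=-iBy'+Q(x)y$ on the domain $\{y\in W^1_2([0,1];\mathbb{C}^n): Cy(0)+Dy(1)=0\}$. Root functions. Root functions are eigenfunctions and associated functions of $L_{C,D}(Q)$; the system of root functions is the union, over all eigenvalues $\lambda$, of bases of the root subspaces $\operatorname{span}\{\ker(L_{C,D}(Q)-\lambda)^k: k\in\mathbb{N}\}$. A system is complete if its closed linear span is the whole space, and minimal if no element belongs to the closed linear span of the others. The matrix $T_A(C,D)$. For a diagonal matrix $A=\operatorname{diag}(a_1,\dots,a_n)$ with $\operatorname{Re}a_k\neq 0$ for all $k$ (the $a_k$ not necessarily distinct), $T_A(C,D)$ is the $n\times n$ matrix whose $k$th column is the $k$th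 column of $C$ if $\operatorname{Re}a_k>0$ and the $k$th column of $D$ if $\operatorname{Re}a_k<0$. Weak regularity. The boundary conditions $Cy(0)+Dy(1)=0$ are called weakly $B$-regular if there exist three complex numbers $z_1,z_2,z_3$ (with $\operatorname{Re}(z_jB)$ nonsingular, so that $T_{z_jB}(C,D)$ is defined) such that (a) the origin is an interior point of the triangle with vertices $z_1,z_2,z_3$, and (b) $\det T_{z_jB}(C,D)\neq0$ for $j\in\{1,2,3\}$. *)

theory Defs
  imports "HOL-Analysis.Analysis" "HOL-Library.Function_Algebras"
begin

definition cscale :: "complex \<Rightarrow> (real \<Rightarrow> complex^'n) \<Rightarrow> real \<Rightarrow> complex^'n"
  where "cscale c f = (\<lambda>x. c *s f x)"

global_interpretation cfun: vector_space "cscale :: complex \<Rightarrow> (real \<Rightarrow> complex^'n) \<Rightarrow> _"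
  by standard (simp_all add: cscale_def fun_eq_iff vec_eq_iff algebra_simps)


subsection \<open>The space $L^2([0,1])$ and complete, minimal systems\<close>

text \<open>Elements of $L^2$ are represented by functions on the real line whose values outside
  $[0,1]$ are irrelevant; two functions represent the same element iff they agree almost everywhere
  on $[0,1]$, i.e. iff the seminorm \<open>L2norm\<close> of their difference vanishes.\<close>

definition L2 :: "(real \<Rightarrow> 'a::real_normed_vector) set"
  where "L2 = {f \<in> borel_measurable (lebesgue_on {0..1}).
                 integrable (lebesgue_on {0..1}) (\<lambda>x. (norm (f x))\<^sup>2)}"

definition L2norm :: "(real \<Rightarrow> 'a::real_normed_vector) \<Rightarrow> real"
  where "L2norm f = sqrt (integral\<^sup>L (lebesgue_on {0..1}) (\<lambda>x. (norm (f x))\<^sup>2))"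

definition L2_closure :: "(real \<Rightarrow> 'a::real_normed_vector) set \<Rightarrow> (real \<Rightarrow> 'a) set"
  where "L2_closure S = {f \<in> L2. \<forall>e>0. \<exists>g\<in>S. L2norm (f - g) < e}"

definition complete_system :: "(real \<Rightarrow> complex^'n) set \<Rightarrow> bool"
  where "complete_system \<Phi> \<longleftrightarrow> L2_closure (cfun.span \<Phi>) = L2"

definition minimal_system :: "(real \<Rightarrow> complex^'n) set \<Rightarrow> bool"
  where "minimal_system \<Phi> \<longleftrightarrow> (\<forall>\<phi>\<in>\<Phi>. \<phi> \<notin> L2_closure (cfun.span (\<Phi> - {\<phi>})))"


subsection \<open>The operator\<close>

text \<open>\<open>y\<close> is absolutely continuous on $[0,1]$ with derivative \<open>g\<close> in $L^2$, that is, \<open>y\<close> is a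
  primitive of \<open>g\<close>. The class of \<open>g\<close> in $L^2$ is determined by \<open>y\<close>.\<close>

definition has_L2_derivative :: "(real \<Rightarrow> complex^'n) \<Rightarrow> (real \<Rightarrow> complex^'n) \<Rightarrow> bool"
  where "has_L2_derivative y g \<longleftrightarrow>
    g \<in> L2 \<and> (\<forall>x\<in>{0..1}. y x = y 0 + integral\<^sup>L (lebesgue_on {0..x}) g)"

text \<open>Each element of $W^1_2$ is represented by its continuous representative, extended by zero
  outside $[0,1]$. The extension makes the representing function unique, so that equality and
  linear independence of functions in \<open>W12\<close> coincide with equality and linear independence
  in $L^2$.\<close>

definition W12 :: "(real \<Rightarrow> complex^'n) set"
  where "W12 = {y. (\<exists>g. has_L2_derivative y g) \<and> (\<forall>x. x \<notin> {0..1} \<longrightarrow> y x = 0)}"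

definition op_domain :: "complex^'n^'n \<Rightarrow> complex^'n^'n \<Rightarrow> (real \<Rightarrow> complex^'n) set"
  where "op_domain C D = {y \<in> W12. C *v y 0 + D *v y 1 = 0}"

text \<open>The graph of $L_{C,D}(Q) - \mu$; its second component ranges over all representatives
  of the image in $L^2$.\<close>

definition op_minus ::
  "complex^'n^'n \<Rightarrow> complex^'n^'n \<Rightarrow> complex^'n^'n \<Rightarrow> (real \<Rightarrow> complex^'n^'n) \<Rightarrow> complex
    \<Rightarrow> ((real \<Rightarrow> complex^'n) \<times> (real \<Rightarrow> complex^'n)) set"
  where "op_minus B C D Q \<mu> =
    {(y, h). y \<in> op_domain C D \<and> h \<in> L2 \<and>
       (\<exists>g. has_L2_derivative y g \<and>
         (AE x in lebesgue_on {0..1}.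
            h x = (- \<i>) *s (B *v g x) + Q x *v y x - \<mu> *s y x))}"

text \<open>The kernel of $(L_{C,D}(Q) - \mu)^k$, to be used for $k \ge 1$ only, where it is a set of
  functions in \<open>op_domain C D\<close>. In the composition of graphs each intermediate image can be chosen
  to be the representative lying in \<open>op_domain C D\<close>, whenever there is one.\<close>

definition ker_pow ::
  "complex^'n^'n \<Rightarrow> complex^'n^'n \<Rightarrow> complex^'n^'n \<Rightarrow> (real \<Rightarrow> complex^'n^'n) \<Rightarrow> complex \<Rightarrow> nat
    \<Rightarrow> (real \<Rightarrow> complex^'n) set"
  where "ker_pow B C D Q \<mu> k =
    {y. \<exists>h. (y, h) \<in> op_minus B C D Q \<mu> ^^ k \<and> (AE x in lebesgue_on {0..1}. h x = 0)}"

definition eigenvalues ::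
  "complex^'n^'n \<Rightarrow> complex^'n^'n \<Rightarrow> complex^'n^'n \<Rightarrow> (real \<Rightarrow> complex^'n^'n) \<Rightarrow> complex set"
  where "eigenvalues B C D Q = {\<mu>. \<exists>y \<in> ker_pow B C D Q \<mu> 1. y \<noteq> 0}"

definition root_subspace ::
  "complex^'n^'n \<Rightarrow> complex^'n^'n \<Rightarrow> complex^'n^'n \<Rightarrow> (real \<Rightarrow> complex^'n^'n) \<Rightarrow> complex
    \<Rightarrow> (real \<Rightarrow> complex^'n) set"
  where "root_subspace B C D Q \<mu> = cfun.span (\<Union>k\<in>{1..}. ker_pow B C D Q \<mu> k)"

definition root_function_system ::
  "complex^'n^'n \<Rightarrow> complex^'n^'n \<Rightarrow> complex^'n^'n \<Rightarrow> (real \<Rightarrow> complex^'n^'n)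
    \<Rightarrow> (real \<Rightarrow> complex^'n) set \<Rightarrow> bool"
  where "root_function_system B C D Q \<Phi> \<longleftrightarrow>
    (\<exists>\<beta>. (\<forall>\<mu>\<in>eigenvalues B C D Q.
            cfun.independent (\<beta> \<mu>) \<and> cfun.span (\<beta> \<mu>) = root_subspace B C D Q \<mu>) \<and>
         \<Phi> = (\<Union>\<mu>\<in>eigenvalues B C D Q. \<beta> \<mu>))"


subsection \<open>The coefficient matrix and the boundary conditions\<close>

text \<open>\<open>blk k\<close> is the block containing the index \<open>k\<close>, so block \<open>j\<close> has size
  $n_j$ = \<open>card {k. blk k = j}\<close>.\<close>

definition block_diag :: "(nat \<Rightarrow> complex) \<Rightarrow> ('n \<Rightarrow> nat) \<Rightarrow> complex^'n^'n"
  where "block_diag b blk = (\<chi> i j. if i = j then inverse (b (blk i)) else 0)"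

definition row_block :: "complex^'n^'n \<Rightarrow> complex^'n^'n \<Rightarrow> complex^('n + 'n)^'n"
  where "row_block C D = (\<chi> i j. case j of Inl k \<Rightarrow> C $ i $ k | Inr k \<Rightarrow> D $ i $ k)"

text \<open>Meaningful only if \<open>Re (A $ k $ k) \<noteq> 0\<close> for all \<open>k\<close>.\<close>

definition T_mat :: "complex^'n^'n \<Rightarrow> complex^'n^'n \<Rightarrow> complex^'n^'n \<Rightarrow> complex^'n^'n"
  where "T_mat A C D = (\<chi> i k. if Re (A $ k $ k) > 0 then C $ i $ k else D $ i $ k)"

definition weakly_regular :: "complex^'n^'n \<Rightarrow> complex^'n^'n \<Rightarrow> complex^'n^'n \<Rightarrow> bool"
  where "weakly_regular B C D \<longleftrightarrow>
    (\<exists>z1 z2 z3 :: complex. 0 \<in> interior (convex hull {z1, z2, z3}) \<and>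
       (\<forall>z\<in>{z1, z2, z3}. (\<forall>k. Re (map_matrix ((*) z) B $ k $ k) \<noteq> 0) \<and>
          det (T_mat (map_matrix ((*) z) B) C D) \<noteq> 0))"

end

theory Submission
  imports Defs "HOL-Complex_Analysis.Riemann_Mapping"
begin

text \<open>On each ray $t\omega_j$, where $\omega_j = i \bar z_j$, the exponentials solving $-iBy' = \lambda y$ split into
  decaying and growing ones, and $\det T_{z_jB}(C,D) \neq 0$ says that the decaying modes can be
  prescribed at $0$ and the growing ones at $1$. Treating $Q$ as a perturbation, which costs a factor
  $t^{-1/2}$, the resolvent is $O(t^{-1/2})$ along the three rays.

  Let $U(\mu) f$ be the resolvent multiplied by the characteristic determinant $\Delta(\mu)$; both are
  entire of exponential type. A functional $l$ annihilating all root functions annihilates the Taylor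
  coefficients of $U f$ at a zero of $\Delta$ below its order, so $l(U(\mu)f)/\Delta(\mu)$ is entire, of
  exponential type, and tends to $0$ along three rays which surround the origin. By Phragmen--Lindelof it
  vanishes, and $l = 0$ since the domain of the operator is dense.

  For minimality, the coefficient functionals of a root subspace are combinations of the Taylor
  coefficients at $\nu$ of $u(\mu) f = (U(\mu) f)(0)$; these are continuous on $L^2$ and vanish on the other root
  subspaces.\<close>

subsection \<open>Integration on the unit interval\<close>

text \<open>The rays come from \<open>Re (\<omega> * (\<i> * a k)) = - (cmod (a k))\<^sup>2 * Re (z
  * inverse (a k))\<close> for \<omega> = \<open>\<i> * cnj z\<close>: the mode k decays away from 0
  exactly where column k of \<open>T_mat\<close> is taken from C. The obstacle is that decay is
  known on three rays only, while between them \<Delta> has zeros and no lower bound. The quotient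
  l(U f)/\<Delta> is therefore estimated without locating zeros: Blaschke factors strip the zeros of
  \<Delta> from a disc, and a Harnack estimate bounds what remains from below. This enlarges the
  type by a constant factor, which is harmless, because two rays bounding a sector enclose an angle
  below \<pi> and Phragmen--Lindelof there admits every finite type. Functionals and point
  evaluations are applied before holomorphy is discussed, so only scalar entire functions occur;
  they are expanded in local power series whose coefficients are again solutions of the differential
  equation. For minimality, finitely many coefficient functionals separate the points of a root
  subspace, hence every coordinate functional with respect to a basis is a linear combination of
  them and extends continuously to all of L2.\<close>

abbreviation leb :: "real measure" where "leb \<equiv> lebesgue_on {0..1}"

lemma emeasure_leb: "emeasure leb (space leb) = 1"
  by (simp add: emeasure_restrict_space)

lemma finite_measure_leb: "finite_measure leb"
  by (rule finite_measureI) (simp only: emeasure_leb infinity_ennreal_def ennreal_one_neq_top, simp)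

interpretation leb: finite_measure leb
  by (rule finite_measure_leb)

lemma measure_leb: "measure leb {0..1} = 1"
  using emeasure_leb by (simp add: measure_def)

lemma L2D:
  assumes "f \<in> L2"
  shows "f \<in> borel_measurable leb" "integrable leb (\<lambda>x. (norm (f x))\<^sup>2)"
  using assms by (auto simp: L2_def)

lemma L2I:
  fixes f :: "real \<Rightarrow> 'a::euclidean_space"
  assumes "f \<in> borel_measurable leb" "g \<in> borel_measurable leb" "integrable leb (\<lambda>x. (g x)\<^sup>2)"
    and "\<And>x. x \<in> {0..1} \<Longrightarrow> norm (f x) \<le> g x"
  shows "f \<in> L2"
proof -
  have "integrable leb (\<lambda>x. (norm (f x))\<^sup>2)"
    by (rule Bochner_Integration.integrable_bound[OF assms(3)])
       (use assms in \<open>auto intro!: AE_I2 power_mono simp: abs_of_nonneg\<close>)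
  then show ?thesis using assms by (auto simp: L2_def)
qed

lemma L2_bounded:
  fixes f :: "real \<Rightarrow> 'a::euclidean_space"
  assumes "f \<in> borel_measurable leb" and "\<And>x. x \<in> {0..1} \<Longrightarrow> norm (f x) \<le> K"
  shows "f \<in> L2"
  by (rule L2I[where g = "\<lambda>_. K"]) (use assms in auto)

lemma L2norm_nonneg [simp]: "0 \<le> L2norm f"
  by (simp add: L2norm_def)

lemma L2norm_power2: "(L2norm f)\<^sup>2 = integral\<^sup>L leb (\<lambda>x. (norm (f x))\<^sup>2)"
  by (simp add: L2norm_def)

lemma L2_norm: "f \<in> L2 \<Longrightarrow> (\<lambda>x. norm (f x)) \<in> L2"
  by (auto simp: L2_def)

lemma L2norm_norm: "L2norm (\<lambda>x. norm (f x)) = L2norm f"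
  by (simp add: L2norm_def)

lemma L2norm_mono:
  fixes f :: "real \<Rightarrow> 'a::euclidean_space" and g :: "real \<Rightarrow> 'b::euclidean_space"
  assumes "f \<in> borel_measurable leb" "g \<in> L2" "AE x in leb. norm (f x) \<le> norm (g x)"
  shows "f \<in> L2" "L2norm f \<le> L2norm g"
proof -
  have *: "AE x in leb. (norm (f x))\<^sup>2 \<le> (norm (g x))\<^sup>2"
    using assms(3) by eventually_elim (auto intro: power_mono)
  have i: "integrable leb (\<lambda>x. (norm (f x))\<^sup>2)"
    by (rule Bochner_Integration.integrable_bound[OF L2D(2)[OF assms(2)]])
       (use assms * in auto)
  then show "f \<in> L2" using assms by (auto simp: L2_def)
  show "L2norm f \<le> L2norm g"
    unfolding L2norm_def by (intro real_sqrt_le_mono integral_mono_AE i L2D(2)[OF assms(2)] *)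
qed

lemma L2norm_le_const:
  fixes f :: "real \<Rightarrow> 'a::euclidean_space"
  assumes "f \<in> borel_measurable leb" and "\<And>x. x \<in> {0..1} \<Longrightarrow> norm (f x) \<le> K" "0 \<le> K"
  shows "L2norm f \<le> K"
proof -
  have "L2norm f \<le> L2norm (\<lambda>_. K)"
    by (rule L2norm_mono(2)) (use assms in \<open>auto intro!: L2_bounded AE_I2\<close>)
  also have "\<dots> = K" using assms by (simp add: L2norm_def measure_leb)
  finally show ?thesis .
qed

lemma L2_mult_integrable:
  fixes u :: "real \<Rightarrow> 'a::euclidean_space" and v :: "real \<Rightarrow> 'b::euclidean_space"
  assumes "u \<in> L2" "v \<in> L2"
  shows "integrable leb (\<lambda>x. norm (u x) * norm (v x))"
proof (rule Bochner_Integration.integrable_bound)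
  show "integrable leb (\<lambda>x. (norm (u x))\<^sup>2 + (norm (v x))\<^sup>2)"
    using assms by (intro Bochner_Integration.integrable_add L2D(2))
  show "(\<lambda>x. norm (u x) * norm (v x)) \<in> borel_measurable leb"
    using assms[THEN L2D(1)] by measurable
  have "norm (u x) * norm (v x) \<le> (norm (u x))\<^sup>2 + (norm (v x))\<^sup>2" for x
    using sum_squares_bound[of "norm (u x)" "norm (v x)"] mult_nonneg_nonneg[OF norm_ge_zero[of "u x"] norm_ge_zero[of "v x"]]
    unfolding mult.assoc by linarith
  then show "AE x in leb. norm (norm (u x) * norm (v x)) \<le> norm ((norm (u x))\<^sup>2 + (norm (v x))\<^sup>2)"
    by (auto intro!: AE_I2)
qed

lemma L2_cauchy_schwarz:
  fixes u :: "real \<Rightarrow> 'a::euclidean_space" and v :: "real \<Rightarrow> 'b::euclidean_space"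
  assumes "u \<in> L2" "v \<in> L2"
  shows "integral\<^sup>L leb (\<lambda>x. norm (u x) * norm (v x)) \<le> L2norm u * L2norm v"
proof -
  note [measurable] = assms[THEN L2D(1)]
  define I where "I = integral\<^sup>L leb (\<lambda>x. norm (u x) * norm (v x))"
  have I0: "I \<ge> 0" unfolding I_def by (rule integral_nonneg_AE) auto
  have *: "(\<integral>\<^sup>+x. ennreal (norm (u x)) * ennreal (norm (v x)) \<partial>leb) = ennreal I"
    unfolding I_def
    by (subst nn_integral_eq_integral[symmetric]) (use L2_mult_integrable[OF assms] in \<open>auto simp: ennreal_mult\<close>)
  have u: "(\<integral>\<^sup>+x. (ennreal (norm (u x)))\<^sup>2 \<partial>leb) = ennreal ((L2norm u)\<^sup>2)"
    unfolding L2norm_power2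
    by (subst nn_integral_eq_integral[symmetric]) (use assms L2D in \<open>auto simp: ennreal_power\<close>)
  have v: "(\<integral>\<^sup>+x. (ennreal (norm (v x)))\<^sup>2 \<partial>leb) = ennreal ((L2norm v)\<^sup>2)"
    unfolding L2norm_power2
    by (subst nn_integral_eq_integral[symmetric]) (use assms L2D in \<open>auto simp: ennreal_power\<close>)
  have "(ennreal I)\<^sup>2 \<le> ennreal ((L2norm u)\<^sup>2) * ennreal ((L2norm v)\<^sup>2)"
    using Cauchy_Schwarz_nn_integral[of "\<lambda>x. ennreal (norm (u x))" leb "\<lambda>x. ennreal (norm (v x))"]
    unfolding * u v by simp
  then have "I\<^sup>2 \<le> (L2norm u)\<^sup>2 * (L2norm v)\<^sup>2"
    using I0 by (simp add: ennreal_power ennreal_mult[symmetric])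
  then have "I\<^sup>2 \<le> (L2norm u * L2norm v)\<^sup>2" by (simp add: power_mult_distrib)
  then show ?thesis unfolding I_def[symmetric] by (rule power2_le_imp_le) simp
qed

lemma L2_integrable:
  fixes f :: "real \<Rightarrow> 'a::euclidean_space"
  assumes "f \<in> L2"
  shows "integrable leb f"
proof (rule Bochner_Integration.integrable_bound)
  have "(\<lambda>_. 1::real) \<in> L2" by (rule L2_bounded[where K=1]) auto
  from L2_mult_integrable[OF assms this] show "integrable leb (\<lambda>x. norm (f x))" by simp
qed (use assms L2D in auto)

lemma L2_add:
  fixes f g :: "real \<Rightarrow> 'a::euclidean_space"
  assumes "f \<in> L2" "g \<in> L2"
  shows "(\<lambda>x. f x + g x) \<in> L2"
proof -
  note [measurable] = assms[THEN L2D(1)]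
  have i: "integrable leb (\<lambda>x. (norm (f x) + norm (g x))\<^sup>2)"
    unfolding power2_sum mult.assoc
    by (intro Bochner_Integration.integrable_add L2D(2) assms Bochner_Integration.integrable_mult_right L2_mult_integrable)
  show ?thesis
    by (rule L2I[OF _ _ i]) (auto intro: norm_triangle_ineq)
qed

lemma L2norm_triangle:
  fixes f g :: "real \<Rightarrow> 'a::euclidean_space"
  assumes "f \<in> L2" "g \<in> L2"
  shows "L2norm (\<lambda>x. f x + g x) \<le> L2norm f + L2norm g"
proof -
  note [measurable] = assms[THEN L2D(1)]
  have "(L2norm (\<lambda>x. f x + g x))\<^sup>2 \<le> integral\<^sup>L leb (\<lambda>x. (norm (f x))\<^sup>2 + (norm (g x))\<^sup>2 + 2 * (norm (f x) * norm (g x)))"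
    unfolding L2norm_power2
  proof (rule integral_mono)
    show "integrable leb (\<lambda>x. (norm (f x + g x))\<^sup>2)" using L2_add[OF assms] L2D by auto
    show "integrable leb (\<lambda>x. (norm (f x))\<^sup>2 + (norm (g x))\<^sup>2 + 2 * (norm (f x) * norm (g x)))"
      by (intro Bochner_Integration.integrable_add L2D(2) assms Bochner_Integration.integrable_mult_right L2_mult_integrable)
    fix x
    have "(norm (f x + g x))\<^sup>2 \<le> (norm (f x) + norm (g x))\<^sup>2" by (intro power_mono norm_triangle_ineq) auto
    then show "(norm (f x + g x))\<^sup>2 \<le> (norm (f x))\<^sup>2 + (norm (g x))\<^sup>2 + 2 * (norm (f x) * norm (g x))"
      by (simp add: power2_sum)
  qed
  also have "\<dots> = (L2norm f)\<^sup>2 + (L2norm g)\<^sup>2 + 2 * integral\<^sup>L leb (\<lambda>x. norm (f x) * norm (g x))"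
    by (simp add: L2norm_power2 L2D(2) assms L2_mult_integrable)
  also have "\<dots> \<le> (L2norm f + L2norm g)\<^sup>2"
    using L2_cauchy_schwarz[OF assms] by (simp add: power2_sum)
  finally show ?thesis by (rule power2_le_imp_le) simp
qed

lemma L2_linear:
  fixes f :: "real \<Rightarrow> 'a::euclidean_space" and T :: "'a \<Rightarrow> 'b::euclidean_space"
  assumes "f \<in> L2" "bounded_linear T"
  shows "(\<lambda>x. T (f x)) \<in> L2"
proof -
  interpret T: bounded_linear T by fact
  obtain K where K: "\<And>x. norm (T x) \<le> norm x * K" using T.bounded by blast
  note [measurable] = L2D(1)[OF assms(1)] borel_measurable_continuous_onI[OF linear_continuous_on[OF assms(2)]]
  show ?thesis
    by (rule L2I[where g = "\<lambda>x. norm (f x) * K"])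
       (use assms L2D K in \<open>auto simp: power_mult_distrib\<close>)
qed

lemma L2_const: "(\<lambda>x. c :: 'a::euclidean_space) \<in> L2"
  by (rule L2_bounded[where K = "norm c"]) auto

lemma L2norm_scaleR: "L2norm (\<lambda>x. c *\<^sub>R f x) = \<bar>c\<bar> * L2norm f"
  by (simp add: L2norm_def power_mult_distrib real_sqrt_mult)

lemma L2_uminus: "(f :: real \<Rightarrow> 'a::euclidean_space) \<in> L2 \<Longrightarrow> (\<lambda>x. - f x) \<in> L2"
  by (rule L2_linear[of f uminus]) (auto intro: bounded_linear_minus bounded_linear_ident)

lemma L2_diff:
  fixes f g :: "real \<Rightarrow> 'a::euclidean_space"
  assumes "f \<in> L2" "g \<in> L2"
  shows "(\<lambda>x. f x - g x) \<in> L2"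
  using L2_add[OF assms(1) L2_uminus[OF assms(2)]] by simp

section \<open>Matrix-vector products: norms, measurability, square integrability\<close>

lemma norm_vec_sum_le: "norm (x :: 'a::real_normed_vector ^'n) \<le> (\<Sum>i\<in>UNIV. norm (x $ i))"
  unfolding norm_vec_def by (rule L2_set_le_sum) auto

text \<open>Matrices are vectors of rows, so their norm is the Frobenius norm; Cauchy-Schwarz in
  each row shows that it dominates the operator norm.\<close>

lemma norm_matrix_vector_le: "norm (M *v v) \<le> norm M * norm (v::complex^'n)" for M :: "complex^'n^'m"
proof -
  have "norm ((M *v v) $ i) \<le> norm (M $ i) * norm v" for i
  proof -
    have "norm ((M *v v) $ i) \<le> (\<Sum>j\<in>UNIV. norm (M $ i $ j) * norm (v $ j))"
      unfolding matrix_vector_mult_def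
      by (auto intro!: sum_norm_le simp: norm_mult)
    also have "\<dots> \<le> norm (M $ i) * norm v"
      unfolding norm_vec_def
      using L2_set_mult_ineq[where A=UNIV and f="\<lambda>j. norm (M $ i $ j)" and g="\<lambda>j. norm (v $ j)"] by simp
    finally show ?thesis .
  qed
  then have "norm (M *v v) \<le> L2_set (\<lambda>i. norm (M $ i) * norm v) UNIV"
    unfolding norm_vec_def[of "M *v v"] by (rule L2_set_mono) auto
  also have "\<dots> = norm M * norm v"
    unfolding norm_vec_def[of M] by (simp add: L2_set_left_distrib)
  finally show ?thesis .
qed

lemma norm_cvec_scale: "norm (c *s (v::complex^'n)) = norm c * norm v"
  by (simp add: norm_vec_def norm_mult L2_set_right_distrib)

lemma bounded_linear_cvec_scale: "bounded_linear (\<lambda>v::complex^'n. c *s v)"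
  by (rule bounded_linear_intro[where K="norm c"])
     (auto simp: norm_cvec_scale vec_eq_iff algebra_simps)

lemma measurable_vec_nth [measurable]: "(\<lambda>v::complex^'n. v $ i) \<in> borel_measurable borel"
  by (intro borel_measurable_continuous_onI continuous_intros)

lemma bounded_bilinear_mat_vec: "bounded_bilinear (\<lambda>(M::complex^'n^'m) v. M *v v)"
proof
  show "\<exists>K. \<forall>(M::complex^'n^'m) v. norm (M *v v) \<le> norm M * norm v * K"
    using norm_matrix_vector_le by (metis mult.right_neutral)
qed (auto simp: vec_eq_iff matrix_vector_mult_def scaleR_sum_right sum.distrib distrib_left distrib_right)

lemmas bounded_linear_mat_vec = bounded_bilinear.bounded_linear_right[OF bounded_bilinear_mat_vec]

lemma measurable_mat_vec [measurable]:
  assumes "f \<in> borel_measurable M" "g \<in> borel_measurable M"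
  shows "(\<lambda>x. (f x :: complex^'n^'m) *v g x) \<in> borel_measurable M"
  using assms by (rule borel_measurable_continuous_Pair)
    (intro bounded_bilinear.continuous_on[OF bounded_bilinear_mat_vec] continuous_intros)

lemma measurable_cvec_scale [measurable]:
  assumes "g \<in> borel_measurable M"
  shows "(\<lambda>x. c *s (g x :: complex^'n)) \<in> borel_measurable M"
  using measurable_compose[OF assms borel_measurable_continuous_onI[OF linear_continuous_on[OF bounded_linear_cvec_scale]]] .

lemma L2_mat_vec:
  fixes Q :: "real \<Rightarrow> complex^'n^'m"
  assumes "Q \<in> L2" "y \<in> borel_measurable leb" "\<And>x. x \<in> {0..1} \<Longrightarrow> norm (y x) \<le> K" "0 \<le> K"
  shows "(\<lambda>x. Q x *v y x) \<in> L2" "L2norm (\<lambda>x. Q x *v y x) \<le> K * L2norm Q"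
proof -
  note [measurable] = L2D(1)[OF assms(1)] assms(2)
  have K: "(\<lambda>x. K *\<^sub>R Q x) \<in> L2"
    by (rule L2_linear[OF assms(1)]) (rule bounded_linear_scaleR_right)
  have *: "norm (Q x *v y x) \<le> norm (K *\<^sub>R Q x)" if "x \<in> {0..1}" for x
    using order_trans[OF norm_matrix_vector_le[of "Q x" "y x"] mult_left_mono[OF assms(3)[OF that]]] assms(4)
    by (simp add: mult.commute)
  show "(\<lambda>x. Q x *v y x) \<in> L2"
    by (rule L2norm_mono(1)[OF _ K]) (use * in \<open>auto intro!: AE_I2\<close>)
  have "L2norm (\<lambda>x. Q x *v y x) \<le> L2norm (\<lambda>x. K *\<^sub>R Q x)"
    by (rule L2norm_mono(2)[OF _ K]) (use * in \<open>auto intro!: AE_I2\<close>)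
  then show "L2norm (\<lambda>x. Q x *v y x) \<le> K * L2norm Q"
    using assms(4) by (simp only: L2norm_scaleR)
qed

section \<open>Primitives and exponential kernels\<close>

lemma integrable_leb_sub:
  fixes g :: "real \<Rightarrow> 'a::euclidean_space"
  assumes "integrable leb g" "x \<in> {0..1}"
  shows "integrable (lebesgue_on {0..x}) g"
  using assms by (auto intro: integrable_subinterval[OF assms(1)])

text \<open>Moves integrals with a variable endpoint to the fixed measure \<open>leb\<close>, where
  Fubini and the kernel estimates apply.\<close>

lemma integral_leb_sub:
  fixes g :: "real \<Rightarrow> 'a::euclidean_space"
  assumes "x \<in> {0..1}"
  shows "integral\<^sup>L (lebesgue_on {0..x}) g = integral\<^sup>L leb (\<lambda>t. indicator {0..x} t *\<^sub>R g t)"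
proof -
  have "integral\<^sup>L (lebesgue_on {0..x}) g = integral\<^sup>L lebesgue (\<lambda>t. indicator {0..x} t *\<^sub>R g t)"
    by (rule integral_restrict_space) auto
  also have "\<dots> = integral\<^sup>L lebesgue (\<lambda>t. indicator {0..1} t *\<^sub>R indicator {0..x} t *\<^sub>R g t)"
    by (rule Bochner_Integration.integral_cong) (use assms in \<open>auto simp: indicator_def\<close>)
  also have "\<dots> = integral\<^sup>L leb (\<lambda>t. indicator {0..x} t *\<^sub>R g t)"
    by (rule integral_restrict_space[symmetric]) auto
  finally show ?thesis .
qed

lemma continuous_on_primitive:
  fixes g :: "real \<Rightarrow> 'a::euclidean_space"
  assumes "integrable leb g"
  shows "continuous_on {0..1} (\<lambda>x. integral\<^sup>L (lebesgue_on {0..x}) g)"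
proof -
  have "g integrable_on {0..1}"
    using assms by (rule integrable_on_lebesgue_on) simp
  then have "continuous_on {0..1} (\<lambda>x. integral {0..x} g)"
    by (rule indefinite_integral_continuous_1)
  moreover have "integral {0..x} g = integral\<^sup>L (lebesgue_on {0..x}) g" if "x \<in> {0..1}" for x
    using lebesgue_integral_eq_integral[OF integrable_leb_sub[OF assms that]] by simp
  ultimately show ?thesis
    by (rule continuous_on_eq)
qed

text \<open>The integral is computed exactly on both sides of \<open>x\<close> and the two negative
  exponentials are dropped. The factor 2 in the exponent is there because the kernel enters squared
  through Cauchy-Schwarz.\<close>

lemma integral_exp_kernel:
  assumes "K > 0" "x \<in> {0..1}"
  shows "integral\<^sup>L leb (\<lambda>t. exp (- 2 * K * \<bar>x - t\<bar>)) \<le> 1 / K"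
proof -
  define a b where "a = exp (-2*K*x)" and "b = exp (-2*K*(1-x))"
  have i: "integrable leb (\<lambda>t. exp (- 2 * K * \<bar>x - t\<bar>))"
    by (intro continuous_imp_integrable_real continuous_intros)
  have 1: "((\<lambda>t. exp (- 2 * K * \<bar>x - t\<bar>)) has_integral (exp (-2*K*(x-x))/(2*K) - exp (-2*K*(x-0))/(2*K))) {0..x}"
  proof (rule fundamental_theorem_of_calculus)
    fix t assume t: "t \<in> {0..x}"
    have "((\<lambda>t. exp (-2*K*(x-t))/(2*K)) has_real_derivative exp (- 2 * K * (x - t))) (at t within {0..x})"
      by (rule derivative_eq_intros refl | (use assms(1) in simp))+
    then show "((\<lambda>t. exp (-2*K*(x-t))/(2*K)) has_vector_derivative exp (- 2 * K * \<bar>x - t\<bar>)) (at t within {0..x})"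
      using t by (simp add: has_real_derivative_iff_has_vector_derivative)
  qed (use assms in auto)
  have 2: "((\<lambda>t. exp (- 2 * K * \<bar>x - t\<bar>)) has_integral (- exp (-2*K*(1-x))/(2*K) - (- exp (-2*K*(x-x))/(2*K)))) {x..1}"
  proof (rule fundamental_theorem_of_calculus)
    fix t assume t: "t \<in> {x..1}"
    have "((\<lambda>t. - exp (-2*K*(t-x))/(2*K)) has_real_derivative exp (- 2 * K * (t - x))) (at t within {x..1})"
      by (rule derivative_eq_intros refl | (use assms(1) in simp))+
    then show "((\<lambda>t. - exp (-2*K*(t-x))/(2*K)) has_vector_derivative exp (- 2 * K * \<bar>x - t\<bar>)) (at t within {x..1})"
      using t by (simp add: has_real_derivative_iff_has_vector_derivative)
  qed (use assms in auto)
  have "((\<lambda>t. exp (- 2 * K * \<bar>x - t\<bar>)) has_integral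
      (exp (-2*K*(x-x))/(2*K) - exp (-2*K*(x-0))/(2*K)) + (- exp (-2*K*(1-x))/(2*K) - (- exp (-2*K*(x-x))/(2*K)))) {0..1}"
    using assms by (intro has_integral_combine[OF _ _ 1 2]) auto
  then have "integral\<^sup>L leb (\<lambda>t. exp (- 2 * K * \<bar>x - t\<bar>)) =
      (exp (-2*K*(x-x))/(2*K) - exp (-2*K*(x-0))/(2*K)) + (- exp (-2*K*(1-x))/(2*K) - (- exp (-2*K*(x-x))/(2*K)))"
    by (subst lebesgue_integral_eq_integral[OF i]) (auto intro: integral_unique)
  also have "\<dots> = (1 - a) / (2*K) + (1 - b) / (2*K)"
    by (simp add: a_def b_def diff_divide_distrib)
  also have "\<dots> \<le> 1 / (2*K) + 1 / (2*K)"
    using assms(1) by (intro add_mono divide_right_mono) (auto simp: a_def b_def)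
  also have "\<dots> = 1 / K" by simp
  finally show ?thesis .
qed

text \<open>Cauchy--Schwarz against an exponential kernel: the gain \<open>1 / sqrt K\<close> is what makes an \<open>L2\<close>
  potential a small perturbation, both in the contraction argument and along the rays.\<close>

lemma kernel_bound:
  fixes h :: "real \<Rightarrow> 'a::euclidean_space" and g :: "real \<Rightarrow> 'b::euclidean_space"
  assumes K: "K > 0" and x: "x \<in> {0..1}" and h: "h \<in> L2"
    and g: "\<And>t. t \<in> {0..1} \<Longrightarrow> norm (g t) \<le> exp (- K * \<bar>x - t\<bar>) * norm (h t)"
  shows "norm (integral\<^sup>L leb g) \<le> L2norm h / sqrt K"
proof -
  define e where "e = (\<lambda>t. exp (- K * \<bar>x - t\<bar>))"
  have "integrable leb e"
    unfolding e_def by (intro continuous_imp_integrable_real continuous_intros)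
  then have em: "e \<in> borel_measurable leb" by (rule borel_measurable_integrable)
  have "norm (e t) \<le> 1" for t
    using K by (simp add: e_def)
  then have e: "e \<in> L2"
    by (intro L2_bounded[where K=1] em)
  have e2: "(norm (e t))\<^sup>2 = exp (- 2 * K * \<bar>x - t\<bar>)" for t
    by (simp add: e_def power2_eq_square flip: exp_add)
  have "norm (integral\<^sup>L leb g) \<le> integral\<^sup>L leb (\<lambda>t. norm (e t) * norm (h t))"
  proof (cases "integrable leb g")
    case True
    have "norm (integral\<^sup>L leb g) \<le> integral\<^sup>L leb (\<lambda>t. norm (g t))" by (rule integral_norm_bound)
    also have "\<dots> \<le> integral\<^sup>L leb (\<lambda>t. norm (e t) * norm (h t))"
    proof (rule integral_mono)
      show "integrable leb (\<lambda>t. norm (g t))" using True by (rule integrable_norm)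
      show "integrable leb (\<lambda>t. norm (e t) * norm (h t))" by (rule L2_mult_integrable[OF e h])
      fix t assume "t \<in> space leb"
      then show "norm (g t) \<le> norm (e t) * norm (h t)" using g[of t] by (simp add: e_def)
    qed
    finally show ?thesis .
  next
    \<comment> \<open>A non-integrable function has Bochner integral 0, so only nonnegativity of the
      right-hand side is left to show.\<close>
    case False
    then show ?thesis
      by (simp add: not_integrable_integral_eq integral_nonneg_AE)
  qed
  also have "\<dots> \<le> L2norm e * L2norm h" by (rule L2_cauchy_schwarz[OF e h])
  also have "\<dots> \<le> sqrt (1 / K) * L2norm h"
  proof (rule mult_right_mono)
    show "L2norm e \<le> sqrt (1 / K)"
      unfolding L2norm_def e2 by (intro real_sqrt_le_mono integral_exp_kernel K x)
  qed simp
  also have "\<dots> = L2norm h / sqrt K" by (simp add: real_sqrt_divide)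
  finally show ?thesis .
qed

subsection \<open>Linear systems of Volterra type\<close>

text \<open>Caratheodory solutions of y' = P y + g: the coefficient is merely L2, so the equation is
  integrated. The initial value stays free.\<close>

definition lin_sol :: "(real \<Rightarrow> complex^'n^'n) \<Rightarrow> (real \<Rightarrow> complex^'n) \<Rightarrow> (real \<Rightarrow> complex^'n) \<Rightarrow> bool"
  where "lin_sol P g y \<longleftrightarrow> continuous_on {0..1} y \<and>
    (\<forall>x\<in>{0..1}. y x = y 0 + integral\<^sup>L (lebesgue_on {0..x}) (\<lambda>t. P t *v y t + g t))"

lemma measurable_leb_continuous:
  fixes f :: "real \<Rightarrow> 'a::euclidean_space"
  shows "continuous_on {0..1} f \<Longrightarrow> f \<in> borel_measurable leb"
  by (intro continuous_imp_measurable_on_sets_lebesgue) auto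

lemma bounded_leb_continuous:
  fixes f :: "real \<Rightarrow> 'a::euclidean_space"
  assumes "continuous_on {0..1} f"
  obtains K where "0 \<le> K" "\<And>x. x \<in> {0..1} \<Longrightarrow> norm (f x) \<le> K"
proof -
  have "bounded (f ` {0..1})" by (intro compact_imp_bounded compact_continuous_image assms) auto
  then obtain K where K: "\<forall>x\<in>{0..1}. norm (f x) \<le> K" unfolding bounded_iff by auto
  then have "0 \<le> K" by (metis atLeastAtMost_iff norm_ge_zero order_trans order_refl zero_le_one)
  with K show ?thesis by (intro that[of K]) auto
qed

lemma L2_continuous:
  fixes f :: "real \<Rightarrow> 'a::euclidean_space"
  assumes "continuous_on {0..1} f" shows "f \<in> L2"
  using assms by (metis L2_bounded bounded_leb_continuous measurable_leb_continuous)

lemma L2_mat_vec_continuous: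
  fixes P :: "real \<Rightarrow> complex^'n^'m"
  assumes "P \<in> L2" "continuous_on {0..1} y"
  shows "(\<lambda>t. P t *v y t) \<in> L2"
proof -
  obtain K where "0 \<le> K" "\<And>x. x \<in> {0..1} \<Longrightarrow> norm (y x) \<le> K" by (rule bounded_leb_continuous[OF assms(2)]) blast
  then show ?thesis by (intro L2_mat_vec(1)[OF assms(1) measurable_leb_continuous[OF assms(2)]])
qed

lemma lin_sol_integrand:
  fixes P :: "real \<Rightarrow> complex^'n^'m"
  assumes "P \<in> L2" "g \<in> L2" "continuous_on {0..1} y"
  shows "integrable leb (\<lambda>t. P t *v y t + g t)"
  by (rule L2_integrable[OF L2_add[OF L2_mat_vec_continuous[OF assms(1,3)] assms(2)]])

text \<open>The bounded part is integrated against the kernel directly and gains 1/K; only the L2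
  part goes through Cauchy-Schwarz and gains 1/sqrt K.\<close>

lemma kernel_bound_const:
  fixes g :: "real \<Rightarrow> 'b::euclidean_space" and h :: "real \<Rightarrow> 'a::euclidean_space"
  assumes K: "K > 0" and x: "x \<in> {0..1}" and h: "h \<in> L2" and c: "0 \<le> c" and gi: "integrable leb g"
    and g: "\<And>t. t \<in> {0..1} \<Longrightarrow> norm (g t) \<le> exp (- K * \<bar>x - t\<bar>) * (c + norm (h t))"
  shows "norm (integral\<^sup>L leb g) \<le> 2 * c / K + L2norm h / sqrt K"
proof -
  define e where "e = (\<lambda>t. exp (- K * \<bar>x - t\<bar>))"
  have ei: "integrable leb e"
    unfolding e_def by (intro continuous_imp_integrable_real continuous_intros)
  have e: "e \<in> L2" unfolding e_def by (intro L2_continuous continuous_intros)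
  have eh: "integrable leb (\<lambda>t. e t * norm (h t))"
    using L2_mult_integrable[OF e h] by (simp add: e_def)
  have "norm (integral\<^sup>L leb g) \<le> integral\<^sup>L leb (\<lambda>t. norm (g t))" by (rule integral_norm_bound)
  also have "\<dots> \<le> integral\<^sup>L leb (\<lambda>t. e t * c + e t * norm (h t))"
  proof (rule integral_mono)
    show "integrable leb (\<lambda>t. norm (g t))" using gi by (rule integrable_norm)
    show "integrable leb (\<lambda>t. e t * c + e t * norm (h t))"
      using ei eh by (intro Bochner_Integration.integrable_add integrable_mult_left) auto
    fix t assume "t \<in> space leb"
    then show "norm (g t) \<le> e t * c + e t * norm (h t)" using g[of t] by (simp add: e_def distrib_left)
  qed
  also have "\<dots> = integral\<^sup>L leb e * c + integral\<^sup>L leb (\<lambda>t. e t * norm (h t))"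
    using ei eh by simp
  \<comment> \<open>The kernel is not squared here, so \<open>integral_exp_kernel\<close> is used
    with \<open>K/2\<close>.\<close>
  also have "integral\<^sup>L leb e \<le> 2 / K"
    using integral_exp_kernel[of "K/2" x] K x by (simp add: e_def)
  also have "integral\<^sup>L leb (\<lambda>t. e t * norm (h t)) \<le> L2norm h / sqrt K"
    using kernel_bound[OF K x h, of "\<lambda>t. e t * norm (h t)"] by (auto simp: e_def)
  finally show ?thesis using c by (simp add: mult_right_mono)
qed

lemma integral_leb_const_mult:
  fixes g :: "real \<Rightarrow> 'a::euclidean_space"
  assumes "x \<in> {0..1}"
  shows "c *\<^sub>R integral\<^sup>L (lebesgue_on {0..x}) g = integral\<^sup>L leb (\<lambda>t. indicator {0..x} t *\<^sub>R (c *\<^sub>R g t))"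
proof -
  have "c *\<^sub>R integral\<^sup>L (lebesgue_on {0..x}) g = integral\<^sup>L (lebesgue_on {0..x}) (\<lambda>t. c *\<^sub>R g t)" by simp
  also have "\<dots> = integral\<^sup>L leb (\<lambda>t. indicator {0..x} t *\<^sub>R (c *\<^sub>R g t))"
    by (rule integral_leb_sub[OF assms])
  finally show ?thesis .
qed

text \<open>The weight \<open>exp (- K x)\<close> turns the Volterra equation into a contraction. Keeping the
  constant part \<open>M\<close> of the coefficient apart lets \<open>K\<close> grow only linearly in \<open>norm M\<close>.\<close>

lemma weighted_volterra_bound:
  fixes M :: "complex^'n^'n"
  assumes K: "K > 0" and x: "x \<in> {0..1}" and R: "R \<in> L2" and g: "g \<in> L2"
    and y: "continuous_on {0..1} y" and m: "\<And>t. t \<in> {0..1} \<Longrightarrow> norm (y t) \<le> m * exp (K * t)"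
  shows "norm (exp (- K * x) *\<^sub>R integral\<^sup>L (lebesgue_on {0..x}) (\<lambda>t. (M + R t) *v y t + g t))
    \<le> (2 * norm M / K + L2norm R / sqrt K) * m + L2norm g / sqrt K"
proof -
  have m0: "m \<ge> 0" using m[of 0] order_trans[OF norm_ge_zero] by fastforce
  define h where "h = (\<lambda>t. norm (m *\<^sub>R R t) + norm (g t))"
  have mR: "(\<lambda>t. m *\<^sub>R R t) \<in> L2" using L2_linear[OF R bounded_linear_scaleR_right] .
  have h: "h \<in> L2" unfolding h_def by (intro L2_add L2_norm mR g)
  have hb: "L2norm h \<le> m * L2norm R + L2norm g"
    using L2norm_triangle[OF L2_norm[OF mR] L2_norm[OF g]] m0
    unfolding h_def L2norm_norm L2norm_scaleR by simp
  have MR: "(\<lambda>t. M + R t) \<in> L2" by (intro L2_add L2_const R)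
  have int: "integrable leb (\<lambda>t. indicator {0..x} t *\<^sub>R (exp (- K * x) *\<^sub>R ((M + R t) *v y t + g t)))"
    by (intro integrable_mult_indicator integrable_scaleR_right lin_sol_integrand MR g y)
       (use x in \<open>auto simp: sets_restrict_space image_iff intro!: exI[of _ "{0..x}"]\<close>)
  have "norm (exp (- K * x) *\<^sub>R integral\<^sup>L (lebesgue_on {0..x}) (\<lambda>t. (M + R t) *v y t + g t))
      \<le> 2 * (norm M * m) / K + L2norm h / sqrt K"
    unfolding integral_leb_const_mult[OF x]
  proof (rule kernel_bound_const[OF K x h _ int])
    show "0 \<le> norm M * m" using m0 by simp
    fix t :: real assume t: "t \<in> {0..1}"
    show "norm (indicator {0..x} t *\<^sub>R (exp (- K * x) *\<^sub>R ((M + R t) *v y t + g t)))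
        \<le> exp (- K * \<bar>x - t\<bar>) * (norm M * m + norm (h t))"
    proof (cases "t \<le> x")
      case True
      \<comment> \<open>The second factor cancels the growth \<open>exp (K * t)\<close> allowed for
        \<open>y\<close>; the first is the decaying kernel.\<close>
      have e: "exp (- K * x) = exp (- K * \<bar>x - t\<bar>) * exp (- K * t)"
        using True by (simp add: algebra_simps flip: exp_add)
      have "norm ((M + R t) *v y t) \<le> norm (M + R t) * norm (y t)" by (rule norm_matrix_vector_le)
      also have "\<dots> \<le> (norm M + norm (R t)) * (m * exp (K * t))"
        by (intro mult_mono norm_triangle_ineq m t) auto
      finally have "norm ((M + R t) *v y t + g t) \<le> (norm M + norm (R t)) * (m * exp (K * t)) + norm (g t)"
        using norm_triangle_ineq[of "(M + R t) *v y t" "g t"] by linarith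
      then have "exp (- K * t) * norm ((M + R t) *v y t + g t)
          \<le> exp (- K * t) * ((norm M + norm (R t)) * (m * exp (K * t)) + norm (g t))"
        by (intro mult_left_mono) auto
      also have "\<dots> = (exp (- K * t) * exp (K * t)) * ((norm M + norm (R t)) * m) + exp (- K * t) * norm (g t)"
        by (simp add: algebra_simps)
      also have "\<dots> = (norm M + norm (R t)) * m + exp (- K * t) * norm (g t)"
        by (simp flip: exp_add)
      also have "\<dots> \<le> (norm M + norm (R t)) * m + 1 * norm (g t)"
        using K t by (intro add_left_mono mult_right_mono) auto
      also have "\<dots> = norm M * m + norm (h t)" using m0 by (simp add: h_def algebra_simps)
      finally have "exp (- K * \<bar>x - t\<bar>) * (exp (- K * t) * norm ((M + R t) *v y t + g t))
        \<le> exp (- K * \<bar>x - t\<bar>) * (norm M * m + norm (h t))"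
        by (intro mult_left_mono) auto
      then show ?thesis using True t unfolding e by (simp add: mult.assoc)
    next
      case False
      then show ?thesis using m0 t by simp
    qed
  qed
  also have "\<dots> \<le> 2 * (norm M * m) / K + (m * L2norm R + L2norm g) / sqrt K"
    by (intro add_left_mono divide_right_mono hb) (use K in auto)
  finally show ?thesis by (simp add: algebra_simps add_divide_distrib)
qed

text \<open>Let \<open>m\<close> be the maximum of the weighted norm
  \<open>exp (- K * x) * norm (y x)\<close>. The Volterra bound at the maximizer gives
  \<open>m\<close> on the left and at most \<open>m / 2\<close> on the right, which is absorbed;
  undoing the weight costs \<open>exp K\<close>.\<close>

lemma lin_sol_bound:
  fixes M :: "complex^'n^'n"
  assumes K: "K > 0" and c: "2 * norm M / K + L2norm R / sqrt K \<le> 1/2" and R: "R \<in> L2" and g: "g \<in> L2"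
    and y: "lin_sol (\<lambda>t. M + R t) g y" and x: "x \<in> {0..1}"
  shows "norm (y x) \<le> 2 * exp K * (norm (y 0) + L2norm g / sqrt K)"
proof -
  have yc: "continuous_on {0..1} y" using y by (simp add: lin_sol_def)
  define u where "u = (\<lambda>x. exp (- K * x) * norm (y x))"
  have "continuous_on {0..1} u" unfolding u_def by (intro continuous_intros yc)
  then obtain x0 where x0: "x0 \<in> {0..1}" "\<And>x. x \<in> {0..1} \<Longrightarrow> u x \<le> u x0"
    using continuous_attains_sup[of "{0..1::real}" u] by auto
  define m where "m = u x0"
  have yu: "norm (y t) = u t * exp (K * t)" for t
    by (simp add: u_def exp_minus)
  have m: "norm (y t) \<le> m * exp (K * t)" if "t \<in> {0..1}" for t
    using x0(2)[OF that] unfolding yu m_def by (intro mult_right_mono) auto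
  have m0: "m \<ge> 0" by (simp add: m_def u_def)
  have yx0: "y x0 = y 0 + integral\<^sup>L (lebesgue_on {0..x0}) (\<lambda>t. (M + R t) *v y t + g t)"
    using y x0(1) unfolding lin_sol_def by blast
  have "m = norm (exp (- K * x0) *\<^sub>R y x0)" by (simp add: m_def u_def)
  also have "exp (- K * x0) *\<^sub>R y x0 = exp (- K * x0) *\<^sub>R y 0
      + exp (- K * x0) *\<^sub>R integral\<^sup>L (lebesgue_on {0..x0}) (\<lambda>t. (M + R t) *v y t + g t)"
    by (subst yx0) (rule scaleR_add_right)
  also have "norm \<dots> \<le> norm (exp (- K * x0) *\<^sub>R y 0)
      + norm (exp (- K * x0) *\<^sub>R integral\<^sup>L (lebesgue_on {0..x0}) (\<lambda>t. (M + R t) *v y t + g t))"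
    by (rule norm_triangle_ineq)
  also have "norm (exp (- K * x0) *\<^sub>R y 0) \<le> 1 * norm (y 0)"
    using K x0(1) by (simp add: mult_left_le_one_le)
  also have "norm (exp (- K * x0) *\<^sub>R integral\<^sup>L (lebesgue_on {0..x0}) (\<lambda>t. (M + R t) *v y t + g t))
    \<le> (2 * norm M / K + L2norm R / sqrt K) * m + L2norm g / sqrt K"
    by (rule weighted_volterra_bound[OF K x0(1) R g yc m])
  also have "\<dots> \<le> (1/2) * m + L2norm g / sqrt K"
    by (intro add_right_mono mult_right_mono c m0)
  finally have "m \<le> 2 * (norm (y 0) + L2norm g / sqrt K)" by simp
  then have "m * exp (K * x) \<le> 2 * (norm (y 0) + L2norm g / sqrt K) * exp K"
    by (intro mult_mono) (use K x m0 in \<open>auto simp: mult_le_cancel_left1\<close>)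
  then show ?thesis using m[OF x] by (simp add: mult_ac)
qed

lemma lin_sol_comb:
  fixes P :: "real \<Rightarrow> complex^'n^'n"
  assumes "lin_sol P g y" "lin_sol P h z" "P \<in> L2" "g \<in> L2" "h \<in> L2"
  shows "lin_sol P (\<lambda>t. c *s g t + h t) (\<lambda>t. c *s y t + z t)"
  unfolding lin_sol_def
proof (intro conjI ballI)
  have yz: "continuous_on {0..1} y" "continuous_on {0..1} z" using assms(1,2) by (auto simp: lin_sol_def)
  show "continuous_on {0..1} (\<lambda>t. c *s y t + z t)"
    by (intro continuous_intros yz bounded_linear.continuous_on[OF bounded_linear_cvec_scale])
  fix x :: real assume x: "x \<in> {0..1}"
  define I where "I = (\<lambda>f::real \<Rightarrow> complex^'n. integral\<^sup>L (lebesgue_on {0..x}) f)"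
  have i: "integrable (lebesgue_on {0..x}) (\<lambda>t. P t *v y t + g t)" "integrable (lebesgue_on {0..x}) (\<lambda>t. P t *v z t + h t)"
    using assms yz x by (auto intro!: integrable_leb_sub[OF _ x] lin_sol_integrand)
  have "I (\<lambda>t. P t *v (c *s y t + z t) + (c *s g t + h t)) = I (\<lambda>t. c *s (P t *v y t + g t) + (P t *v z t + h t))"
    by (simp add: matrix_vector_right_distrib vec.scale_right_distrib vec.scale algebra_simps)
  also have "\<dots> = I (\<lambda>t. c *s (P t *v y t + g t)) + I (\<lambda>t. P t *v z t + h t)"
    unfolding I_def by (intro Bochner_Integration.integral_add i integrable_bounded_linear[OF bounded_linear_cvec_scale])
  also have "I (\<lambda>t. c *s (P t *v y t + g t)) = c *s I (\<lambda>t. P t *v y t + g t)"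
    unfolding I_def by (rule integral_bounded_linear[OF bounded_linear_cvec_scale i(1)])
  finally have *: "I (\<lambda>t. P t *v (c *s y t + z t) + (c *s g t + h t)) = c *s I (\<lambda>t. P t *v y t + g t) + I (\<lambda>t. P t *v z t + h t)" .
  have "y x = y 0 + I (\<lambda>t. P t *v y t + g t)" "z x = z 0 + I (\<lambda>t. P t *v z t + h t)"
    using assms(1,2) x unfolding lin_sol_def I_def by blast+
  then show "c *s y x + z x = c *s y 0 + z 0 + integral\<^sup>L (lebesgue_on {0..x}) (\<lambda>t. P t *v (c *s y t + z t) + (c *s g t + h t))"
    using * unfolding I_def by (simp only: vec.scale_right_distrib ac_simps)
qed

lemma integral_leb_singleton:
  fixes f :: "real \<Rightarrow> 'a::euclidean_space"
  shows "integral\<^sup>L (lebesgue_on {0..0}) f = 0"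
proof -
  have "AE x in lebesgue. x \<noteq> (0::real)"
    by (rule AE_completion[OF AE_lborel_singleton])
  then show ?thesis
    by (subst integral_restrict_space) (auto intro!: integral_eq_zero_AE elim!: eventually_mono)
qed

lemma exists_weight:
  assumes "a \<ge> 0"
  obtains K :: real where "K > 0" "a / sqrt K \<le> 1/2"
proof
  show "(4 * a\<^sup>2 + 1 :: real) > 0" by (simp add: add_nonneg_pos)
  have "2 * a \<le> sqrt (4 * a\<^sup>2 + 1)" by (rule real_le_rsqrt) (simp add: power_mult_distrib)
  moreover have "sqrt (4 * a\<^sup>2 + 1) > 0" by (simp add: add_nonneg_pos)
  ultimately show "a / sqrt (4 * a\<^sup>2 + 1) \<le> 1/2" by (simp add: pos_divide_le_eq)
qed

text \<open>The difference solves the homogeneous equation with zero initial value, and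
  \<open>lin_sol_bound\<close> with \<open>M = 0\<close> makes it vanish.\<close>

lemma lin_sol_unique:
  fixes P :: "real \<Rightarrow> complex^'n^'n"
  assumes "lin_sol P g y" "lin_sol P g z" "y 0 = z 0" and P: "P \<in> L2" and g: "g \<in> L2" and x: "x \<in> {0..1}"
  shows "y x = z x"
proof -
  obtain K where K: "K > 0" "L2norm P / sqrt K \<le> 1/2" using exists_weight[of "L2norm P"] by auto
  have "lin_sol P (\<lambda>t. (-1) *s g t + g t) (\<lambda>t. (-1) *s y t + z t)"
    by (rule lin_sol_comb) fact+
  then have "lin_sol (\<lambda>t. 0 + P t) (\<lambda>t. 0) (\<lambda>t. z t - y t)"
    by (simp add: vec.scale_minus_left)
  from lin_sol_bound[OF K(1) _ P _ this x] K show ?thesis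
    using assms(3) by (simp add: L2_const L2norm_def)
qed

text \<open>Banach's fixed point theorem for \<open>exp (- K * x) *\<^sub>R y x\<close> in the sup
  norm, with \<open>K\<close> so large that the integral operator contracts by 1/2.\<close>

lemma lin_sol_exists:
  fixes P :: "real \<Rightarrow> complex^'n^'n"
  assumes P: "P \<in> L2" and g: "g \<in> L2"
  obtains y where "lin_sol P g y" "y 0 = c"
proof -
  obtain K where K: "K > 0" "L2norm P / sqrt K \<le> 1/2" using exists_weight[of "L2norm P"] by auto
  \<comment> \<open>The type of bounded continuous functions lives on the whole line; clamping to
    \<open>{0..1}\<close> extends the integral operator constantly beyond the interval.\<close>
  define cl :: "real \<Rightarrow> real" where "cl = (\<lambda>x. max 0 (min 1 x))"
  have cl01: "cl x \<in> {0..1}" for x by (auto simp: cl_def)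
  have cl_id: "cl x = x" if "x \<in> {0..1}" for x using that by (auto simp: cl_def)
  have cl_cont: "continuous_on UNIV cl" unfolding cl_def by (intro continuous_intros)
  \<comment> \<open>Removes the weight: \<open>v\<close> is the unknown of the fixed point problem,
    \<open>Y v\<close> the candidate solution.\<close>
  define Y :: "(real \<Rightarrow>\<^sub>C (complex^'n)) \<Rightarrow> real \<Rightarrow> complex^'n" where "Y v t = exp (K * t) *\<^sub>R apply_bcontfun v t" for v t
  have Yc: "continuous_on {0..1} (Y v)" for v
    unfolding Y_def by (intro continuous_intros continuous_on_subset[OF continuous_on_apply_bcontfun]) auto
  define J where "J v x = integral\<^sup>L (lebesgue_on {0..x}) (\<lambda>t. P t *v Y v t + g t)" for v x
  have Jc: "continuous_on {0..1} (J v)" for v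
    unfolding J_def by (intro continuous_on_primitive lin_sol_integrand P g Yc)
  define T where "T v x = exp (- K * cl x) *\<^sub>R (c + J v (cl x))" for v x
  have T0: "continuous_on {0..1} (\<lambda>x. exp (- K * x) *\<^sub>R (c + J v x))" for v
    by (intro continuous_intros Jc)
  have Tc: "continuous_on UNIV (T v)" for v
    unfolding T_def
    by (rule continuous_on_compose2[OF T0 cl_cont]) (use cl01 in auto)
  have "bounded (range (T v))" for v
  proof -
    have "bounded ((\<lambda>x. exp (- K * x) *\<^sub>R (c + J v x)) ` {0..1})"
      by (intro compact_imp_bounded compact_continuous_image T0) auto
    then show ?thesis by (rule bounded_subset) (use cl01 in \<open>auto simp: T_def\<close>)
  qed
  then have Tb: "T v \<in> bcontfun" for v using Tc by (simp add: bcontfun_def)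
  define F where "F v = Bcontfun (T v)" for v
  have F: "apply_bcontfun (F v) = T v" for v
    unfolding F_def using Tb by (rule Bcontfun_inverse)
  have "\<exists>!v. F v = v"
  proof (rule banach_fix_type)
    show "\<forall>v w. dist (F v) (F w) \<le> 1/2 * dist v w"
    proof (intro allI dist_bound)
      fix v w x
      define z where "z = (\<lambda>t. Y v t - Y w t)"
      have zc: "continuous_on {0..1} z" unfolding z_def by (intro continuous_intros Yc)
      have zb: "norm (z t) \<le> dist v w * exp (K * t)" for t
      proof -
        have "norm (z t) = exp (K * t) * dist (apply_bcontfun v t) (apply_bcontfun w t)"
          by (simp add: z_def Y_def dist_norm flip: scaleR_diff_right)
        then show ?thesis using dist_bounded[of v t w] by simp
      qed
      define X where "X = cl x"
      have X: "X \<in> {0..1}" using cl01 by (simp add: X_def)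
      have i: "integrable (lebesgue_on {0..X}) (\<lambda>t. P t *v Y v t + g t)" for v
        by (intro integrable_leb_sub[OF _ X] lin_sol_integrand P g Yc)
      have "J v X - J w X = integral\<^sup>L (lebesgue_on {0..X}) (\<lambda>t. (P t *v Y v t + g t) - (P t *v Y w t + g t))"
        unfolding J_def by (rule Bochner_Integration.integral_diff[symmetric]) (rule i)+
      also have "\<dots> = integral\<^sup>L (lebesgue_on {0..X}) (\<lambda>t. (0 + P t) *v z t + 0)"
        by (simp add: z_def matrix_vector_mult_diff_distrib)
      finally have *: "J v X - J w X = integral\<^sup>L (lebesgue_on {0..X}) (\<lambda>t. (0 + P t) *v z t + 0)" .
      have "dist (F v x) (F w x) = norm (exp (- K * X) *\<^sub>R (J v X - J w X))"
        by (simp add: F T_def X_def dist_norm flip: scaleR_diff_right)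
      also have "\<dots> \<le> (2 * norm (0::complex^'n^'n) / K + L2norm P / sqrt K) * dist v w + L2norm (\<lambda>t. 0::complex^'n) / sqrt K"
        unfolding * by (rule weighted_volterra_bound[OF K(1) X P L2_const zc zb])
      also have "\<dots> = L2norm P / sqrt K * dist v w" by (simp add: L2norm_def)
      also have "\<dots> \<le> 1/2 * dist v w" by (intro mult_right_mono K) auto
      finally show "dist (F v x) (F w x) \<le> 1/2 * dist v w" .
    qed
  qed auto
  then obtain v where v: "F v = v" by auto
  have "apply_bcontfun v x = T v x" for x using F[of v] v by simp
  then have Yv: "Y v x = c + J v x" if "x \<in> {0..1}" for x
    using cl_id[OF that] by (simp add: Y_def T_def flip: exp_add)
  have J0: "J v 0 = 0"
    unfolding J_def by (rule integral_leb_singleton)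
  show ?thesis
  proof
    show "Y v 0 = c" using Yv[of 0] J0 by simp
    with Yv Yc show "lin_sol P g (Y v)"
      unfolding lin_sol_def J_def by blast
  qed
qed

subsection \<open>Exponential decay of diagonal components\<close>

text \<open>The inner integral over the triangle s \<le> t \<le> x when Fubini is applied in
  \<open>integral_by_parts_exp\<close>; it is empty for s > x.\<close>

lemma integral_leb_exp:
  assumes "s \<in> {0..1}" "x \<in> {0..1}"
  shows "integral\<^sup>L leb (\<lambda>t. indicator {0..x} t *\<^sub>R (indicator {0..t} s *\<^sub>R (\<nu> * exp (- (\<nu> * complex_of_real t)))))
     = indicator {0..x} s *\<^sub>R (exp (- (\<nu> * s)) - exp (- (\<nu> * x)))"
proof (cases "s \<le> x")
  case True
  have "integral\<^sup>L leb (\<lambda>t. indicator {0..x} t *\<^sub>R (indicator {0..t} s *\<^sub>R (\<nu> * exp (- (\<nu> * complex_of_real t)))))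
      = integral\<^sup>L lebesgue (\<lambda>t. indicator {0..1} t *\<^sub>R (indicator {0..x} t *\<^sub>R (indicator {0..t} s *\<^sub>R (\<nu> * exp (- (\<nu> * complex_of_real t))))))"
    by (rule integral_restrict_space) auto
  also have "\<dots> = integral\<^sup>L lebesgue (\<lambda>t. indicator {s..x} t *\<^sub>R (\<nu> * exp (- (\<nu> * complex_of_real t))))"
    by (rule Bochner_Integration.integral_cong) (use assms in \<open>auto simp: indicator_def\<close>)
  also have "\<dots> = integral\<^sup>L (lebesgue_on {s..x}) (\<lambda>t. \<nu> * exp (- (\<nu> * complex_of_real t)))"
    by (rule integral_restrict_space[symmetric]) auto
  also have "\<dots> = integral {s..x} (\<lambda>t. \<nu> * exp (- (\<nu> * complex_of_real t)))"
  proof (rule lebesgue_integral_eq_integral)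
    have "integrable leb (\<lambda>t. \<nu> * exp (- (\<nu> * complex_of_real t)))"
      by (intro L2_integrable L2_continuous continuous_intros)
    then show "integrable (lebesgue_on {s..x}) (\<lambda>t. \<nu> * exp (- (\<nu> * complex_of_real t)))"
      by (rule integrable_subinterval) (use assms in auto)
  qed simp
  also have "((\<lambda>t. \<nu> * exp (- (\<nu> * complex_of_real t))) has_integral
      (- exp (- (\<nu> * complex_of_real x))) - (- exp (- (\<nu> * complex_of_real s)))) {s..x}"
  proof (rule fundamental_theorem_of_calculus[OF True])
    fix t assume "t \<in> {s..x}"
    have "((\<lambda>t. - exp (- (\<nu> * t))) has_field_derivative (\<nu> * exp (- (\<nu> * complex_of_real t)))) (at (complex_of_real t))"
      by (rule derivative_eq_intros refl | simp)+
    from has_vector_derivative_real_field[OF this]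
    show "((\<lambda>t. - exp (- (\<nu> * complex_of_real t))) has_vector_derivative \<nu> * exp (- (\<nu> * complex_of_real t))) (at t within {s..x})" .
  qed
  then have "integral {s..x} (\<lambda>t. \<nu> * exp (- (\<nu> * complex_of_real t))) = exp (- (\<nu> * s)) - exp (- (\<nu> * x))"
    by (subst integral_unique) auto
  finally show ?thesis using assms True by simp
next
  case False
  then have "(\<lambda>t. indicator {0..x} t *\<^sub>R (indicator {0..t} s *\<^sub>R (\<nu> * exp (- (\<nu> * complex_of_real t))))) = (\<lambda>t. 0)"
    by (auto simp: fun_eq_iff indicator_def)
  then show ?thesis using False by simp
qed

text \<open>\<open>g\<close> is only integrable, so integration by parts is done by Fubini: write
  exp(-\<nu> s) - exp(-\<nu> x) as the integral of \<nu> exp(-\<nu> t) over s \<le> t \<le> x,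
  multiply by \<open>g s\<close> and exchange the integrals.\<close>

lemma integral_by_parts_exp:
  fixes g :: "real \<Rightarrow> complex"
  assumes g: "integrable leb g" and x: "x \<in> {0..1}"
  shows "integral\<^sup>L (lebesgue_on {0..x}) (\<lambda>t. exp (- (\<nu> * t)) * g t) =
     exp (- (\<nu> * x)) * integral\<^sup>L (lebesgue_on {0..x}) g
     + integral\<^sup>L (lebesgue_on {0..x}) (\<lambda>t. \<nu> * exp (- (\<nu> * t)) * integral\<^sup>L (lebesgue_on {0..t}) g)"
proof -
  interpret p: pair_sigma_finite leb leb ..
  have gm: "g \<in> borel_measurable leb" using g by (rule borel_measurable_integrable)
  define E where "E = (\<lambda>t. \<nu> * exp (- (\<nu> * complex_of_real t)))"
  have Ec: "continuous_on {0..1} E" unfolding E_def by (intro continuous_intros)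
  obtain B where B: "0 \<le> B" "\<And>t. t \<in> {0..1} \<Longrightarrow> norm (E t) \<le> B" by (rule bounded_leb_continuous[OF Ec]) blast
  have Em: "E \<in> borel_measurable leb" by (rule measurable_leb_continuous[OF Ec])
  \<comment> \<open>The two indicators cut out the triangle 0 \<le> s \<le> t \<le> x.\<close>
  define F where "F = (\<lambda>(t,s). indicator {0..x} t *\<^sub>R (indicator {0..t} s *\<^sub>R (E t * g s)))"
  have idm: "(\<lambda>x. x) \<in> borel_measurable leb"
    by (rule measurable_leb_continuous) (intro continuous_intros)
  have [measurable]: "fst \<in> borel_measurable (leb \<Otimes>\<^sub>M leb)" "snd \<in> borel_measurable (leb \<Otimes>\<^sub>M leb)"
    using measurable_compose[OF measurable_fst idm] measurable_compose[OF measurable_snd idm] by auto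
  have m1: "(\<lambda>z. E (fst z)) \<in> borel_measurable (leb \<Otimes>\<^sub>M leb)" "(\<lambda>z. g (snd z)) \<in> borel_measurable (leb \<Otimes>\<^sub>M leb)"
    using measurable_compose[OF measurable_fst Em] measurable_compose[OF measurable_snd gm] by auto
  note [measurable] = m1
  have "F = (\<lambda>z. if 0 \<le> fst z \<and> fst z \<le> x \<and> 0 \<le> snd z \<and> snd z \<le> fst z then E (fst z) * g (snd z) else 0)"
    by (auto simp: F_def fun_eq_iff indicator_def)
  also have "\<dots> \<in> borel_measurable (leb \<Otimes>\<^sub>M leb)"
    by measurable
  finally have Fm: "F \<in> borel_measurable (leb \<Otimes>\<^sub>M leb)" .
  have gp: "integrable (leb \<Otimes>\<^sub>M leb) (\<lambda>(t,s). B * norm (g s))"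
  proof (rule p.Fubini_integrable)
    show "(\<lambda>(t,s). B * norm (g s)) \<in> borel_measurable (leb \<Otimes>\<^sub>M leb)"
      unfolding case_prod_unfold by measurable
  qed (use g in auto)
  have Fi: "integrable (leb \<Otimes>\<^sub>M leb) F"
  proof (rule Bochner_Integration.integrable_bound[OF gp Fm])
    have "norm (F z) \<le> norm (case z of (t,s) \<Rightarrow> B * norm (g s))" if "z \<in> space (leb \<Otimes>\<^sub>M leb)" for z
      using that B by (auto simp: F_def space_pair_measure norm_mult indicator_def intro!: mult_right_mono)
    then show "AE z in leb \<Otimes>\<^sub>M leb. norm (F z) \<le> norm (case z of (t,s) \<Rightarrow> B * norm (g s))"
      by (rule AE_I2)
  qed
  have "integral\<^sup>L leb (\<lambda>s. integral\<^sup>L leb (\<lambda>t. indicator {0..x} t *\<^sub>R (indicator {0..t} s *\<^sub>R (E t * g s))))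
      = integral\<^sup>L leb (\<lambda>t. integral\<^sup>L leb (\<lambda>s. indicator {0..x} t *\<^sub>R (indicator {0..t} s *\<^sub>R (E t * g s))))"
    by (rule p.Fubini_integral) (use Fi in \<open>simp add: F_def\<close>)
  also have "\<dots> = integral\<^sup>L leb (\<lambda>t. indicator {0..x} t *\<^sub>R (E t * integral\<^sup>L (lebesgue_on {0..t}) g))"
  proof (rule Bochner_Integration.integral_cong[OF refl])
    fix t :: real assume "t \<in> space leb"
    then have t: "t \<in> {0..1}" by simp
    have "integral\<^sup>L leb (\<lambda>s. indicator {0..x} t *\<^sub>R (indicator {0..t} s *\<^sub>R (E t * g s)))
      = integral\<^sup>L leb (\<lambda>s. (of_real (indicator {0..x} t) * E t) * (indicator {0..t} s *\<^sub>R g s))"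
      by (rule Bochner_Integration.integral_cong[OF refl]) (simp add: scaleR_conv_of_real)
    also have "\<dots> = (of_real (indicator {0..x} t) * E t) * integral\<^sup>L leb (\<lambda>s. indicator {0..t} s *\<^sub>R g s)"
      by (rule integral_mult_right_zero)
    finally show "integral\<^sup>L leb (\<lambda>s. indicator {0..x} t *\<^sub>R (indicator {0..t} s *\<^sub>R (E t * g s)))
      = indicator {0..x} t *\<^sub>R (E t * integral\<^sup>L (lebesgue_on {0..t}) g)"
      by (simp add: integral_leb_sub[OF t] scaleR_conv_of_real)
  qed
  also have "\<dots> = integral\<^sup>L (lebesgue_on {0..x}) (\<lambda>t. E t * integral\<^sup>L (lebesgue_on {0..t}) g)"
    by (rule integral_leb_sub[OF x, symmetric])
  finally have 1: "integral\<^sup>L leb (\<lambda>s. integral\<^sup>L leb (\<lambda>t. indicator {0..x} t *\<^sub>R (indicator {0..t} s *\<^sub>R (E t * g s))))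
    = integral\<^sup>L (lebesgue_on {0..x}) (\<lambda>t. E t * integral\<^sup>L (lebesgue_on {0..t}) g)" .
  have "integral\<^sup>L leb (\<lambda>s. integral\<^sup>L leb (\<lambda>t. indicator {0..x} t *\<^sub>R (indicator {0..t} s *\<^sub>R (E t * g s))))
    = integral\<^sup>L leb (\<lambda>s. indicator {0..x} s *\<^sub>R (exp (- (\<nu> * s)) * g s - exp (- (\<nu> * x)) * g s))"
  proof (rule Bochner_Integration.integral_cong[OF refl])
    fix s :: real assume "s \<in> space leb"
    then have s: "s \<in> {0..1}" by simp
    have "integral\<^sup>L leb (\<lambda>t. indicator {0..x} t *\<^sub>R (indicator {0..t} s *\<^sub>R (E t * g s)))
      = integral\<^sup>L leb (\<lambda>t. (indicator {0..x} t *\<^sub>R (indicator {0..t} s *\<^sub>R E t)) * g s)"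
      by simp
    also have "\<dots> = integral\<^sup>L leb (\<lambda>t. indicator {0..x} t *\<^sub>R (indicator {0..t} s *\<^sub>R E t)) * g s"
      by (rule integral_mult_left_zero)
    finally show "integral\<^sup>L leb (\<lambda>t. indicator {0..x} t *\<^sub>R (indicator {0..t} s *\<^sub>R (E t * g s)))
      = indicator {0..x} s *\<^sub>R (exp (- (\<nu> * s)) * g s - exp (- (\<nu> * x)) * g s)"
      unfolding E_def integral_leb_exp[OF s x] by (simp add: algebra_simps)
  qed
  also have "\<dots> = integral\<^sup>L (lebesgue_on {0..x}) (\<lambda>s. exp (- (\<nu> * s)) * g s - exp (- (\<nu> * x)) * g s)"
    by (rule integral_leb_sub[OF x, symmetric])
  also have "\<dots> = integral\<^sup>L (lebesgue_on {0..x}) (\<lambda>s. exp (- (\<nu> * s)) * g s) - integral\<^sup>L (lebesgue_on {0..x}) (\<lambda>s. exp (- (\<nu> * x)) * g s)"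
  proof (intro Bochner_Integration.integral_diff integrable_leb_sub[OF _ x])
    have ec: "continuous_on {0..1} (\<lambda>s. exp (- (\<nu> * complex_of_real s)))" by (intro continuous_intros)
    obtain B' where B': "0 \<le> B'" "\<And>t. t \<in> {0..1} \<Longrightarrow> norm (exp (- (\<nu> * complex_of_real t))) \<le> B'"
      by (rule bounded_leb_continuous[OF ec]) blast
    show "integrable leb (\<lambda>s. exp (- (\<nu> * s)) * g s)"
    proof (rule Bochner_Integration.integrable_bound)
      show "integrable leb (\<lambda>s. B' * norm (g s))" using g by auto
      show "(\<lambda>s. exp (- (\<nu> * complex_of_real s)) * g s) \<in> borel_measurable leb"
        by (intro borel_measurable_times measurable_leb_continuous ec gm)
    qed (use B' in \<open>auto intro!: AE_I2 mult_right_mono simp: norm_mult\<close>)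
  qed (use g in auto)
  finally show ?thesis using 1 by (simp add: E_def diff_eq_eq add.commute)
qed

text \<open>Integrate exp(-\<nu> t) (\<nu> y + h) by parts. The primitive of \<nu> y + h is y -
  y(0), so the integrals containing \<nu> y cancel.\<close>

lemma variation_of_constants:
  fixes y h :: "real \<Rightarrow> complex"
  assumes h: "integrable leb h" and yc: "continuous_on {0..1} y"
    and y: "\<And>x. x \<in> {0..1} \<Longrightarrow> y x = y 0 + integral\<^sup>L (lebesgue_on {0..x}) (\<lambda>t. \<nu> * y t + h t)"
    and x: "x \<in> {0..1}"
  shows "exp (- (\<nu> * x)) * y x = y 0 + integral\<^sup>L (lebesgue_on {0..x}) (\<lambda>t. exp (- (\<nu> * t)) * h t)"
proof -
  have gi: "integrable leb (\<lambda>t. \<nu> * y t + h t)"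
    using h L2_integrable[OF L2_continuous[OF yc]] by auto
  let ?I = "\<lambda>f. integral\<^sup>L (lebesgue_on {0..x}) f"
  let ?e = "\<lambda>t::real. exp (- (\<nu> * t))"
  have ec: "continuous_on {0..1} ?e" by (intro continuous_intros)
  have i1: "integrable (lebesgue_on {0..x}) (\<lambda>t. \<nu> * ?e t * y t)"
    by (intro integrable_leb_sub[OF _ x] L2_integrable L2_continuous continuous_intros yc)
  have i2: "integrable (lebesgue_on {0..x}) (\<lambda>t. ?e t * h t)"
  proof (rule integrable_leb_sub[OF _ x])
    obtain B' where B': "0 \<le> B'" "\<And>t. t \<in> {0..1} \<Longrightarrow> norm (?e t) \<le> B'"
      by (rule bounded_leb_continuous[OF ec]) blast
    show "integrable leb (\<lambda>s. ?e s * h s)"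
    proof (rule Bochner_Integration.integrable_bound)
      show "integrable leb (\<lambda>s. B' * norm (h s))" using h by auto
      show "(\<lambda>s. ?e s * h s) \<in> borel_measurable leb"
        by (intro borel_measurable_times measurable_leb_continuous ec borel_measurable_integrable[OF h])
    qed (use B' in \<open>auto intro!: AE_I2 mult_right_mono simp: norm_mult\<close>)
  qed
  have i3: "integrable (lebesgue_on {0..x}) (\<lambda>t. \<nu> * ?e t * y 0)"
    by (intro integrable_leb_sub[OF _ x] L2_integrable L2_continuous continuous_intros)
  have "?I (\<lambda>t. ?e t * (\<nu> * y t + h t)) = ?e x * ?I (\<lambda>t. \<nu> * y t + h t)
     + ?I (\<lambda>t. \<nu> * ?e t * integral\<^sup>L (lebesgue_on {0..t}) (\<lambda>t. \<nu> * y t + h t))"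
    by (rule integral_by_parts_exp[OF gi x])
  also have "?I (\<lambda>t. \<nu> * ?e t * integral\<^sup>L (lebesgue_on {0..t}) (\<lambda>t. \<nu> * y t + h t)) = ?I (\<lambda>t. \<nu> * ?e t * y t - \<nu> * ?e t * y 0)"
  proof (rule Bochner_Integration.integral_cong[OF refl])
    fix t assume "t \<in> space (lebesgue_on {0..x})"
    then have "t \<in> {0..1}" using x by auto
    from y[OF this] have "integral\<^sup>L (lebesgue_on {0..t}) (\<lambda>t. \<nu> * y t + h t) = y t - y 0"
      by (metis add_diff_cancel_left')
    then show "\<nu> * ?e t * integral\<^sup>L (lebesgue_on {0..t}) (\<lambda>t. \<nu> * y t + h t) = \<nu> * ?e t * y t - \<nu> * ?e t * y 0"
      by (simp only: right_diff_distrib)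
  qed
  also have "\<dots> = ?I (\<lambda>t. \<nu> * ?e t * y t) - ?I (\<lambda>t. \<nu> * ?e t * y 0)"
    by (rule Bochner_Integration.integral_diff[OF i1 i3])
  also have "?I (\<lambda>t. \<nu> * ?e t * y 0) = (1 - ?e x) * y 0"
  proof -
    have "?I (\<lambda>t. \<nu> * ?e t) = integral\<^sup>L leb (\<lambda>t. indicator {0..x} t *\<^sub>R (\<nu> * ?e t))"
      by (rule integral_leb_sub[OF x])
    \<comment> \<open>The inserted \<open>indicator {0..t} 0\<close> equals 1 on the range of
      integration; it brings the integrand into the form of \<open>integral_leb_exp\<close> at
      \<open>s = 0\<close>.\<close>
    also have "\<dots> = integral\<^sup>L leb (\<lambda>t. indicator {0..x} t *\<^sub>R (indicator {0..t} 0 *\<^sub>R (\<nu> * ?e t)))"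
      by (rule Bochner_Integration.integral_cong) auto
    also have "\<dots> = 1 - ?e x" using integral_leb_exp[of 0 x \<nu>] x by simp
    finally show ?thesis by simp
  qed
  also have "?I (\<lambda>t. \<nu> * y t + h t) = y x - y 0"
    using y[OF x] by (metis add_diff_cancel_left')
  also have "?I (\<lambda>t. ?e t * (\<nu> * y t + h t)) = ?I (\<lambda>t. \<nu> * ?e t * y t + ?e t * h t)"
    by (simp add: algebra_simps)
  also have "\<dots> = ?I (\<lambda>t. \<nu> * ?e t * y t) + ?I (\<lambda>t. ?e t * h t)"
    by (rule Bochner_Integration.integral_add[OF i1 i2])
  finally show ?thesis by (simp add: algebra_simps)
qed

text \<open>A mode damped at rate K is controlled from the left end: in the variation of constants
  formula the kernel exp(\<nu> (x - t)) runs over t \<le> x and is at most exp(-K |x - t|).\<close>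

lemma decay_forward:
  fixes y h :: "real \<Rightarrow> complex"
  assumes h: "h \<in> L2" and yc: "continuous_on {0..1} y"
    and y: "\<And>x. x \<in> {0..1} \<Longrightarrow> y x = y 0 + integral\<^sup>L (lebesgue_on {0..x}) (\<lambda>t. \<nu> * y t + h t)"
    and x: "x \<in> {0..1}" and K: "K > 0" "Re \<nu> \<le> - K"
  shows "norm (y x) \<le> exp (- (K * x)) * norm (y 0) + L2norm h / sqrt K"
proof -
  let ?e = "\<lambda>t::real. exp (- (\<nu> * t))"
  let ?J = "integral\<^sup>L leb (\<lambda>t. exp (\<nu> * x) * (indicator {0..x} t *\<^sub>R (?e t * h t)))"
  have vc: "?e x * y x = y 0 + integral\<^sup>L (lebesgue_on {0..x}) (\<lambda>t. ?e t * h t)"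
    by (rule variation_of_constants[OF L2_integrable[OF h] yc _ x]) (rule y)
  have "y x = exp (\<nu> * x) * (?e x * y x)" by (simp flip: exp_add mult.assoc)
  also have "\<dots> = exp (\<nu> * x) * y 0 + exp (\<nu> * x) * integral\<^sup>L leb (\<lambda>t. indicator {0..x} t *\<^sub>R (?e t * h t))"
    unfolding vc integral_leb_sub[OF x]
    by (simp add: distrib_left)
  also have "exp (\<nu> * x) * integral\<^sup>L leb (\<lambda>t. indicator {0..x} t *\<^sub>R (?e t * h t)) = ?J"
    by (rule integral_mult_right_zero[symmetric])
  finally have eq: "y x = exp (\<nu> * x) * y 0 + ?J" .
  have "norm ?J \<le> L2norm h / sqrt K"
  proof (rule kernel_bound[OF K(1) x h])
    fix t :: real assume t: "t \<in> {0..1}"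
    show "norm (exp (\<nu> * x) * (indicator {0..x} t *\<^sub>R (?e t * h t))) \<le> exp (- K * \<bar>x - t\<bar>) * norm (h t)"
    proof (cases "t \<le> x")
      case True
      have "norm (exp (\<nu> * x) * (?e t * h t)) = exp (Re \<nu> * (x - t)) * norm (h t)"
      proof -
        have "exp (\<nu> * x) * ?e t = exp (\<nu> * complex_of_real (x - t))"
          by (simp add: algebra_simps flip: exp_add)
        then show ?thesis by (simp only: mult.assoc[symmetric] norm_mult norm_exp_eq_Re) simp
      qed
      also have "\<dots> \<le> exp (- K * (x - t)) * norm (h t)"
        using True mult_right_mono[OF K(2), of "x - t"] by (intro mult_right_mono) auto
      finally show ?thesis using True t by simp
    qed auto
  qed
  moreover have "norm (exp (\<nu> * x) * y 0) \<le> exp (- (K * x)) * norm (y 0)"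
    using K x mult_right_mono[of "Re \<nu>" "-K" x] by (auto simp: norm_mult intro!: mult_right_mono)
  ultimately show ?thesis unfolding eq using norm_triangle_ineq[of "exp (\<nu> * x) * y 0" ?J] by linarith
qed

text \<open>The mirror image of \<open>decay_forward\<close>: a mode growing at rate K is controlled
  from the right end. Subtracting the formulas at 1 and at \<open>x\<close> leaves an integral over
  t > x.\<close>

lemma decay_backward:
  fixes y h :: "real \<Rightarrow> complex"
  assumes h: "h \<in> L2" and yc: "continuous_on {0..1} y"
    and y: "\<And>x. x \<in> {0..1} \<Longrightarrow> y x = y 0 + integral\<^sup>L (lebesgue_on {0..x}) (\<lambda>t. \<nu> * y t + h t)"
    and x: "x \<in> {0..1}" and K: "K > 0" "Re \<nu> \<ge> K"
  shows "norm (y x) \<le> exp (- (K * (1 - x))) * norm (y 1) + L2norm h / sqrt K"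
proof -
  let ?e = "\<lambda>t::real. exp (- (\<nu> * t))"
  let ?J = "integral\<^sup>L leb (\<lambda>t. exp (\<nu> * x) * (indicator {x<..1} t *\<^sub>R (?e t * h t)))"
  have vc: "?e x * y x = y 0 + integral\<^sup>L (lebesgue_on {0..x}) (\<lambda>t. ?e t * h t)" if x: "x \<in> {0..1}" for x
    by (rule variation_of_constants[OF L2_integrable[OF h] yc _ x]) (rule y)
  have one: "(1::real) \<in> {0..1}" by simp
  have hi: "integrable leb (\<lambda>t. ?e t * h t)"
  proof -
    have ec: "?e \<in> L2" by (intro L2_continuous continuous_intros)
    have "integrable leb (\<lambda>t. norm (?e t) * norm (h t))" by (rule L2_mult_integrable[OF ec h])
    then show ?thesis
      by (rule Bochner_Integration.integrable_bound)
         (auto simp: norm_mult intro!: borel_measurable_times[OF L2D(1)[OF ec] L2D(1)[OF h]])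
  qed
  have sub: "{0..u} \<in> sets leb" if "u \<in> {0..1}" for u
    using that by (auto simp: sets_restrict_space image_iff intro!: exI[of _ "{0..u}"])
  have "?e 1 * y 1 - ?e x * y x = integral\<^sup>L leb (\<lambda>t. ?e t * h t) - integral\<^sup>L leb (\<lambda>t. indicator {0..x} t *\<^sub>R (?e t * h t))"
    unfolding vc[OF x] vc[OF one] integral_leb_sub[OF x] by simp
  also have "\<dots> = integral\<^sup>L leb (\<lambda>t. ?e t * h t - indicator {0..x} t *\<^sub>R (?e t * h t))"
    by (rule Bochner_Integration.integral_diff[symmetric]) (intro integrable_mult_indicator sub x hi)+
  also have "\<dots> = integral\<^sup>L leb (\<lambda>t. indicator {x<..1} t *\<^sub>R (?e t * h t))"
    by (rule Bochner_Integration.integral_cong) (use x in \<open>auto simp: indicator_def\<close>)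
  finally have "exp (\<nu> * x) * (?e 1 * y 1 - ?e x * y x) = ?J"
    by (simp only: integral_mult_right_zero)
  moreover have "exp (\<nu> * x) * (?e 1 * y 1 - ?e x * y x) = exp (- (\<nu> * (1 - x))) * y 1 - y x"
    by (simp add: algebra_simps flip: exp_add mult.assoc)
  ultimately have eq: "y x = exp (- (\<nu> * (1 - x))) * y 1 - ?J" by (simp add: algebra_simps)
  have "norm ?J \<le> L2norm h / sqrt K"
  proof (rule kernel_bound[OF K(1) x h])
    fix t :: real assume t: "t \<in> {0..1}"
    show "norm (exp (\<nu> * x) * (indicator {x<..1} t *\<^sub>R (?e t * h t))) \<le> exp (- K * \<bar>x - t\<bar>) * norm (h t)"
    proof (cases "t \<le> x")
      case False
      have "norm (exp (\<nu> * x) * (?e t * h t)) = exp (Re \<nu> * (x - t)) * norm (h t)"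
      proof -
        have "exp (\<nu> * x) * ?e t = exp (\<nu> * complex_of_real (x - t))"
          by (simp add: algebra_simps flip: exp_add)
        then show ?thesis by (simp only: mult.assoc[symmetric] norm_mult norm_exp_eq_Re) simp
      qed
      also have "\<dots> \<le> exp (K * (x - t)) * norm (h t)"
        using False mult_right_mono_neg[OF K(2), of "x - t"] by (intro mult_right_mono) auto
      also have "exp (K * (x - t)) = exp (- K * \<bar>x - t\<bar>)"
        using False by (simp add: algebra_simps)
      finally show ?thesis using False t by simp
    qed auto
  qed
  moreover have "norm (exp (- (\<nu> * (1 - x))) * y 1) \<le> exp (- (K * (1 - x))) * norm (y 1)"
    using K x mult_right_mono[of K "Re \<nu>" "1 - x"] by (auto simp: norm_mult intro!: mult_right_mono)
  ultimately show ?thesis unfolding eq using norm_triangle_ineq4[of "exp (- (\<nu> * (1 - x))) * y 1" ?J] by linarith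
qed

subsection \<open>The boundary value problem and its a priori estimate along a ray\<close>

definition diag_mat :: "('n \<Rightarrow> complex) \<Rightarrow> complex^'n^'n"
  where "diag_mat d = (\<chi> i j. if i = j then d i else 0)"

lemma diag_mat_vec [simp]: "(diag_mat d *v v) $ k = d k * v $ k"
  by (simp add: diag_mat_def matrix_vector_mult_def if_distrib[of "\<lambda>x. x * _"] cong: if_cong)

lemma diag_mat_mul [simp]: "(diag_mat d ** M) $ k $ j = d k * M $ k $ j"
  by (simp add: diag_mat_def matrix_matrix_mult_def if_distrib[of "\<lambda>x. x * _"] cong: if_cong)

lemma norm_diag_mat_scale: "norm (diag_mat (\<lambda>k. c * d k) :: complex^'n^'n) = norm c * norm (diag_mat d)"
proof -
  have "norm (diag_mat (\<lambda>k. c * d k) $ i) = norm c * norm (diag_mat d $ i)" for i :: 'n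
    unfolding norm_vec_def diag_mat_def
    by (simp add: L2_set_right_distrib norm_mult if_distrib[of norm] cong: if_cong)
       (rule L2_set_cong, auto simp: norm_mult)
  then show ?thesis unfolding norm_vec_def[where 'b='n and 'a="complex^'n"]
    by (simp add: L2_set_right_distrib)
qed

text \<open>\<open>a k\<close> is the inverse of the kth diagonal entry of B, so solving the
  equation for y' multiplies its kth component by \<open>\<i> * a k\<close>.\<close>

locale bvp =
  fixes a :: "'n::finite \<Rightarrow> complex" and C D :: "complex^'n^'n" and Q :: "real \<Rightarrow> complex^'n^'n"
  assumes Q: "Q \<in> L2" and a_nz: "a k \<noteq> 0"
begin

abbreviation IA :: "complex^'n^'n" where "IA \<equiv> diag_mat (\<lambda>k. \<i> * a k)"

text \<open>\<open>- i B y' + Q y - \<mu> y = f\<close>, solved for \<open>y'\<close> and integrated.\<close>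

definition sol :: "complex \<Rightarrow> (real \<Rightarrow> complex^'n) \<Rightarrow> (real \<Rightarrow> complex^'n) \<Rightarrow> bool"
  where "sol \<mu> f y \<longleftrightarrow> lin_sol (\<lambda>t. diag_mat (\<lambda>k. \<mu> * (\<i> * a k)) + - (IA ** Q t)) (\<lambda>t. IA *v f t) y"

lemma bounded_linear_IA_mul: "bounded_linear (\<lambda>M. - (IA ** M))"
  unfolding linear_conv_bounded_linear[symmetric]
  by (rule linearI) (auto simp: vec_eq_iff algebra_simps)

lemma IAQ: "(\<lambda>t. - (IA ** Q t)) \<in> L2"
  by (rule L2_linear[OF Q bounded_linear_IA_mul])

lemma IAf: "f \<in> L2 \<Longrightarrow> (\<lambda>t. IA *v f t) \<in> L2"
  by (rule L2_linear[OF _ bounded_linear_mat_vec])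

lemma coeff_L2: "(\<lambda>t. diag_mat (\<lambda>k. \<mu> * (\<i> * a k)) + - (IA ** Q t)) \<in> L2"
  by (intro L2_add L2_const IAQ)

lemma sol_continuous: "sol \<mu> f y \<Longrightarrow> continuous_on {0..1} y"
  by (simp add: sol_def lin_sol_def)

lemma sol_L2: "sol \<mu> f y \<Longrightarrow> y \<in> L2"
  by (intro L2_continuous sol_continuous)

lemma sol_exists:
  assumes "f \<in> L2" obtains y where "sol \<mu> f y" "y 0 = c"
  using lin_sol_exists[OF coeff_L2 IAf[OF assms]] unfolding sol_def by blast

lemma sol_unique:
  assumes "sol \<mu> f y" "sol \<mu> f z" "y 0 = z 0" "f \<in> L2" "x \<in> {0..1}"
  shows "y x = z x"
  by (rule lin_sol_unique[OF assms(1,2)[unfolded sol_def] assms(3) coeff_L2 IAf[OF assms(4)] assms(5)])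

lemma sol_comb:
  assumes "sol \<mu> f y" "sol \<mu> h z" "f \<in> L2" "h \<in> L2"
  shows "sol \<mu> (\<lambda>t. c *s f t + h t) (\<lambda>t. c *s y t + z t)"
  using lin_sol_comb[OF assms(1,2)[unfolded sol_def] coeff_L2 IAf[OF assms(3)] IAf[OF assms(4)], of c]
  unfolding sol_def by (simp add: matrix_vector_right_distrib vec.scale)

lemma L2norm_mat_vec_const:
  assumes "f \<in> L2"
  shows "L2norm (\<lambda>t. M *v f t) \<le> norm (M :: complex^'n^'n) * L2norm f"
proof -
  have "L2norm (\<lambda>t. M *v f t) \<le> L2norm (\<lambda>t. norm M *\<^sub>R f t)"
    by (rule L2norm_mono(2))
       (use norm_matrix_vector_le[of M] in \<open>auto intro!: AE_I2 L2_linear[OF assms] bounded_linear_scaleR_right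
           L2D(1)[OF L2_linear[OF assms bounded_linear_mat_vec]]\<close>)
  then show ?thesis by (simp add: L2norm_scaleR)
qed

text \<open>Chosen so that the weight \<open>2 * growth * (1 + norm \<mu>)\<close> meets the
  smallness condition of \<open>lin_sol_bound\<close>: the first summand pays for the constant
  coefficient, the square for the potential, with 1/4 each.\<close>

definition growth :: real where "growth = 4 * norm IA + (4 * L2norm (\<lambda>t. - (IA ** Q t)))\<^sup>2 + 1"

lemma growth_pos: "growth \<ge> 1"
  by (simp add: growth_def)

text \<open>The source of exponential type for every function of \<mu> below: the weight grows
  linearly in \<open>norm \<mu>\<close>, and the bound is exponential in the weight.\<close>

lemma sol_bound:
  assumes y: "sol \<mu> f y" and f: "f \<in> L2" and x: "x \<in> {0..1}"
  shows "norm (y x) \<le> 2 * exp (2 * growth * (1 + norm \<mu>)) * (norm (y 0) + norm IA * L2norm f)"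
proof -
  define K where "K = 2 * growth * (1 + norm \<mu>)"
  define q where "q = L2norm (\<lambda>t. - (IA ** Q t))"
  have g1: "growth \<ge> 1" by (rule growth_pos)
  have q0: "0 \<le> q" by (simp add: q_def)
  have "K \<ge> 2 * growth * 1" unfolding K_def using g1 by (intro mult_left_mono) auto
  then have K1: "K \<ge> 2 * growth" by simp
  then have K0: "K \<ge> 1" using g1 by linarith
  have "8 * (norm \<mu> * norm IA) \<le> K"
  proof -
    have "8 * (norm \<mu> * norm IA) \<le> 2 * ((4 * norm IA) * (1 + norm \<mu>))" by (simp add: algebra_simps)
    also have "\<dots> \<le> 2 * (growth * (1 + norm \<mu>))"
      by (intro mult_left_mono mult_right_mono) (auto simp: growth_def)
    finally show ?thesis by (simp add: K_def)
  qed
  then have 1: "2 * norm (diag_mat (\<lambda>k. \<mu> * (\<i> * a k)) :: complex^'n^'n) / K \<le> 1/4"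
    using K0 by (simp add: norm_diag_mat_scale pos_divide_le_eq)
  have "4 * q \<le> sqrt K"
  proof (rule real_le_rsqrt)
    have "(4 * q)\<^sup>2 \<le> 2 * growth"
      using zero_le_power2[of "4 * q"] norm_ge_zero[of IA]
      unfolding growth_def q_def[symmetric] by argo
    then show "(4 * q)\<^sup>2 \<le> K" using K1 by linarith
  qed
  then have 2: "q / sqrt K \<le> 1/4" using K0 by (simp add: pos_divide_le_eq)
  have "norm (y x) \<le> 2 * exp K * (norm (y 0) + L2norm (\<lambda>t. IA *v f t) / sqrt K)"
  proof (rule lin_sol_bound[OF _ _ IAQ IAf[OF f] y[unfolded sol_def] x])
    show "2 * norm (diag_mat (\<lambda>k. \<mu> * (\<i> * a k)) :: complex^'n^'n) / K + L2norm (\<lambda>t. - (IA ** Q t)) / sqrt K \<le> 1/2"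
      using 1 2 unfolding q_def by linarith
  qed (use K0 in simp)
  also have "L2norm (\<lambda>t. IA *v f t) / sqrt K \<le> L2norm (\<lambda>t. IA *v f t) / 1"
    using K0 by (intro divide_left_mono) auto
  also have "L2norm (\<lambda>t. IA *v f t) / 1 \<le> norm IA * L2norm f"
    using L2norm_mat_vec_const[OF f] by simp
  finally show ?thesis by (simp add: K_def)
qed

text \<open>Decouples the system into scalar equations by treating \<open>Q t *v y t\<close> as part
  of the inhomogeneity, the form needed for \<open>decay_forward\<close> and
  \<open>decay_backward\<close>.\<close>

lemma sol_component:
  assumes y: "sol \<mu> f y" and f: "f \<in> L2" and x: "x \<in> {0..1}"
  shows "y x $ k = y 0 $ k + integral\<^sup>L (lebesgue_on {0..x}) (\<lambda>t. (\<mu> * (\<i> * a k)) * (y t $ k) + \<i> * a k * (f t - Q t *v y t) $ k)"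
proof -
  let ?P = "\<lambda>t. diag_mat (\<lambda>k. \<mu> * (\<i> * a k)) + - (IA ** Q t)"
  have i: "integrable (lebesgue_on {0..x}) (\<lambda>t. ?P t *v y t + IA *v f t)"
    by (rule integrable_leb_sub[OF lin_sol_integrand[OF coeff_L2 IAf[OF f] sol_continuous[OF y]] x])
  have "y x = y 0 + integral\<^sup>L (lebesgue_on {0..x}) (\<lambda>t. ?P t *v y t + IA *v f t)"
    using y x unfolding sol_def lin_sol_def by blast
  then have "y x $ k = (y 0 + integral\<^sup>L (lebesgue_on {0..x}) (\<lambda>t. ?P t *v y t + IA *v f t)) $ k"
    by (rule arg_cong)
  also have "\<dots> = y 0 $ k + integral\<^sup>L (lebesgue_on {0..x}) (\<lambda>t. (?P t *v y t + IA *v f t) $ k)"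
    unfolding vector_add_component[of "y 0"] integral_bounded_linear[OF bounded_linear_vec_nth i] ..
  also have "(\<lambda>t. (?P t *v y t + IA *v f t) $ k) = (\<lambda>t. (\<mu> * (\<i> * a k)) * (y t $ k) + \<i> * a k * (f t - Q t *v y t) $ k)"
  proof
    fix t
    have Py: "?P t *v y t = diag_mat (\<lambda>k. \<mu> * (\<i> * a k)) *v y t - IA *v (Q t *v y t)"
      by (simp add: matrix_vector_mult_add_rdistrib matrix_vector_mul_assoc matrix_vector_mult_diff_rdistrib)
    show "(?P t *v y t + IA *v f t) $ k = (\<mu> * (\<i> * a k)) * (y t $ k) + \<i> * a k * (f t - Q t *v y t) $ k"
      unfolding vector_add_component Py vector_minus_component diag_mat_vec by (simp add: algebra_simps)
  qed
  finally show ?thesis .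
qed

text \<open>Each component is controlled by its value at the end from which it decays. Collect these
  values in \<open>c\<close> and those at the opposite ends in \<open>c'\<close>. The boundary
  condition reads T c + T' c' = 0 with T invertible, and decay makes c' small against c up to the
  error \<open>\<eta>\<close>; hence c = O(\<open>\<eta>\<close>) and so sup |y| =
  O(\<open>\<eta>\<close>). The part of \<open>\<eta>\<close> that contains sup |y| carries a factor
  1/s and is absorbed for large t.\<close>

lemma ray_estimate:
  assumes \<delta>: "\<delta> > 0" "\<And>k. \<bar>Re (\<omega> * (\<i> * a k))\<bar> \<ge> \<delta>"
    and T: "det (\<chi> i k. if Re (\<omega> * (\<i> * a k)) < 0 then C $ i $ k else D $ i $ k) \<noteq> 0"
  obtains t0 K where "t0 > 0" "K \<ge> 0" "\<And>t f y x. \<lbrakk>t \<ge> t0; f \<in> L2; sol (of_real t * \<omega>) f y; C *v y 0 + D *v y 1 = 0; x \<in> {0..1}\<rbrakk>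
    \<Longrightarrow> norm (y x) \<le> K * L2norm f / sqrt t"
proof -
  define fw where "fw k \<longleftrightarrow> Re (\<omega> * (\<i> * a k)) < 0" for k
  define T where "T = (\<chi> i k. if fw k then C $ i $ k else D $ i $ k)"
  define T' where "T' = (\<chi> i k. if fw k then D $ i $ k else C $ i $ k)"
  have "det T \<noteq> 0" using T by (simp add: T_def fw_def)
  then obtain S where inv: "S ** T = mat 1"
    using invertible_det_nz[of T] unfolding invertible_def by auto
  define N where "N = norm S * norm T'"
  have N0: "N \<ge> 0" by (simp add: N_def)
  define n where "n = real CARD('n)"
  have n1: "n \<ge> 1" unfolding n_def using one_le_card_finite[where 'a='n] by simp
  define \<alpha> where "\<alpha> = (\<Sum>k\<in>UNIV. norm (a k))"
  have \<alpha>: "norm (a k) \<le> \<alpha>" for k unfolding \<alpha>_def by (rule member_le_sum) auto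
  have \<alpha>0: "\<alpha> \<ge> 0" unfolding \<alpha>_def by (rule sum_nonneg) auto
  \<comment> \<open>The constant that results when \<open>norm c \<le> 2 * N * n * \<eta>\<close> is
    put into the sum of \<open>n\<close> component bounds \<open>norm c + \<eta>\<close>.\<close>
  define B where "B = n * (2 * N * n + 1) * \<alpha>"
  have B0: "B \<ge> 0" using n1 N0 \<alpha>0 by (simp add: B_def)
  \<comment> \<open>The second and third summand are the thresholds for the two absorptions, of
    \<open>norm c\<close> and of \<open>m\<close>; the first keeps \<open>s0\<close>
    positive.\<close>
  define s0 where "s0 = 1 + 2 * N * n + 2 * B * L2norm Q"
  have s0: "s0 > 0" using n1 N0 B0 by (auto simp: s0_def intro!: add_pos_nonneg)
  show ?thesis
  proof
    show "s0\<^sup>2 / \<delta> > 0" using s0 \<delta> by simp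
    show "2 * B / sqrt \<delta> \<ge> 0" using B0 \<delta> by simp
    fix t f y x
    assume t: "t \<ge> s0\<^sup>2 / \<delta>" and f: "f \<in> L2" and y: "sol (of_real t * \<omega>) f y"
      and bc: "C *v y 0 + D *v y 1 = 0" and x: "x \<in> {0..1::real}"
    have t0: "t > 0" using t \<open>s0\<^sup>2 / \<delta> > 0\<close> by linarith
    define s where "s = sqrt (\<delta> * t)"
    have "s0\<^sup>2 \<le> \<delta> * t" using t \<delta> by (simp add: pos_divide_le_eq mult.commute)
    then have ss: "s0 \<le> s" unfolding s_def by (rule real_le_rsqrt)
    have s: "s > 0" "2 * N * n \<le> s" "2 * B * L2norm Q \<le> s"
    proof -
      have "0 \<le> 2 * N * n" "0 \<le> 2 * B * L2norm Q" using n1 N0 B0 by simp_all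
      then show "s > 0" "2 * N * n \<le> s" "2 * B * L2norm Q \<le> s"
        using ss unfolding s0_def by linarith+
    qed
    have yc: "continuous_on {0..1} y" by (rule sol_continuous[OF y])
    then have "continuous_on {0..1} (\<lambda>x. norm (y x))" by (intro continuous_intros)
    then obtain x0 where x0: "x0 \<in> {0..1}" "\<And>x. x \<in> {0..1} \<Longrightarrow> norm (y x) \<le> norm (y x0)"
      using continuous_attains_sup[of "{0..1::real}" "\<lambda>x. norm (y x)"] by auto
    define m where "m = norm (y x0)"
    have m0: "m \<ge> 0" by (simp add: m_def)
    \<comment> \<open>Common bound for what the inhomogeneities contribute to the components; it
      still contains the unknown maximum \<open>m\<close> through the potential.\<close>
    define \<eta> where "\<eta> = \<alpha> * (L2norm f + m * L2norm Q) / s"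
    have \<eta>0: "\<eta> \<ge> 0" using \<alpha>0 m0 s by (simp add: \<eta>_def)
    define h where "h k = (\<lambda>t. \<i> * a k * (f t - Q t *v y t) $ k)" for k
    have Qy: "(\<lambda>t. Q t *v y t) \<in> L2" "L2norm (\<lambda>t. Q t *v y t) \<le> m * L2norm Q"
      using L2_mat_vec[OF Q measurable_leb_continuous[OF yc], of m] x0 m0 by (auto simp: m_def)
    have fQ: "(\<lambda>t. f t - Q t *v y t) \<in> L2" by (rule L2_diff[OF f Qy(1)])
    have fQn: "L2norm (\<lambda>t. f t - Q t *v y t) \<le> L2norm f + m * L2norm Q"
    proof -
      have "L2norm (\<lambda>t. f t + - (Q t *v y t)) \<le> L2norm f + L2norm (\<lambda>t. - (Q t *v y t))"
        by (rule L2norm_triangle[OF f L2_uminus[OF Qy(1)]])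
      also have "L2norm (\<lambda>t. - (Q t *v y t)) = L2norm (\<lambda>t. Q t *v y t)" by (simp add: L2norm_def)
      finally show ?thesis using Qy(2) by simp
    qed
    have hL: "h k \<in> L2" for k unfolding h_def
      by (rule L2_linear[OF fQ]) (intro bounded_linear_const_mult bounded_linear_vec_nth)
    have hb: "L2norm (h k) / s \<le> \<eta>" for k
    proof -
      have "L2norm (h k) \<le> L2norm (\<lambda>t. \<alpha> *\<^sub>R (f t - Q t *v y t))"
      proof (rule L2norm_mono(2)[OF L2D(1)[OF hL] L2_linear[OF fQ bounded_linear_scaleR_right] AE_I2])
        fix t
        have "norm (h k t) = norm (a k) * norm ((f t - Q t *v y t) $ k)" by (simp add: h_def norm_mult)
        also have "\<dots> \<le> \<alpha> * norm (f t - Q t *v y t)"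
          by (intro mult_mono \<alpha> Finite_Cartesian_Product.norm_nth_le \<alpha>0) auto
        finally show "norm (h k t) \<le> norm (\<alpha> *\<^sub>R (f t - Q t *v y t))" using \<alpha>0 by simp
      qed
      also have "\<dots> = \<alpha> * L2norm (\<lambda>t. f t - Q t *v y t)" using \<alpha>0 by (simp only: L2norm_scaleR abs_of_nonneg)
      also have "\<dots> \<le> \<alpha> * (L2norm f + m * L2norm Q)" by (intro mult_left_mono fQn \<alpha>0)
      finally show ?thesis unfolding \<eta>_def using s by (intro divide_right_mono) auto
    qed
    have eqk: "y x $ k = y 0 $ k + integral\<^sup>L (lebesgue_on {0..x}) (\<lambda>u. (of_real t * \<omega> * (\<i> * a k)) * (y u $ k) + h k u)"
      if "x \<in> {0..1}" for x k
      using sol_component[OF y f that, of k] by (simp add: h_def)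
    have yk: "continuous_on {0..1} (\<lambda>x. y x $ k)" for k by (intro continuous_intros yc)
    have Re_scale: "Re (of_real t * \<omega> * (\<i> * a k)) = t * Re (\<omega> * (\<i> * a k))" for k
      by (simp add: mult.assoc)
    have \<delta>t: "\<delta> * t > 0" using \<delta> t0 by simp
    have fwd: "norm (y x $ k) \<le> exp (- (\<delta> * t * x)) * norm (y 0 $ k) + \<eta>" if "fw k" "x \<in> {0..1}" for x k
    proof -
      have "Re (\<omega> * (\<i> * a k)) \<le> - \<delta>" using \<delta>(2)[of k] that(1) by (auto simp: fw_def)
      then have "t * Re (\<omega> * (\<i> * a k)) \<le> t * (- \<delta>)" using t0 by (intro mult_left_mono) auto
      then have "Re (of_real t * \<omega> * (\<i> * a k)) \<le> - (\<delta> * t)" unfolding Re_scale by (simp add: mult.commute)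
      from decay_forward[OF hL yk eqk that(2) \<delta>t this] hb[of k]
      show ?thesis by (simp add: s_def)
    qed
    have bwd: "norm (y x $ k) \<le> exp (- (\<delta> * t * (1 - x))) * norm (y 1 $ k) + \<eta>" if "\<not> fw k" "x \<in> {0..1}" for x k
    proof -
      have "Re (\<omega> * (\<i> * a k)) \<ge> \<delta>" using \<delta>(2)[of k] that(1) by (auto simp: fw_def)
      then have "t * Re (\<omega> * (\<i> * a k)) \<ge> t * \<delta>" using t0 by (intro mult_left_mono) auto
      then have "Re (of_real t * \<omega> * (\<i> * a k)) \<ge> \<delta> * t" unfolding Re_scale by (simp add: mult.commute)
      from decay_backward[OF hL yk eqk that(2) \<delta>t this] hb[of k]
      show ?thesis by (simp add: s_def)
    qed
    define c where "c = (\<chi> k. if fw k then y 0 $ k else y 1 $ k)"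
    define c' where "c' = (\<chi> k. if fw k then y 1 $ k else y 0 $ k)"
    \<comment> \<open>The decay across the whole interval, weakened to the power that the argument
      uses: s \<le> 1 + s^2 \<le> exp(s^2).\<close>
    have es: "exp (- (\<delta> * t)) \<le> 1 / s"
    proof -
      have "s\<^sup>2 = \<delta> * t" using \<delta>t by (simp add: s_def)
      moreover have "s \<le> 1 + s\<^sup>2"
        using sum_squares_bound[of s 1] s(1) by (simp add: power2_eq_square)
      moreover have "1 + \<delta> * t \<le> exp (\<delta> * t)" by (rule exp_ge_add_one_self)
      ultimately have "s \<le> exp (\<delta> * t)" by linarith
      then show ?thesis using s(1) by (simp add: exp_minus divide_inverse le_imp_inverse_le)
    qed
    have ck: "norm (c $ k) \<le> norm c" for k by (rule Finite_Cartesian_Product.norm_nth_le)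
    have c'k: "norm (c' $ k) \<le> norm c / s + \<eta>" for k
    proof -
      have "norm (c' $ k) \<le> exp (- (\<delta> * t)) * norm (c $ k) + \<eta>"
        using fwd[of k 1] bwd[of k 0] by (auto simp: c_def c'_def)
      also have "exp (- (\<delta> * t)) * norm (c $ k) \<le> 1 / s * norm c"
        using s by (intro mult_mono es ck) auto
      finally show ?thesis by simp
    qed
    have c'n: "norm c' \<le> n * (norm c / s + \<eta>)"
    proof -
      have "norm c' \<le> (\<Sum>k\<in>UNIV. norm (c' $ k))" by (rule norm_vec_sum_le)
      also have "\<dots> \<le> (\<Sum>k\<in>(UNIV::'n set). norm c / s + \<eta>)" by (rule sum_mono) (rule c'k)
      finally show ?thesis by (simp add: n_def)
    qed
    \<comment> \<open>Regroups the columns of C and D by decay direction; this is where the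
      selection of columns in T matches the ends chosen in \<open>c\<close>.\<close>
    have "T *v c + T' *v c' = C *v y 0 + D *v y 1"
      unfolding vec_eq_iff
      by (auto simp: matrix_vector_mult_def T_def T'_def c_def c'_def simp flip: sum.distrib intro!: sum.cong)
    then have "T *v c = - (T' *v c')" using bc by (simp add: eq_neg_iff_add_eq_0)
    then have "S *v (T *v c) = - (S *v (T' *v c'))"
      by (simp add: vec.neg)
    then have "c = - (S *v (T' *v c'))"
      by (simp add: matrix_vector_mul_assoc inv)
    then have "norm c = norm (S *v (T' *v c'))" by (metis norm_minus_cancel)
    also have "\<dots> \<le> norm (S) * (norm T' * norm c')"
      by (rule order_trans[OF norm_matrix_vector_le]) (intro mult_left_mono norm_matrix_vector_le norm_ge_zero)
    also have "\<dots> = N * norm c'" by (simp add: N_def)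
    also have "\<dots> \<le> N * (n * (norm c / s + \<eta>))" by (intro mult_left_mono c'n N0)
    \<comment> \<open>Because \<open>2 * N * n \<le> s\<close>, the first summand is at most half of
      \<open>norm c\<close>.\<close>
    finally have "norm c \<le> (2 * N * n) * (norm c / s) / 2 + N * n * \<eta>" by (simp add: algebra_simps)
    also have "(2 * N * n) * (norm c / s) \<le> s * (norm c / s)" using s by (intro mult_right_mono) auto
    also have "s * (norm c / s) = norm c" using s by simp
    finally have cn: "norm c \<le> 2 * N * n * \<eta>" by simp
    have "m \<le> (\<Sum>k\<in>UNIV. norm (y x0 $ k))" unfolding m_def by (rule norm_vec_sum_le)
    also have "\<dots> \<le> (\<Sum>k\<in>(UNIV::'n set). norm c + \<eta>)"
    proof (rule sum_mono)
      fix k :: 'n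
      show "norm (y x0 $ k) \<le> norm c + \<eta>"
      proof (cases "fw k")
        case True
        have "exp (- (\<delta> * t * x0)) * norm (y 0 $ k) \<le> 1 * norm c"
          using \<delta>t x0(1) ck[of k] True by (intro mult_mono) (auto simp: c_def)
        then show ?thesis using fwd[OF True x0(1)] by simp
      next
        case False
        have "exp (- (\<delta> * t * (1 - x0))) * norm (y 1 $ k) \<le> 1 * norm c"
          using \<delta>t x0(1) ck[of k] False by (intro mult_mono) (auto simp: c_def)
        then show ?thesis using bwd[OF False x0(1)] by simp
      qed
    qed
    also have "\<dots> = n * (norm c + \<eta>)" by (simp add: n_def)
    also have "\<dots> \<le> n * (2 * N * n * \<eta> + \<eta>)" using cn n1 by (intro mult_left_mono) auto
    also have "\<dots> = B * (L2norm f + m * L2norm Q) / s" by (simp add: B_def \<eta>_def algebra_simps add_divide_distrib)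
    finally have "m * s \<le> B * (L2norm f + m * L2norm Q)" using s by (simp add: pos_le_divide_eq)
    \<comment> \<open>The potential thus accounts for at most half of \<open>m * s\<close>.\<close>
    moreover have "(2 * B * L2norm Q) * m \<le> s * m" using s m0 by (intro mult_right_mono)
    ultimately have "m * s \<le> 2 * B * L2norm f" by (simp add: algebra_simps)
    then have "m \<le> 2 * B * L2norm f / s" using s by (simp add: pos_le_divide_eq)
    also have "\<dots> = 2 * B / sqrt \<delta> * L2norm f / sqrt t" by (simp add: s_def real_sqrt_mult)
    finally show "norm (y x) \<le> 2 * B / sqrt \<delta> * L2norm f / sqrt t" using x0(2)[OF x] by (simp add: m_def)
  qed
qed

end

subsection \<open>Quotients of functions of exponential type\<close>

text \<open>The hypothesis places \<open>w\<close> in the pseudohyperbolic disc of radius 1/2 about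
  \<open>w0\<close> in the left half-plane; real parts there differ by a factor of at most (1 + 1/2)
  / (1 - 1/2) = 3.\<close>

lemma pos_real_part_quotient:
  fixes w w0 :: complex
  assumes "Re w < 0" "Re w0 < 0" "norm (w - w0) \<le> 1/2 * norm (w + cnj w0)"
  shows "Re w \<ge> 3 * Re w0"
proof -
  define p p0 d where "p = - Re w" and "p0 = - Re w0" and "d = Im w - Im w0"
  have "(norm (w - w0))\<^sup>2 \<le> (1/2 * norm (w + cnj w0))\<^sup>2"
    by (intro power_mono assms) auto
  then have "(p - p0)\<^sup>2 + d\<^sup>2 \<le> ((p + p0)\<^sup>2 + d\<^sup>2) / 4"
    unfolding power_mult_distrib cmod_power2 by (simp add: p_def p0_def d_def power2_eq_square algebra_simps)
  moreover have "((p + p0) / 2)\<^sup>2 = (p + p0)\<^sup>2 / 4" by (simp add: power_divide)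
  ultimately have "(p - p0)\<^sup>2 \<le> ((p + p0) / 2)\<^sup>2"
    using zero_le_power2[of d] by argo
  then have "p - p0 \<le> (p + p0) / 2"
    by (rule power2_le_imp_le) (use assms in \<open>simp add: p_def p0_def\<close>)
  then show ?thesis by (simp add: p_def p0_def)
qed

text \<open>Harnack's inequality for the negative harmonic function log(|G| / M): on the disc of
  half the radius it is at least three times its value at the centre, and exponentiating turns the 3
  into a cube. It is derived from the Schwarz lemma.\<close>

lemma harnack_lower_bound:
  fixes G :: "complex \<Rightarrow> complex"
  assumes hol: "G holomorphic_on ball 0 \<rho>" and \<rho>: "\<rho> > 0"
    and nz: "\<And>z. norm z < \<rho> \<Longrightarrow> G z \<noteq> 0" and M: "\<And>z. norm z < \<rho> \<Longrightarrow> norm (G z) < M"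
    and z: "norm z \<le> \<rho> / 2"
  shows "norm (G z) \<ge> M * (norm (G 0) / M) ^ 3"
proof -
  have M0: "M > 0" using M[of 0] \<rho> by (auto intro: le_less_trans[OF norm_ge_zero])
  \<comment> \<open>A zero-free holomorphic function on a disc has a logarithm.\<close>
  have "simply_connected (ball (0::complex) \<rho>)" by (rule convex_imp_simply_connected) simp
  then obtain h where h: "h holomorphic_on ball 0 \<rho>" "\<And>z. z \<in> ball 0 \<rho> \<Longrightarrow> G z = exp (h z)"
    using hol nz unfolding simply_connected_eq_holomorphic_log[OF open_ball] by (auto simp: dist_norm)
  define w where "w z = h z - of_real (ln M)" for z
  have nG: "norm (G z) = M * exp (Re (w z))" if "norm z < \<rho>" for z
    using h(2)[of z] that M0 by (simp add: w_def exp_diff)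
  have wneg: "Re (w z) < 0" if "norm z < \<rho>" for z
  proof -
    have "M * exp (Re (w z)) < M * 1" using M[OF that] nG[OF that] by simp
    then have "exp (Re (w z)) < 1" using M0 by (simp only: mult_less_cancel_left_pos)
    then show ?thesis by simp
  qed
  define w0 where "w0 = w 0"
  have w0: "Re w0 < 0" using wneg[of 0] \<rho> by (simp add: w0_def)
  \<comment> \<open>A Cayley transform of the left half-plane onto the unit disc taking
    \<open>w0\<close> to 0, so that the Schwarz lemma applies after rescaling the disc of radius
    \<rho>.\<close>
  define s where "s \<zeta> = (w (\<rho> * \<zeta>) - w0) / (w (\<rho> * \<zeta>) + cnj w0)" for \<zeta> :: complex
  have in_ball: "norm (\<rho> * \<zeta>) < \<rho>" if "norm \<zeta> < 1" for \<zeta> :: complex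
    using that \<rho> by (simp add: norm_mult)
  have den: "w (\<rho> * \<zeta>) + cnj w0 \<noteq> 0" if "norm \<zeta> < 1" for \<zeta> :: complex
  proof
    assume "w (\<rho> * \<zeta>) + cnj w0 = 0"
    then have "Re (w (\<rho> * \<zeta>)) + Re w0 = 0" by (metis complex_cnj_cnj cnj.sel(1) plus_complex.sel(1) zero_complex.sel(1))
    then show False using wneg[OF in_ball[OF that]] w0 by linarith
  qed
  have s_hol: "s holomorphic_on ball 0 1"
    unfolding s_def w_def
    by (intro holomorphic_intros holomorphic_on_compose_gen[OF _ h(1), unfolded o_def])
       (use in_ball den[unfolded w_def] in auto)
  have s1: "norm (s \<zeta>) < 1" if "norm \<zeta> < 1" for \<zeta> :: complex
  proof -
    let ?W = "w (\<rho> * \<zeta>)"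
    have W: "Re ?W < 0" by (rule wneg[OF in_ball[OF that]])
    have "(norm (?W - w0))\<^sup>2 < (norm (?W + cnj w0))\<^sup>2"
      unfolding cmod_power2 using mult_neg_neg[OF W w0] by (simp add: power2_eq_square algebra_simps)
    then have "norm (?W - w0) < norm (?W + cnj w0)" by (rule power2_less_imp_less) simp
    then show ?thesis using den[OF that] by (simp add: s_def norm_divide)
  qed
  define \<zeta> where "\<zeta> = z / of_real \<rho>"
  have \<zeta>: "norm \<zeta> \<le> 1/2" "\<rho> * \<zeta> = z" using z \<rho> by (auto simp: \<zeta>_def norm_divide field_simps)
  have "norm (s \<zeta>) \<le> norm \<zeta>"
    by (rule Schwarz_Lemma(1)[OF s_hol _ s1]) (use \<zeta> in \<open>auto simp: s_def w0_def\<close>)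
  then have "norm (w z - w0) \<le> norm \<zeta> * norm (w z + cnj w0)"
    using den[of \<zeta>] \<zeta> by (simp add: s_def norm_divide pos_divide_le_eq)
  also have "\<dots> \<le> 1/2 * norm (w z + cnj w0)" using \<zeta> by (intro mult_right_mono) auto
  finally have "Re (w z) \<ge> 3 * Re w0"
    by (intro pos_real_part_quotient wneg w0) (use z \<rho> in auto)
  then have "M * exp (Re (w z)) \<ge> M * exp (3 * Re w0)" using M0 by simp
  moreover have "exp (3 * Re w0) = (norm (G 0) / M) ^ 3"
    using nG[of 0] \<rho> M0 by (simp add: w0_def exp_of_nat_mult[of 3, simplified])
  ultimately show ?thesis using nG[of z] z \<rho> by simp
qed

lemma norm_le_on_cball:
  fixes f :: "complex \<Rightarrow> complex"
  assumes "f holomorphic_on UNIV" "\<And>z. norm z = R \<Longrightarrow> norm (f z) \<le> M" "norm z \<le> R" "R > 0"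
  shows "norm (f z) \<le> M"
proof (rule maximum_modulus_frontier[of f "cball 0 R"])
  show "f holomorphic_on interior (cball 0 R)" using assms(1) by (rule holomorphic_on_subset) auto
  show "continuous_on (closure (cball 0 R)) f"
    using assms(1) by (intro holomorphic_on_imp_continuous_on holomorphic_on_subset[OF assms(1)]) auto
qed (use assms in auto)

text \<open>Zeros of \<open>G\<close> in the half disc are removed one at a time by Blaschke factors: this keeps
  \<open>norm G\<close> on the circle and at least doubles \<open>norm (G 0) \<le> M\<close>, so it stops.\<close>

lemma quotient_bound_aux:
  fixes F :: "complex \<Rightarrow> complex"
  assumes F: "F holomorphic_on UNIV" and R: "R > 0" and M: "M > 0"
  shows "\<lbrakk>G holomorphic_on UNIV; \<And>z. norm z = R \<Longrightarrow> norm (G z) \<le> M; \<And>z. norm z = R \<Longrightarrow> norm (F z * G z) \<le> M;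
    G 0 \<noteq> 0; M < norm (G 0) * 2 ^ k; norm z \<le> R / 4\<rbrakk> \<Longrightarrow> norm (F z) \<le> (2 * M / norm (G 0)) ^ 3"
proof (induction k arbitrary: G)
  case 0
  \<comment> \<open>An impossible case: the maximum principle contradicts
    \<open>M < norm (G 0) * 2 ^ 0\<close>.\<close>
  then have "norm (G 0) \<le> M" using norm_le_on_cball[of G R M 0] R by auto
  then show ?case using 0 by simp
next
  case (Suc k)
  note G = Suc.prems(1)
  show ?case
  proof (cases "\<exists>a. norm a \<le> R / 2 \<and> G a = 0")
    case True
    then obtain a where a: "norm a \<le> R / 2" "G a = 0" by auto
    have a0: "a \<noteq> 0" using Suc.prems(4) a by auto
    define G1 where "G1 z = (if z = a then deriv G a else (G z - G a) / (z - a))" for z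
    have G1: "G1 holomorphic_on UNIV" unfolding G1_def by (rule pole_lemma_open[OF G]) simp
    have GG1: "G z = (z - a) * G1 z" for z using a by (simp add: G1_def)
    \<comment> \<open>The factor (R^2 - cnj a z) / (R (z - a)) has modulus 1 on the circle and
      modulus R / |a| \<ge> 2 at 0.\<close>
    define H where "H z = G1 z * ((of_real (R\<^sup>2) - cnj a * z) / of_real R)" for z
    have H: "H holomorphic_on UNIV" unfolding H_def by (intro holomorphic_intros G1) (use R in auto)
    have bl: "norm (of_real (R\<^sup>2) - cnj a * z) = R * norm (z - a)" if "norm z = R" for z
    proof -
      have "of_real (R\<^sup>2) - cnj a * z = z * cnj (z - a)"
        using that complex_norm_square[of z] by (simp add: algebra_simps)
      then show ?thesis using that by (simp add: norm_mult flip: complex_cnj_diff)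
    qed
    have nH: "norm (H z) = norm (G z)" if "norm z = R" for z
      using bl[OF that] R by (simp add: H_def GG1 norm_mult norm_divide)
    have "norm (H 0) = norm (G1 0) * R" using R by (simp add: H_def norm_mult norm_divide power2_eq_square)
    moreover have "norm (G 0) = norm a * norm (G1 0)" using GG1[of 0] by (simp add: norm_mult)
    moreover have "norm a * norm (G1 0) \<le> R / 2 * norm (G1 0)" using a by (intro mult_right_mono) auto
    ultimately have H0: "2 * norm (G 0) \<le> norm (H 0)" by (simp add: mult.commute)
    have G0: "norm (G 0) > 0" using Suc.prems(4) by simp
    have "norm (F z) \<le> (2 * M / norm (H 0)) ^ 3"
    proof (rule Suc.IH[OF H])
      show "H 0 \<noteq> 0" using H0 G0 by auto
      have "norm (G 0) * 2 ^ Suc k = (2 * norm (G 0)) * 2 ^ k" by simp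
      also have "\<dots> \<le> norm (H 0) * 2 ^ k" by (intro mult_right_mono H0) auto
      finally show "M < norm (H 0) * 2 ^ k" using Suc.prems(5) by linarith
      show "norm z \<le> R / 4" by (rule Suc.prems(6))
    qed (use Suc.prems(2,3) nH in \<open>auto simp: norm_mult\<close>)
    also have "\<dots> \<le> (2 * M / norm (G 0)) ^ 3"
    proof (intro power_mono divide_left_mono)
      show GH: "norm (G 0) \<le> norm (H 0)" using H0 G0 by linarith
      show "0 < norm (H 0) * norm (G 0)" using GH G0 by (intro mult_pos_pos) linarith+
    qed (use M in auto)
    finally show ?thesis .
  next
    case False
    have FG: "(\<lambda>z. F z * G z) holomorphic_on UNIV" by (intro holomorphic_intros F G)
    have zR: "norm z \<le> R" using Suc.prems(6) R by simp
    \<comment> \<open>Doubling \<open>M\<close> gives the strict inequality that makes the logarithm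
      in \<open>harnack_lower_bound\<close> have negative real part. Zeros are excluded up to R/2,
      so the lower bound holds up to R/4.\<close>
    have "norm (G u) < 2 * M" if "norm u < R / 2" for u :: complex
      using norm_le_on_cball[of G R M u] G Suc.prems(2) that R M by force
    then have "norm (G z) \<ge> 2 * M * (norm (G 0) / (2 * M)) ^ 3"
      by (intro harnack_lower_bound[of G "R/2"] holomorphic_on_subset[OF G]) (use False R Suc.prems(6) in auto)
    moreover have "2 * M * (norm (G 0) / (2 * M)) ^ 3 = 2 * M / (2 * M / norm (G 0)) ^ 3"
      by (simp add: power_divide)
    ultimately have g: "2 * M / (2 * M / norm (G 0)) ^ 3 \<le> norm (G z)" by simp
    have q: "(2 * M / norm (G 0)) ^ 3 > 0" using M Suc.prems(4) by simp
    have "norm (F z) * (2 * M / (2 * M / norm (G 0)) ^ 3) \<le> norm (F z) * norm (G z)"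
      by (intro mult_left_mono g) auto
    also have "\<dots> \<le> M" using norm_le_on_cball[OF FG Suc.prems(3) zR R] by (simp add: norm_mult)
    finally have "norm (F z) * 2 \<le> (2 * M / norm (G 0)) ^ 3"
      using M q by (simp add: pos_divide_le_eq mult.assoc[symmetric])
    then show ?thesis using norm_ge_zero[of "F z"] by linarith
  qed
qed

text \<open>The counter of \<open>quotient_bound_aux\<close> limits how many zeros can be removed;
  since powers of 2 are unbounded, a suitable one always exists.\<close>

lemma quotient_bound:
  fixes F G :: "complex \<Rightarrow> complex"
  assumes "F holomorphic_on UNIV" "G holomorphic_on UNIV" "R > 0" "M > 0"
    "\<And>z. norm z = R \<Longrightarrow> norm (G z) \<le> M" "\<And>z. norm z = R \<Longrightarrow> norm (F z * G z) \<le> M"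
    "G 0 \<noteq> 0" "norm z \<le> R / 4"
  shows "norm (F z) \<le> (2 * M / norm (G 0)) ^ 3"
proof -
  obtain k where "M / norm (G 0) < 2 ^ k" using real_arch_pow[of 2 "M / norm (G 0)"] by auto
  then have "M < norm (G 0) * 2 ^ k" using assms(7) by (simp add: pos_divide_less_eq mult.commute)
  from quotient_bound_aux[OF assms(1,3,4,2,5,6,7) this assms(8)] show ?thesis by simp
qed

text \<open>Apply \<open>quotient_bound\<close> on a disc about \<open>z0\<close> whose radius is
  comparable to the distance of \<open>z\<close>. The bound M is exponential in that radius, and so
  is its cube.\<close>

lemma quotient_exponential_type:
  fixes F G :: "complex \<Rightarrow> complex"
  assumes F: "F holomorphic_on UNIV" and G: "G holomorphic_on UNIV" and z0: "G z0 \<noteq> 0"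
    and A: "A > 0" and B: "B \<ge> 0"
    and bG: "\<And>z. norm (G z) \<le> A * exp (B * norm z)"
    and bFG: "\<And>z. norm (F z * G z) \<le> A * exp (B * norm z)"
  obtains A' B' where "A' \<ge> 0" "B' \<ge> 0" "\<And>z. norm (F z) \<le> A' * exp (B' * norm z)"
proof
  define A1 where "A1 = A * exp (B * norm z0)"
  have A1: "A1 > 0" using A by (simp add: A1_def)
  define g where "g = norm (G z0)"
  have g: "g > 0" using z0 by (simp add: g_def)
  show "(2 * A1 / g) ^ 3 * exp (12 * B * (norm z0 + 1)) \<ge> 0" using A1 g by simp
  show "12 * B \<ge> 0" using B by simp
  fix z :: complex
  \<comment> \<open>Four times the distance, because the quotient is controlled on the quarter disc;
    together with the cube this explains the 12. The summand 1 keeps the radius positive at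
    \<open>z = z0\<close>.\<close>
  define R where "R = 4 * (norm (z - z0) + 1)"
  have R: "R > 0" by (auto simp: R_def intro!: add_nonneg_pos)
  have shift: "A * exp (B * norm (u + z0)) \<le> A1 * exp (B * R)" if "norm u = R" for u
  proof -
    have "B * norm (u + z0) \<le> B * (R + norm z0)"
      using norm_triangle_ineq[of u z0] that B by (intro mult_left_mono) auto
    then have "exp (B * norm (u + z0)) \<le> exp (B * norm z0) * exp (B * R)"
      by (simp add: algebra_simps flip: exp_add)
    then show ?thesis using A by (simp add: A1_def mult.assoc)
  qed
  have "norm (F ((z - z0) + z0)) \<le> (2 * (A1 * exp (B * R)) / norm (G (0 + z0))) ^ 3"
  proof (rule quotient_bound[where F = "\<lambda>u. F (u + z0)" and G = "\<lambda>u. G (u + z0)" and R = R])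
    show "(\<lambda>u. F (u + z0)) holomorphic_on UNIV" "(\<lambda>u. G (u + z0)) holomorphic_on UNIV"
      by (auto intro!: holomorphic_intros holomorphic_on_compose_gen[OF _ F, unfolded o_def] holomorphic_on_compose_gen[OF _ G, unfolded o_def])
  qed (use R A1 z0 shift bG bFG in \<open>auto simp: R_def intro: order_trans\<close>)
  also have "\<dots> = (2 * A1 / g) ^ 3 * exp (B * R) ^ 3" by (simp add: g_def power_mult_distrib power_divide)
  also have "exp (B * R) ^ 3 = exp (3 * (B * R))" by (simp add: exp_of_nat_mult[of 3, simplified])
  also have "(2 * A1 / g) ^ 3 * exp (3 * (B * R)) \<le> (2 * A1 / g) ^ 3 * exp (12 * B * (norm z0 + 1) + 12 * B * norm z)"
  proof (intro mult_left_mono)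
    have "B * R \<le> B * (4 * (norm z + norm z0 + 1))"
      using norm_triangle_ineq4[of z z0] B by (intro mult_left_mono) (auto simp: R_def)
    then show "exp (3 * (B * R)) \<le> exp (12 * B * (norm z0 + 1) + 12 * B * norm z)"
      by (simp add: algebra_simps)
  qed (use A1 g in auto)
  finally show "norm (F z) \<le> (2 * A1 / g) ^ 3 * exp (12 * B * (norm z0 + 1)) * exp (12 * B * norm z)"
    by (simp add: exp_add mult.assoc)
qed

subsection \<open>Decay on three rays\<close>

text \<open>The left-hand side involves the principal power of \<open>w\<close> with exponent
  \<kappa>. Its argument is at most \<kappa> arctan \<tau> < \<pi>/2 in modulus, so the real part is
  comparable to the modulus.\<close>

lemma Re_exp_Ln_ge:
  assumes "Re w > 0" "\<bar>Im w\<bar> \<le> \<tau> * Re w" "0 < \<kappa>" "\<kappa> * arctan \<tau> < pi / 2" "0 \<le> \<tau>"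
  shows "Re (exp (of_real \<kappa> * Ln w)) \<ge> cos (\<kappa> * arctan \<tau>) * exp (\<kappa> * ln (norm w))"
proof -
  have w: "w \<noteq> 0" using assms(1) by auto
  have "Im (Ln w) = arctan (Im w / Re w)"
    using Arg_eq_Im_Ln[OF w] arg_conv_arctan[OF assms(1)] by simp
  moreover have "\<bar>arctan (Im w / Re w)\<bar> \<le> arctan \<tau>"
  proof -
    have "\<bar>Im w\<bar> / Re w \<le> \<tau>" using assms(1,2) by (simp only: pos_divide_le_eq)
    then have "\<bar>Im w / Re w\<bar> \<le> \<tau>" using assms(1) by (simp only: abs_divide abs_of_pos)
    then have "Im w / Re w \<le> \<tau>" "- \<tau> \<le> Im w / Re w" by linarith+
    then have "arctan (Im w / Re w) \<le> arctan \<tau>" "arctan (- \<tau>) \<le> arctan (Im w / Re w)"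
      by (simp_all only: arctan_le_iff)
    then show ?thesis by (simp add: arctan_minus abs_le_iff)
  qed
  ultimately have "\<bar>\<kappa> * Im (Ln w)\<bar> \<le> \<kappa> * arctan \<tau>" using assms(3) by (simp add: abs_mult)
  then have "cos (\<kappa> * arctan \<tau>) \<le> cos \<bar>\<kappa> * Im (Ln w)\<bar>"
    using assms(4) pi_gt_zero by (intro cos_monotone_0_pi_le) auto
  then have "cos (\<kappa> * arctan \<tau>) \<le> cos (\<kappa> * Im (Ln w))" by simp
  then have "exp (\<kappa> * ln (norm w)) * cos (\<kappa> * arctan \<tau>) \<le> exp (\<kappa> * ln (norm w)) * cos (\<kappa> * Im (Ln w))"
    by (intro mult_left_mono) auto
  then show ?thesis using w by (simp add: Re_exp mult.commute)
qed

text \<open>Multiplication by \<open>w\<close> turns the cone of \<open>u\<close> and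
  \<open>v\<close> into the open right half-plane. The witness is the conjugate of a bisector, and
  strict Cauchy-Schwarz |Re(u cnj v)| < |u| |v| makes both real parts positive.\<close>

lemma independent_half_plane:
  assumes "Im (u * cnj v) \<noteq> 0"
  obtains w where "Re (u * w) > 0" "Re (v * w) > 0"
proof
  have nz: "u \<noteq> 0" "v \<noteq> 0" using assms by auto
  define p where "p = Re (u * cnj v)"
  have "p\<^sup>2 < (norm (u * cnj v))\<^sup>2" unfolding p_def cmod_power2 using assms by simp
  then have "p\<^sup>2 < (norm u * norm v)\<^sup>2" by (simp add: norm_mult)
  then have p: "\<bar>p\<bar> < norm u * norm v" by (metis abs_le_square_iff abs_of_nonneg mult_nonneg_nonneg norm_ge_zero not_le)
  let ?w = "of_real (norm v) * cnj u + of_real (norm u) * cnj v"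
  have "Re (u * ?w) = norm v * Re (u * cnj u) + norm u * p" by (simp add: p_def algebra_simps)
  also have "Re (u * cnj u) = (norm u)\<^sup>2" by (metis Re_complex_of_real complex_norm_square)
  also have "norm v * (norm u)\<^sup>2 + norm u * p = norm u * (norm u * norm v + p)" by (simp add: power2_eq_square algebra_simps)
  also have "\<dots> > 0" using p nz by (intro mult_pos_pos) auto
  finally show "Re (u * ?w) > 0" .
  have "Re (v * ?w) = norm u * Re (v * cnj v) + norm v * p" by (simp add: p_def algebra_simps)
  also have "Re (v * cnj v) = (norm v)\<^sup>2" by (metis Re_complex_of_real complex_norm_square)
  also have "norm u * (norm v)\<^sup>2 + norm v * p = norm v * (norm u * norm v + p)" by (simp add: power2_eq_square algebra_simps)
  also have "\<dots> > 0" using p nz by (intro mult_pos_pos) auto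
  finally show "Re (v * ?w) > 0" .
qed

text \<open>The damping factor \<open>exp (- \<epsilon> (1 + w z)\<^sup>\<kappa>)\<close> with \<open>1 < \<kappa> < \<pi> /\<close> (opening angle) beats every
  function of exponential type inside the sector; the shift by \<open>1\<close> avoids the branch point.\<close>

lemma phragmen_lindelof:
  fixes F :: "complex \<Rightarrow> complex"
  assumes F: "F holomorphic_on UNIV" and uv: "Im (u * cnj v) \<noteq> 0"
    and A: "\<And>z. norm (F z) \<le> A * exp (B * norm z)" and B: "B \<ge> 0"
    and K: "\<And>t. t \<ge> 0 \<Longrightarrow> norm (F (of_real t * u)) \<le> K" "\<And>t. t \<ge> 0 \<Longrightarrow> norm (F (of_real t * v)) \<le> K"
    and K1: "K \<ge> 1" and s: "s0 \<ge> 0" "t0 \<ge> 0"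
  shows "norm (F (of_real s0 * u + of_real t0 * v)) \<le> K"
proof (cases "s0 = 0 \<or> t0 = 0")
  case True then show ?thesis using K s by auto
next
  case False
  then have s: "s0 > 0" "t0 > 0" using s by auto
  obtain w where w: "Re (u * w) > 0" "Re (v * w) > 0" by (rule independent_half_plane[OF uv])
  define z0 where "z0 = of_real s0 * u + of_real t0 * v"
  \<comment> \<open>\<open>sc\<close> and \<open>tc\<close> are the real coordinates with respect to
    the basis \<open>u\<close>, \<open>v\<close>, found by Cramer's rule; the sector is where both
    are nonnegative.\<close>
  define sc where "sc z = Im (z * cnj v) / Im (u * cnj v)" for z
  define tc where "tc z = Im (z * cnj u) / Im (v * cnj u)" for z
  have vu: "Im (v * cnj u) = - Im (u * cnj v)" by simp
  have vu0: "Im (v * cnj u) \<noteq> 0" using uv unfolding vu by simp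
  have sc: "sc (of_real s * u + of_real t * v) = s" for s t
    using uv by (simp add: sc_def field_simps)
  have tc: "tc (of_real s * u + of_real t * v) = t" for s t
    unfolding tc_def vu using uv by (simp add: field_simps)
  have coord: "z = of_real (sc z) * u + of_real (tc z) * v" for z
  proof -
    define d where "d = Im (u * cnj v)"
    have d: "d \<noteq> 0" using uv by (simp add: d_def)
    have "of_real (sc z) * u + of_real (tc z) * v
       = (of_real (Im (z * cnj v)) * u - of_real (Im (z * cnj u)) * v) / of_real d"
    proof -
      have "of_real (\<alpha> / d) * u + of_real (\<beta> / - d) * v = (of_real \<alpha> * u - of_real \<beta> * v) / of_real d" for \<alpha> \<beta> :: real
        by (simp add: diff_divide_distrib)
      then show ?thesis unfolding sc_def tc_def vu d_def[symmetric] .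
    qed
    also have "of_real (Im (z * cnj v)) * u - of_real (Im (z * cnj u)) * v = z * of_real d"
      by (simp add: complex_eq_iff d_def algebra_simps)
    finally show ?thesis using d by simp
  qed
  have sc_cont: "continuous_on UNIV sc" "continuous_on UNIV tc"
    unfolding sc_def tc_def
    by (intro continuous_intros; use uv in simp) (intro continuous_intros; use vu0 in simp)
  \<comment> \<open>The largest slope of the rotated edges, so arctan \<tau> bounds the argument in
    the rotated sector.\<close>
  define \<tau> where "\<tau> = max (\<bar>Im (u * w)\<bar> / Re (u * w)) (\<bar>Im (v * w)\<bar> / Re (v * w))"
  have \<tau>: "\<bar>Im (u * w)\<bar> \<le> \<tau> * Re (u * w)" "\<bar>Im (v * w)\<bar> \<le> \<tau> * Re (v * w)" "0 \<le> \<tau>"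
    using w by (auto simp: \<tau>_def pos_divide_le_eq[symmetric] le_max_iff_disj)
  define \<theta> where "\<theta> = arctan \<tau>"
  have \<theta>: "0 \<le> \<theta>" "\<theta> < pi / 2" using \<tau>(3) arctan_ubound[of \<tau>] by (auto simp: \<theta>_def)
  \<comment> \<open>Any exponent above 1 with \<kappa> \<theta> < \<pi>/2 would do; this one works
    because \<theta> / \<pi> < 1/2.\<close>
  define \<kappa> where "\<kappa> = 1 + (pi / 2 - \<theta>) / pi"
  have \<kappa>: "\<kappa> > 1" using \<theta> by (simp add: \<kappa>_def)
  have \<kappa>\<theta>: "\<kappa> * \<theta> < pi / 2"
  proof -
    have "\<theta> / pi < 1 / 2" using \<theta> by (simp add: pos_divide_less_eq)
    then have "(\<theta> / pi) * (pi / 2 - \<theta>) \<le> 1 / 2 * (pi / 2 - \<theta>)"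
      using \<theta> by (intro mult_right_mono) auto
    moreover have "\<kappa> * \<theta> = \<theta> + (\<theta> / pi) * (pi / 2 - \<theta>)" by (simp add: \<kappa>_def distrib_left mult.commute)
    ultimately show ?thesis using \<theta> by simp
  qed
  define c where "c = cos (\<kappa> * \<theta>)"
  have c: "c > 0" unfolding c_def using \<kappa>\<theta> \<kappa> \<theta> by (intro cos_gt_zero_pi) (auto intro: less_le_trans[of _ 0])
  have w0: "norm w > 0" using w by auto
  define \<phi> where "\<phi> z = exp (of_real \<kappa> * Ln (1 + w * z))" for z
  have cone: "Re (1 + w * z) > 0" "\<bar>Im (1 + w * z)\<bar> \<le> \<tau> * Re (1 + w * z)" "norm (w * z) \<le> norm (1 + w * z)"
    if "sc z \<ge> 0" "tc z \<ge> 0" for z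
  proof -
    have zw: "w * z = of_real (sc z) * (u * w) + of_real (tc z) * (v * w)"
      by (subst coord) (simp add: algebra_simps)
    have re: "Re (w * z) = sc z * Re (u * w) + tc z * Re (v * w)"
      and im: "Im (w * z) = sc z * Im (u * w) + tc z * Im (v * w)"
      unfolding zw by simp_all
    have re0: "Re (w * z) \<ge> 0" unfolding re using that w by simp
    then show "Re (1 + w * z) > 0" by simp
    have "\<bar>Im (w * z)\<bar> \<le> sc z * \<bar>Im (u * w)\<bar> + tc z * \<bar>Im (v * w)\<bar>"
      unfolding im using that by (metis abs_mult abs_of_nonneg abs_triangle_ineq)
    also have "\<dots> \<le> sc z * (\<tau> * Re (u * w)) + tc z * (\<tau> * Re (v * w))"
      using that \<tau> by (intro add_mono mult_left_mono) auto
    also have "\<dots> = \<tau> * Re (w * z)" unfolding re by (simp only: algebra_simps)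
    also have "\<dots> \<le> \<tau> * Re (1 + w * z)" using \<tau>(3) by (intro mult_left_mono) auto
    finally show "\<bar>Im (1 + w * z)\<bar> \<le> \<tau> * Re (1 + w * z)" by simp
    have "(norm (w * z))\<^sup>2 \<le> (norm (1 + w * z))\<^sup>2" unfolding cmod_power2 using re0 by (simp add: power2_eq_square algebra_simps)
    then show "norm (w * z) \<le> norm (1 + w * z)" by (rule power2_le_imp_le) simp
  qed
  have \<phi>: "Re (\<phi> z) \<ge> c * exp (\<kappa> * ln (norm (1 + w * z)))" if "sc z \<ge> 0" "tc z \<ge> 0" for z
    unfolding \<phi>_def c_def \<theta>_def
    by (rule Re_exp_Ln_ge[OF cone(1,2)[OF that] _ _ \<tau>(3)]) (use \<kappa> \<kappa>\<theta> in \<open>auto simp: \<theta>_def\<close>)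
  have \<phi>0: "Re (\<phi> z) \<ge> 0" if "sc z \<ge> 0" "tc z \<ge> 0" for z
    using \<phi>[OF that] c by (intro order_trans[OF _ \<phi>[OF that]]) auto
  have main: "norm (F z0) \<le> K * exp (\<epsilon> * Re (\<phi> z0))" if \<epsilon>: "\<epsilon> > 0" for \<epsilon>
  proof -
    \<comment> \<open>The radius encloses \<open>z0\<close>, exceeds the constant \<open>A\<close>,
      and is so large that on the arc the damping beats exp((B + 1) r); the surplus exp(-r) then
      swallows \<open>A\<close>.\<close>
    define r where "r = Max {norm z0 + 1, \<bar>A\<bar>, ((B + 1) / (\<epsilon> * c * exp (\<kappa> * ln (norm w)))) powr (1 / (\<kappa> - 1))}"
    have r: "r \<ge> norm z0 + 1" "r \<ge> \<bar>A\<bar>" "r \<ge> ((B + 1) / (\<epsilon> * c * exp (\<kappa> * ln (norm w)))) powr (1 / (\<kappa> - 1))"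
      unfolding r_def by (intro Max_ge; simp)+
    have r0: "r > 0" using r(1) norm_ge_zero[of z0] by linarith
    define q where "q = \<epsilon> * c * exp (\<kappa> * ln (norm w))"
    have q: "q > 0" using \<epsilon> c by (simp add: q_def)
    have "(x powr (1 / (\<kappa> - 1))) powr (\<kappa> - 1) = x" if "x \<ge> 0" for x :: real
      unfolding powr_powr using \<kappa> that by simp
    then have "(B + 1) / q = (((B + 1) / q) powr (1 / (\<kappa> - 1))) powr (\<kappa> - 1)"
      using B q by simp
    also have "\<dots> \<le> r powr (\<kappa> - 1)"
      by (rule powr_mono2[OF _ _ r(3)[folded q_def]]) (use \<kappa> in auto)
    finally have rq: "B + 1 \<le> q * r powr (\<kappa> - 1)" using q by (simp add: pos_divide_le_eq mult.commute)
    define X where "X = {z. sc z > 0} \<inter> {z. tc z > 0} \<inter> ball 0 r"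
    have oX: "open X" unfolding X_def
      by (intro open_Int open_ball open_Collect_less sc_cont continuous_intros)
    have clX: "closure X \<subseteq> {z. sc z \<ge> 0} \<inter> {z. tc z \<ge> 0} \<inter> cball 0 r"
      by (rule closure_minimal) (auto simp: X_def intro!: closed_Int closed_Collect_le sc_cont continuous_intros)
    define g where "g z = F z * exp (- (of_real \<epsilon> * \<phi> z))" for z
    have dom: "1 + w * z \<notin> \<real>\<^sub>\<le>\<^sub>0" if "sc z \<ge> 0" "tc z \<ge> 0" for z
      using cone(1)[OF that] by (auto simp: complex_nonpos_Reals_iff)
    have g_hol: "g holomorphic_on X"
      unfolding g_def \<phi>_def
      by (intro holomorphic_intros holomorphic_on_subset[OF F]) (use dom in \<open>auto simp: X_def\<close>)
    have g_cont: "continuous_on (closure X) g"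
      unfolding g_def \<phi>_def
      by (intro continuous_intros continuous_on_subset[OF holomorphic_on_imp_continuous_on[OF F]])
         (use dom clX in auto)
    have ng: "norm (g z) = norm (F z) * exp (- (\<epsilon> * Re (\<phi> z)))" for z
      by (simp add: g_def norm_mult)
    have "norm (g z0) \<le> K"
    proof (rule maximum_modulus_frontier[of g X])
      show "g holomorphic_on interior X" using g_hol oX by (simp add: interior_open)
      show "continuous_on (closure X) g" by (rule g_cont)
      show "bounded X" by (rule bounded_subset[of "ball 0 r"]) (auto simp: X_def)
      show "z0 \<in> X" using r(1) s by (auto simp: X_def z0_def sc tc)
      fix z assume "z \<in> frontier X"
      then have "z \<in> closure X" "z \<notin> X" using oX by (auto simp: frontier_def interior_open)
      then have z: "sc z \<ge> 0" "tc z \<ge> 0" "norm z \<le> r" "sc z = 0 \<or> tc z = 0 \<or> norm z = r"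
        using clX by (auto simp: X_def)
      show "norm (g z) \<le> K"
      proof (cases "norm z = r")
        case True
        have "r = r powr 1" using r0 by simp
        have "norm w * r \<le> norm (1 + w * z)" using cone(3)[OF z(1,2)] True by (simp add: norm_mult)
        then have "ln (norm w * r) \<le> ln (norm (1 + w * z))" using w0 r0 by (intro ln_mono) auto
        then have "exp (\<kappa> * ln (norm w * r)) \<le> exp (\<kappa> * ln (norm (1 + w * z)))" using \<kappa> by simp
        moreover have "exp (\<kappa> * ln (norm w * r)) = exp (\<kappa> * ln (norm w)) * r powr \<kappa>"
          using w0 r0 by (simp add: ln_mult powr_def distrib_left exp_add)
        ultimately have "c * (exp (\<kappa> * ln (norm w)) * r powr \<kappa>) \<le> Re (\<phi> z)"
          using \<phi>[OF z(1,2)] c by (auto intro: order_trans[OF mult_left_mono])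
        then have "\<epsilon> * (c * (exp (\<kappa> * ln (norm w)) * r powr \<kappa>)) \<le> \<epsilon> * Re (\<phi> z)"
          using \<epsilon> by (intro mult_left_mono) auto
        then have "q * r powr \<kappa> \<le> \<epsilon> * Re (\<phi> z)" by (simp add: q_def mult_ac)
        moreover have "r powr \<kappa> = r powr (\<kappa> - 1) * r"
          using r0 by (simp add: powr_diff)
        moreover have "(B + 1) * r \<le> q * r powr (\<kappa> - 1) * r" using rq r0 by (intro mult_right_mono) auto
        ultimately have "B * r + r \<le> \<epsilon> * Re (\<phi> z)" by (simp add: algebra_simps)
        then have e: "exp (B * r) * exp (- (\<epsilon> * Re (\<phi> z))) \<le> exp (- r)"
          by (simp flip: exp_add)
        have "norm (g z) \<le> (\<bar>A\<bar> * exp (B * r)) * exp (- (\<epsilon> * Re (\<phi> z)))"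
          unfolding ng using A[of z] True
          by (intro mult_right_mono) (auto intro: order_trans mult_right_mono)
        also have "\<dots> \<le> \<bar>A\<bar> * exp (- r)" using e by (simp add: mult.assoc mult_left_mono)
        also have "\<dots> \<le> r * exp (- r)" using r(2) by (intro mult_right_mono) auto
        also have "\<dots> \<le> 1"
        proof -
          have "r \<le> exp r" using exp_ge_add_one_self[of r] by linarith
          then show ?thesis by (simp add: exp_minus divide_simps)
        qed
        finally show ?thesis using K1 by simp
      next
        case False
        then have "z = of_real (sc z) * u \<or> z = of_real (tc z) * v" using z(4) coord[of z] by auto
        then have "norm (F z) \<le> K" using K z by metis
        moreover have "exp (- (\<epsilon> * Re (\<phi> z))) \<le> 1" using \<epsilon> \<phi>0[OF z(1,2)] by simp
        ultimately have "norm (g z) \<le> K * 1" unfolding ng using K1 by (intro mult_mono) auto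
        then show ?thesis by simp
      qed
    qed
    then have "norm (F z0) * exp (- (\<epsilon> * Re (\<phi> z0))) * exp (\<epsilon> * Re (\<phi> z0)) \<le> K * exp (\<epsilon> * Re (\<phi> z0))"
      unfolding ng by (intro mult_right_mono) auto
    then show ?thesis by (simp add: mult.assoc flip: exp_add)
  qed
  \<comment> \<open>The bound holds for every \<epsilon> > 0 at the fixed point \<open>z0\<close>;
    letting \<epsilon> tend to 0 removes the damping.\<close>
  have "((\<lambda>\<epsilon>. K * exp (\<epsilon> * Re (\<phi> z0))) \<longlongrightarrow> K * exp (0 * Re (\<phi> z0))) (at_right 0)"
    by (intro tendsto_intros)
  moreover have "eventually (\<lambda>\<epsilon>. norm (F z0) \<le> K * exp (\<epsilon> * Re (\<phi> z0))) (at_right 0)"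
    using main by (auto simp: eventually_at_right_field intro!: exI[of _ 1])
  ultimately show ?thesis
    using tendsto_lowerbound[of "\<lambda>\<epsilon>. K * exp (\<epsilon> * Re (\<phi> z0))" K "at_right 0" "norm (F z0)"] by (simp add: z0_def)
qed

section \<open>Cones spanned by the vertices of a triangle around the origin\<close>

text \<open>If two vertices lay on one line through 0, the triangle would stay on the side of that
  line where the third vertex is, and 0 could not be interior.\<close>

lemma triangle_vertices_independent:
  fixes z1 z2 z3 :: complex
  assumes "0 \<in> interior (convex hull {z1, z2, z3})"
  shows "Im (z1 * cnj z2) \<noteq> 0"
proof
  assume z12: "Im (z1 * cnj z2) = 0"
  \<comment> \<open>\<open>d\<close> directs the line containing \<open>z1\<close> and
    \<open>z2\<close>; a vertex equal to 0 is why cases are needed.\<close>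
  obtain d where d: "d \<noteq> 0" "Im (z1 * cnj d) = 0" "Im (z2 * cnj d) = 0"
  proof (cases "z1 = 0")
    case True
    show ?thesis
    proof (cases "z2 = 0")
      case True
      with \<open>z1 = 0\<close> show ?thesis by (intro that[of 1]) auto
    next
      case False
      with \<open>z1 = 0\<close> show ?thesis by (intro that[of z2]) auto
    qed
  next
    case False
    have "Im (z2 * cnj z1) = - Im (z1 * cnj z2)" by simp
    with False z12 show ?thesis by (intro that[of z1]) auto
  qed
  obtain e where e: "e > 0" "ball 0 e \<subseteq> convex hull {z1, z2, z3}"
    using assms by (auto simp: mem_interior)
  have hull: "\<exists>c\<ge>0. Im (p * cnj d) = c * Im (z3 * cnj d)" if "p \<in> convex hull {z1, z2, z3}" for p
  proof -
    from that obtain a b c where "0 \<le> c" "p = a *\<^sub>R z1 + b *\<^sub>R z2 + c *\<^sub>R z3" unfolding convex_hull_3 by auto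
    moreover from this have "Im (p * cnj d) = a * Im (z1 * cnj d) + b * Im (z2 * cnj d) + c * Im (z3 * cnj d)"
      by (simp add: algebra_simps)
    ultimately show ?thesis using d by auto
  qed
  define \<epsilon> where "\<epsilon> = e / (2 * norm d)"
  have \<epsilon>: "\<epsilon> > 0" using e d by (simp add: \<epsilon>_def)
  \<comment> \<open>Small steps perpendicular to \<open>d\<close>, in both directions, lie in the
    triangle and so on both sides of the line.\<close>
  have "\<exists>c\<ge>0. Im ((of_real s * \<i> * d) * cnj d) = c * Im (z3 * cnj d)" if "\<bar>s\<bar> = \<epsilon>" for s
  proof (rule hull[OF subsetD[OF e(2)]])
    have "norm (of_real s * \<i> * d) = \<epsilon> * norm d" using that by (simp add: norm_mult)
    then show "of_real s * \<i> * d \<in> ball 0 e" using d e by (simp add: \<epsilon>_def)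
  qed
  moreover have "Im ((of_real s * \<i> * d) * cnj d) = s * (norm d)\<^sup>2" for s
  proof -
    have eq: "(of_real s * \<i> * d) * cnj d = of_real s * \<i> * of_real ((norm d)\<^sup>2)"
      by (simp only: mult.assoc complex_norm_square)
    show ?thesis unfolding eq by simp
  qed
  ultimately have *: "\<exists>c\<ge>0. s * (norm d)\<^sup>2 = c * Im (z3 * cnj d)" if "\<bar>s\<bar> = \<epsilon>" for s
    using that by simp
  obtain c where c: "c \<ge> 0" "\<epsilon> * (norm d)\<^sup>2 = c * Im (z3 * cnj d)" using *[of \<epsilon>] \<epsilon> by auto
  obtain c' where c': "c' \<ge> 0" "- \<epsilon> * (norm d)\<^sup>2 = c' * Im (z3 * cnj d)" using *[of "- \<epsilon>"] \<epsilon> by auto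
  have "\<epsilon> * (norm d)\<^sup>2 > 0" using \<epsilon> d by simp
  then have "c * Im (z3 * cnj d) > 0" "c' * Im (z3 * cnj d) < 0" using c c' by linarith+
  then show False using c(1) c'(1) by (metis mult_nonneg_nonneg mult_nonneg_nonpos linear not_le)
qed

text \<open>A small negative multiple of \<open>z1\<close> lies in the triangle; moving it to the
  other side of its convex representation makes the coefficient of \<open>z1\<close> strictly
  positive.\<close>

lemma triangle_positive_relation:
  fixes z1 z2 z3 :: complex
  assumes "0 \<in> interior (convex hull {z1, z2, z3})"
  obtains a b c :: real where "a > 0" "b \<ge> 0" "c \<ge> 0" "a *\<^sub>R z1 + b *\<^sub>R z2 + c *\<^sub>R z3 = 0"
proof -
  obtain e where e: "e > 0" "ball 0 e \<subseteq> convex hull {z1, z2, z3}"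
    using assms by (auto simp: mem_interior)
  have half: "e / (2 * N) * N = e / 2" if "N > 0" for N :: real using that by simp
  define \<epsilon> where "\<epsilon> = e / (2 * (norm z1 + 1))"
  have n: "norm z1 + 1 > 0" by (simp add: add_nonneg_pos)
  have \<epsilon>: "\<epsilon> > 0" using e n by (simp add: \<epsilon>_def)
  have "\<epsilon> * norm z1 \<le> \<epsilon> * (norm z1 + 1)" using \<epsilon> by simp
  also have "\<dots> = e / 2" unfolding \<epsilon>_def by (rule half[OF n])
  also have "\<dots> < e" using e by simp
  finally have "- (\<epsilon> *\<^sub>R z1) \<in> ball 0 e" using \<epsilon> by simp
  then have "- (\<epsilon> *\<^sub>R z1) \<in> convex hull {z1, z2, z3}" using e by auto
  then obtain a b c where "0 \<le> a" "0 \<le> b" "0 \<le> c" "- (\<epsilon> *\<^sub>R z1) = a *\<^sub>R z1 + b *\<^sub>R z2 + c *\<^sub>R z3"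
    unfolding convex_hull_3 by auto
  moreover from this have "(a + \<epsilon>) *\<^sub>R z1 + b *\<^sub>R z2 + c *\<^sub>R z3 = 0"
    by (simp add: scaleR_add_left add_eq_0_iff)
  ultimately show ?thesis using \<epsilon> by (intro that[of "a + \<epsilon>" b c]) auto
qed

text \<open>The three cones cover the plane: represent a small multiple of \<open>z\<close> by
  nonnegative coefficients, then subtract a strictly positive relation among the vertices until one
  coefficient vanishes.\<close>

lemma triangle_cones:
  fixes z1 z2 z3 z :: complex
  assumes int: "0 \<in> interior (convex hull {z1, z2, z3})"
  obtains u v s t where "u \<in> {z1, z2, z3}" "v \<in> {z1, z2, z3}" "Im (u * cnj v) \<noteq> 0" "s \<ge> 0" "t \<ge> 0"
    "z = of_real s * u + of_real t * v"
proof -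
  have int2: "0 \<in> interior (convex hull {z2, z3, z1})" "0 \<in> interior (convex hull {z3, z1, z2})"
    using int by (simp_all add: insert_commute)
  obtain a1 b1 c1 where 1: "a1 > 0" "b1 \<ge> 0" "c1 \<ge> 0" "a1 *\<^sub>R z1 + b1 *\<^sub>R z2 + c1 *\<^sub>R z3 = 0"
    by (rule triangle_positive_relation[OF int])
  obtain a2 b2 c2 where 2: "a2 > 0" "b2 \<ge> 0" "c2 \<ge> 0" "a2 *\<^sub>R z2 + b2 *\<^sub>R z3 + c2 *\<^sub>R z1 = 0"
    by (rule triangle_positive_relation[OF int2(1)])
  obtain a3 b3 c3 where 3: "a3 > 0" "b3 \<ge> 0" "c3 \<ge> 0" "a3 *\<^sub>R z3 + b3 *\<^sub>R z1 + c3 *\<^sub>R z2 = 0"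
    by (rule triangle_positive_relation[OF int2(2)])
  \<comment> \<open>The sum of three relations, each strictly positive at a different vertex, is
    strictly positive at all of them.\<close>
  define A B C where "A = a1 + c2 + b3" and "B = b1 + a2 + c3" and "C = c1 + b2 + a3"
  have pos: "A > 0" "B > 0" "C > 0" using 1 2 3 by (auto simp: A_def B_def C_def)
  have "A *\<^sub>R z1 + B *\<^sub>R z2 + C *\<^sub>R z3 = (a1 *\<^sub>R z1 + b1 *\<^sub>R z2 + c1 *\<^sub>R z3)
      + (a2 *\<^sub>R z2 + b2 *\<^sub>R z3 + c2 *\<^sub>R z1) + (a3 *\<^sub>R z3 + b3 *\<^sub>R z1 + c3 *\<^sub>R z2)"
    by (simp add: A_def B_def C_def scaleR_add_left)
  then have zero: "A *\<^sub>R z1 + B *\<^sub>R z2 + C *\<^sub>R z3 = 0" using 1 2 3 by simp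
  obtain e where e: "e > 0" "ball 0 e \<subseteq> convex hull {z1, z2, z3}"
    using int by (auto simp: mem_interior)
  have half: "e / (2 * N) * N = e / 2" if "N > 0" for N :: real using that by simp
  define \<epsilon> where "\<epsilon> = e / (2 * (norm z + 1))"
  have n: "norm z + 1 > 0" by (simp add: add_nonneg_pos)
  have \<epsilon>: "\<epsilon> > 0" using e n by (simp add: \<epsilon>_def)
  have "\<epsilon> * norm z \<le> \<epsilon> * (norm z + 1)" using \<epsilon> by simp
  also have "\<dots> = e / 2" unfolding \<epsilon>_def by (rule half[OF n])
  also have "\<dots> < e" using e by simp
  finally have "\<epsilon> *\<^sub>R z \<in> ball 0 e" using \<epsilon> by simp
  then have "\<epsilon> *\<^sub>R z \<in> convex hull {z1, z2, z3}" using e by auto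
  then obtain p q r where pqr: "0 \<le> p" "0 \<le> q" "0 \<le> r" "\<epsilon> *\<^sub>R z = p *\<^sub>R z1 + q *\<^sub>R z2 + r *\<^sub>R z3"
    unfolding convex_hull_3 by auto
  \<comment> \<open>The largest multiple of the relation that can be subtracted without a negative
    coefficient; the index attaining the minimum is eliminated.\<close>
  define m where "m = min (p / A) (min (q / B) (r / C))"
  have shift: "\<epsilon> *\<^sub>R z = (p - m * A) *\<^sub>R z1 + (q - m * B) *\<^sub>R z2 + (r - m * C) *\<^sub>R z3"
  proof -
    have "(p - m * A) *\<^sub>R z1 + (q - m * B) *\<^sub>R z2 + (r - m * C) *\<^sub>R z3
      = (p *\<^sub>R z1 + q *\<^sub>R z2 + r *\<^sub>R z3) - m *\<^sub>R (A *\<^sub>R z1 + B *\<^sub>R z2 + C *\<^sub>R z3)"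
      by (simp add: algebra_simps)
    then show ?thesis using zero pqr by simp
  qed
  have nn: "p - m * A \<ge> 0" "q - m * B \<ge> 0" "r - m * C \<ge> 0"
    using pos by (auto simp: m_def pos_le_divide_eq[symmetric])
  have "m = p / A \<or> m = q / B \<or> m = r / C" by (auto simp: m_def min_def)
  then have z0: "p - m * A = 0 \<or> q - m * B = 0 \<or> r - m * C = 0" using pos by auto
  have zz: "z = of_real (s / \<epsilon>) * u + of_real (t / \<epsilon>) * v" if "\<epsilon> *\<^sub>R z = s *\<^sub>R u + t *\<^sub>R v" for s t u v
  proof -
    have "z = (1 / \<epsilon>) *\<^sub>R (\<epsilon> *\<^sub>R z)" using \<epsilon> by simp
    also have "\<dots> = (s / \<epsilon>) *\<^sub>R u + (t / \<epsilon>) *\<^sub>R v" unfolding that by (simp add: scaleR_add_right)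
    finally show ?thesis by (simp add: scaleR_conv_of_real)
  qed
  note ind = triangle_vertices_independent[OF int] triangle_vertices_independent[OF int2(1)] triangle_vertices_independent[OF int2(2)]
  have nn': "(p - m * A) / \<epsilon> \<ge> 0" "(q - m * B) / \<epsilon> \<ge> 0" "(r - m * C) / \<epsilon> \<ge> 0"
    using nn \<epsilon> by auto
  from z0 show ?thesis
  proof (elim disjE)
    assume "p - m * A = 0"
    then have "\<epsilon> *\<^sub>R z = (q - m * B) *\<^sub>R z2 + (r - m * C) *\<^sub>R z3" using shift by simp
    from that[OF _ _ ind(2) nn'(2,3) zz[OF this]] show ?thesis by simp
  next
    assume "q - m * B = 0"
    then have "\<epsilon> *\<^sub>R z = (r - m * C) *\<^sub>R z3 + (p - m * A) *\<^sub>R z1" using shift by (simp add: add.commute)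
    from that[OF _ _ ind(3) nn'(3,1) zz[OF this]] show ?thesis by simp
  next
    assume "r - m * C = 0"
    then have "\<epsilon> *\<^sub>R z = (p - m * A) *\<^sub>R z1 + (q - m * B) *\<^sub>R z2" using shift by simp
    from that[OF _ _ ind(1) nn'(1,2) zz[OF this]] show ?thesis by simp
  qed
qed

text \<open>Decay bounds F on the rays, Phragmen--Lindelof carries the bound into the cones, and
  \<open>triangle_cones\<close> makes it global. By Liouville F is constant, and the constant is its
  limit 0 along a ray.\<close>

lemma exponential_type_three_rays:
  fixes F :: "complex \<Rightarrow> complex"
  assumes F: "F holomorphic_on UNIV" and int: "0 \<in> interior (convex hull {z1, z2, z3})"
    and A: "\<And>z. norm (F z) \<le> A * exp (B * norm z)" and B: "B \<ge> 0"
    and ray: "\<And>u. u \<in> {z1, z2, z3} \<Longrightarrow> ((\<lambda>t. F (of_real t * u)) \<longlongrightarrow> 0) at_top"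
  shows "F z = 0"
proof -
  have bd: "\<exists>K. \<forall>t\<ge>0. norm (F (of_real t * u)) \<le> K" if u: "u \<in> {z1, z2, z3}" for u
  proof -
    from ray[OF u] have "eventually (\<lambda>t. norm (F (of_real t * u)) < 1) at_top"
      using tendstoD[of "\<lambda>t. F (of_real t * u)" 0 at_top 1] by (simp add: dist_norm)
    then obtain t1 where t1: "\<And>t. t \<ge> t1 \<Longrightarrow> norm (F (of_real t * u)) < 1"
      unfolding eventually_at_top_linorder by auto
    have "continuous_on {0..t1} (\<lambda>t. F (of_real t * u))"
      by (intro continuous_on_compose2[OF holomorphic_on_imp_continuous_on[OF F]] continuous_intros) auto
    then have "bounded ((\<lambda>t. F (of_real t * u)) ` {0..t1})"
      by (intro compact_imp_bounded compact_continuous_image) auto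
    then obtain K where K: "\<forall>t\<in>{0..t1}. norm (F (of_real t * u)) \<le> K" unfolding bounded_iff by auto
    show ?thesis
    proof (intro exI allI impI)
      fix t :: real assume "t \<ge> 0"
      then show "norm (F (of_real t * u)) \<le> max K 1" using t1[of t] K[rule_format, of t]
        by (cases "t \<ge> t1") (auto simp: le_max_iff_disj)
    qed
  qed
  obtain k where k: "\<And>u t. u \<in> {z1, z2, z3} \<Longrightarrow> t \<ge> 0 \<Longrightarrow> norm (F (of_real t * u)) \<le> k u"
    using bd by metis
  \<comment> \<open>The entry 1 provides \<open>K \<ge> 1\<close>, which
    \<open>phragmen_lindelof\<close> needs on the arc of its sector.\<close>
  define K where "K = Max {k z1, k z2, k z3, 1}"
  have K: "k u \<le> K" if "u \<in> {z1, z2, z3}" for u using that by (auto simp: K_def)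
  have K1: "K \<ge> 1" by (auto simp: K_def)
  have "norm (F w) \<le> K" for w
  proof -
    obtain u v s t where w: "u \<in> {z1, z2, z3}" "v \<in> {z1, z2, z3}" "Im (u * cnj v) \<noteq> 0" "s \<ge> 0" "t \<ge> 0"
      "w = of_real s * u + of_real t * v" by (rule triangle_cones[OF int, of w])
    show ?thesis unfolding w(6)
      by (rule phragmen_lindelof[OF F w(3) A B _ _ K1 w(4,5)])
         (use k[OF w(1)] k[OF w(2)] K[OF w(1)] K[OF w(2)] in \<open>auto intro: order_trans\<close>)
  qed
  then have "bounded (range F)" by (auto simp: bounded_iff)
  from Liouville_theorem[OF F this] obtain c where c: "\<And>z. F z = c" by (auto simp: constant_on_def)
  have "((\<lambda>t::real. c) \<longlongrightarrow> 0) at_top" using ray[of z1] by (simp add: c)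
  then have "c = 0" using tendsto_unique[OF trivial_limit_at_top_linorder tendsto_const] by metis
  then show ?thesis by (simp add: c)
qed

subsection \<open>Analytic dependence on the spectral parameter\<close>

definition exptype :: "(complex \<Rightarrow> 'a::real_normed_vector) \<Rightarrow> bool"
  where "exptype \<phi> \<longleftrightarrow> (\<exists>A B. A \<ge> 0 \<and> B \<ge> 0 \<and> (\<forall>\<mu>. norm (\<phi> \<mu>) \<le> A * exp (B * norm \<mu>)))"

lemma exptype_const: "exptype (\<lambda>\<mu>. c)"
  unfolding exptype_def by (rule exI[of _ "norm c"], rule exI[of _ 0]) auto

lemma exptype_bound: "exptype \<psi> \<Longrightarrow> (\<And>\<mu>. norm (\<phi> \<mu>) \<le> norm (\<psi> \<mu>)) \<Longrightarrow> exptype \<phi>"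
  unfolding exptype_def by (meson order_trans)

lemma exptype_add:
  assumes "exptype \<phi>" "exptype \<psi>" shows "exptype (\<lambda>\<mu>. \<phi> \<mu> + \<psi> \<mu>)"
proof -
  obtain A B where 1: "A \<ge> 0" "B \<ge> 0" "\<And>\<mu>. norm (\<phi> \<mu>) \<le> A * exp (B * norm \<mu>)"
    using assms(1) unfolding exptype_def by blast
  obtain A' B' where 2: "A' \<ge> 0" "B' \<ge> 0" "\<And>\<mu>. norm (\<psi> \<mu>) \<le> A' * exp (B' * norm \<mu>)"
    using assms(2) unfolding exptype_def by blast
  have "norm (\<phi> \<mu> + \<psi> \<mu>) \<le> (A + A') * exp ((B + B') * norm \<mu>)" for \<mu>
  proof -
    have "A * exp (B * norm \<mu>) \<le> A * exp ((B + B') * norm \<mu>)" "A' * exp (B' * norm \<mu>) \<le> A' * exp ((B + B') * norm \<mu>)"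
      using 1 2 by (auto intro!: mult_left_mono mult_right_mono)
    then show ?thesis
      using 1(3)[of \<mu>] 2(3)[of \<mu>] norm_triangle_ineq[of "\<phi> \<mu>" "\<psi> \<mu>"] unfolding distrib_right by linarith
  qed
  then show ?thesis unfolding exptype_def using 1 2 by (intro exI[of _ "A + A'"] exI[of _ "B + B'"]) auto
qed

lemma exptype_mult_norm:
  assumes "exptype \<phi>" "exptype \<psi>" "\<And>\<mu>. norm (\<rho> \<mu>) \<le> norm (\<phi> \<mu>) * norm (\<psi> \<mu>)" shows "exptype \<rho>"
proof -
  obtain A B where 1: "A \<ge> 0" "B \<ge> 0" "\<And>\<mu>. norm (\<phi> \<mu>) \<le> A * exp (B * norm \<mu>)"
    using assms(1) unfolding exptype_def by blast
  obtain A' B' where 2: "A' \<ge> 0" "B' \<ge> 0" "\<And>\<mu>. norm (\<psi> \<mu>) \<le> A' * exp (B' * norm \<mu>)"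
    using assms(2) unfolding exptype_def by blast
  have "norm (\<rho> \<mu>) \<le> (A * A') * exp ((B + B') * norm \<mu>)" for \<mu>
  proof -
    have "norm (\<phi> \<mu>) * norm (\<psi> \<mu>) \<le> (A * exp (B * norm \<mu>)) * (A' * exp (B' * norm \<mu>))"
      by (rule mult_mono[OF 1(3) 2(3)]) (use 1 in auto)
    also have "\<dots> = (A * A') * exp ((B + B') * norm \<mu>)" by (simp add: distrib_right exp_add)
    finally show ?thesis using assms(3)[of \<mu>] by linarith
  qed
  then show ?thesis unfolding exptype_def using 1 2 by (intro exI[of _ "A * A'"] exI[of _ "B + B'"]) auto
qed

lemma exptype_mult:
  fixes \<phi> \<psi> :: "complex \<Rightarrow> complex"
  shows "exptype \<phi> \<Longrightarrow> exptype \<psi> \<Longrightarrow> exptype (\<lambda>\<mu>. \<phi> \<mu> * \<psi> \<mu>)"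
  by (erule (1) exptype_mult_norm) (simp add: norm_mult)

lemma exptype_sum: "(\<And>i. i \<in> I \<Longrightarrow> exptype (\<phi> i)) \<Longrightarrow> exptype (\<lambda>\<mu>. \<Sum>i\<in>I. \<phi> i \<mu>)"
  by (induction I rule: infinite_finite_induct) (auto intro: exptype_const exptype_add)

lemma exptype_prod:
  fixes \<phi> :: "'i \<Rightarrow> complex \<Rightarrow> complex"
  shows "(\<And>i. i \<in> I \<Longrightarrow> exptype (\<phi> i)) \<Longrightarrow> exptype (\<lambda>\<mu>. \<Prod>i\<in>I. \<phi> i \<mu>)"
  by (induction I rule: infinite_finite_induct) (auto intro: exptype_const exptype_mult)

lemma exptype_vec:
  fixes \<phi> :: "complex \<Rightarrow> 'a::real_normed_vector^'n"
  assumes "\<And>i. exptype (\<lambda>\<mu>. \<phi> \<mu> $ i)" shows "exptype \<phi>"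
proof (rule exptype_bound)
  show "exptype (\<lambda>\<mu>. \<Sum>i\<in>UNIV. norm (\<phi> \<mu> $ i))"
    by (intro exptype_sum exptype_bound[OF assms]) auto
  show "norm (\<phi> \<mu>) \<le> norm (\<Sum>i\<in>UNIV. norm (\<phi> \<mu> $ i))" for \<mu>
    using norm_vec_sum_le[of "\<phi> \<mu>"] by (simp add: abs_of_nonneg sum_nonneg)
qed

lemma exptype_vec_nth: "exptype \<phi> \<Longrightarrow> exptype (\<lambda>\<mu>. \<phi> \<mu> $ i)"
  by (erule exptype_bound) (rule Finite_Cartesian_Product.norm_nth_le)

lemma exptype_det:
  fixes A :: "complex \<Rightarrow> complex^'n^'n"
  assumes "\<And>i j. exptype (\<lambda>\<mu>. A \<mu> $ i $ j)" shows "exptype (\<lambda>\<mu>. det (A \<mu>))"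
  unfolding det_def by (intro exptype_sum exptype_mult exptype_prod exptype_const assms)

lemma holomorphic_det:
  fixes A :: "complex \<Rightarrow> complex^'n^'n"
  assumes "\<And>i j. (\<lambda>\<mu>. A \<mu> $ i $ j) holomorphic_on S" shows "(\<lambda>\<mu>. det (A \<mu>)) holomorphic_on S"
  unfolding det_def by (intro holomorphic_intros assms)

section \<open>Taylor coefficients and local power series\<close>

definition taylor :: "(complex \<Rightarrow> complex) \<Rightarrow> complex \<Rightarrow> nat \<Rightarrow> complex"
  where "taylor \<phi> z k = (deriv ^^ k) \<phi> z / fact k"

lemma taylor_sums:
  assumes "\<phi> holomorphic_on UNIV"
  shows "(\<lambda>k. taylor \<phi> z k * (w - z) ^ k) sums \<phi> w"
  unfolding taylor_def
  by (rule holomorphic_power_series[where r = "dist z w + 1"])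
     (auto intro: holomorphic_on_subset[OF assms] simp: add_pos_nonneg intro: le_less_trans[OF zero_le_dist])

lemma taylor_bound:
  assumes "\<phi> holomorphic_on UNIV" "\<And>w. norm (w - z) = 1 \<Longrightarrow> norm (\<phi> w) \<le> B"
  shows "norm (taylor \<phi> z k) \<le> B"
proof -
  have *: "norm (\<phi> w) \<le> B" if "norm (z - w) = 1" for w
    using assms(2)[of w] that by (simp add: norm_minus_commute)
  have "norm ((deriv ^^ k) \<phi> z) \<le> fact k * B / 1 ^ k"
    by (rule Cauchy_inequality[OF _ _ _ *])
       (use assms in \<open>auto intro: holomorphic_on_subset holomorphic_on_imp_continuous_on\<close>)
  then show ?thesis by (simp add: taylor_def norm_divide pos_divide_le_eq mult.commute)
qed

lemma taylor_bounded:
  assumes "\<phi> holomorphic_on UNIV" obtains B where "B \<ge> 0" "\<And>k. norm (taylor \<phi> z k) \<le> B"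
proof -
  have "continuous_on (sphere z 1) \<phi>"
    by (intro holomorphic_on_imp_continuous_on holomorphic_on_subset[OF assms]) auto
  then have "bounded (\<phi> ` sphere z 1)" by (intro compact_imp_bounded compact_continuous_image) auto
  then obtain B where B: "\<forall>w\<in>sphere z 1. norm (\<phi> w) \<le> B" unfolding bounded_iff by auto
  have "norm (\<phi> w) \<le> max B 0" if "norm (w - z) = 1" for w
    using B[rule_format, of w] that by (simp add: dist_norm norm_minus_commute le_max_iff_disj)
  from taylor_bound[OF assms this] show ?thesis by (intro that[of "max B 0"]) auto
qed

text \<open>Identity theorem for power series, applied to the difference of the two
  expansions.\<close>

lemma taylor_unique:
  assumes "\<phi> holomorphic_on UNIV" "r > 0" "\<And>w. norm (w - z) < r \<Longrightarrow> (\<lambda>k. a k * (w - z) ^ k) sums \<phi> w"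
  shows "taylor \<phi> z k = a k"
proof -
  define e where "e k = taylor \<phi> z k - a k" for k
  have e: "(\<lambda>k. e k * u ^ k) sums 0" if "norm u < r" for u
    using sums_diff[OF taylor_sums[OF assms(1), of z "z + u"] assms(3)[of "z + u"]] that
    by (simp add: e_def left_diff_distrib)
  have "e k = 0"
  proof (cases "k = 0")
    case True
    have "(\<lambda>k. e k * 0 ^ k) sums e 0" by (rule powser_sums_zero)
    then show ?thesis using e[of 0] assms(2) True sums_unique2 by fastforce
  next
    case False
    show ?thesis
    proof (rule ccontr)
      assume "e k \<noteq> 0"
      \<comment> \<open>A nonzero coefficient of positive index would keep the sum, here the zero
        function, away from 0 near the centre.\<close>
      obtain s where "0 < s" "\<And>u :: complex. u \<in> cball 0 s - {0} \<Longrightarrow> (0::complex) \<noteq> 0"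
        by (rule powser_0_nonzero[where r = r and a = e and f = "\<lambda>_. 0" and m = k and \<xi> = 0]) (use assms(2) e \<open>e k \<noteq> 0\<close> False in auto)
      from this(2)[of "of_real s"] \<open>0 < s\<close> show False by simp
    qed
  qed
  then show ?thesis by (simp add: e_def)
qed

text \<open>The criterion by which dependence on the spectral parameter is shown to be entire: a
  local expansion at every point, with centre-dependent radius.\<close>

lemma holomorphic_locally_power_series:
  assumes "\<And>z. \<exists>a r. r > 0 \<and> (\<forall>w. norm (w - z) < r \<longrightarrow> (\<lambda>k. a k * (w - z) ^ k) sums \<phi> w)"
  shows "\<phi> holomorphic_on UNIV"
proof -
  have "\<phi> field_differentiable at z" for z
  proof -
    obtain a r where r: "r > 0" "\<And>w. norm (w - z) < r \<Longrightarrow> (\<lambda>k. a k * (w - z) ^ k) sums \<phi> w"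
      using assms[of z] by blast
    have "\<phi> holomorphic_on ball z r"
      by (rule power_series_holomorphic[of z r a]) (use r(2) in \<open>auto simp: dist_norm norm_minus_commute\<close>)
    then show ?thesis using r(1) by (simp add: holomorphic_on_open field_differentiable_def)
  qed
  then show ?thesis by (simp add: holomorphic_on_def field_differentiable_at_within)
qed

lemma L2_zero [simp]: "(\<lambda>t. 0 :: complex^'n) \<in> L2" by (rule L2_const)

lemma L2norm_zero [simp]: "L2norm (\<lambda>t. 0 :: complex^'n) = 0" by (simp add: L2norm_def)

lemma L2_cscale: "f \<in> L2 \<Longrightarrow> (\<lambda>t. c *s (f t :: complex^'n)) \<in> L2"
  by (rule L2_linear[OF _ bounded_linear_cvec_scale])

lemma L2norm_cscale: "L2norm (\<lambda>t. c *s (f t :: complex^'n)) = norm c * L2norm f"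
  by (simp add: L2norm_def norm_cvec_scale power_mult_distrib real_sqrt_mult)

context bvp
begin

text \<open>A change of the spectral parameter is moved to the right-hand side. This lets solutions
  for different parameters be compared in one equation.\<close>

lemma sol_shift:
  assumes "sol \<mu>0 g y" shows "sol \<mu> (\<lambda>t. g t - (\<mu> - \<mu>0) *s y t) y"
proof -
  have eq: "(diag_mat (\<lambda>k. \<mu> * (\<i> * a k)) + - (IA ** Q t)) *v y t + IA *v (g t - (\<mu> - \<mu>0) *s y t)
     = (diag_mat (\<lambda>k. \<mu>0 * (\<i> * a k)) + - (IA ** Q t)) *v y t + IA *v g t" for t
    unfolding vec_eq_iff matrix_vector_mult_add_rdistrib
    by (simp add: algebra_simps)
  show ?thesis using assms unfolding sol_def lin_sol_def eq .
qed

text \<open>The solution operator. The choice fixes values only on \<open>{0..1}\<close>; outside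
  they are arbitrary, so identities for \<open>S\<close> are stated at points of the
  interval.\<close>

definition S :: "complex \<Rightarrow> complex^'n \<Rightarrow> (real \<Rightarrow> complex^'n) \<Rightarrow> real \<Rightarrow> complex^'n"
  where "S \<mu> c f = (SOME y. sol \<mu> f y \<and> y 0 = c)"

lemma S: assumes "f \<in> L2" shows "sol \<mu> f (S \<mu> c f)" "S \<mu> c f 0 = c"
proof -
  obtain y where "sol \<mu> f y" "y 0 = c" by (rule sol_exists[OF assms])
  then have "\<exists>y. sol \<mu> f y \<and> y 0 = c" by blast
  then have "sol \<mu> f (S \<mu> c f) \<and> S \<mu> c f 0 = c"
    unfolding S_def by (rule someI_ex)
  then show "sol \<mu> f (S \<mu> c f)" "S \<mu> c f 0 = c" by auto
qed

lemma S_unique: "f \<in> L2 \<Longrightarrow> sol \<mu> f y \<Longrightarrow> x \<in> {0..1} \<Longrightarrow> y x = S \<mu> (y 0) f x"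
  by (rule sol_unique) (auto simp: S)

lemma sol_zero: "sol \<mu> (\<lambda>t. 0) (\<lambda>t. 0)"
  by (simp add: sol_def lin_sol_def)

lemma sol_scale: "sol \<mu> f y \<Longrightarrow> f \<in> L2 \<Longrightarrow> sol \<mu> (\<lambda>t. c *s f t) (\<lambda>t. c *s y t)"
  using sol_comb[OF _ sol_zero _ L2_zero, of \<mu> f y c] by simp

text \<open>Coefficients of the expansion in powers of \<mu> - \<mu>0: comparing powers in (L -
  \<mu>0) y = (\<mu> - \<mu>0) y + d f shows that each coefficient solves the equation with the
  previous one on the right.\<close>

fun ps :: "complex \<Rightarrow> (real \<Rightarrow> complex^'n) \<Rightarrow> (nat \<Rightarrow> complex^'n) \<Rightarrow> (nat \<Rightarrow> complex) \<Rightarrow> nat \<Rightarrow> real \<Rightarrow> complex^'n"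
  where "ps \<mu> f c d 0 = S \<mu> (c 0) (\<lambda>t. d 0 *s f t)"
  | "ps \<mu> f c d (Suc k) = S \<mu> (c (Suc k)) (\<lambda>t. 1 *s ps \<mu> f c d k t + d (Suc k) *s f t)"

lemma ps_L2: "f \<in> L2 \<Longrightarrow> ps \<mu> f c d k \<in> L2"
  by (induction k) (auto intro!: sol_L2[OF S(1)] L2_cscale L2_add)

lemma ps_init: "f \<in> L2 \<Longrightarrow> ps \<mu> f c d k 0 = c k"
  by (cases k) (auto intro!: S(2) L2_cscale L2_add ps_L2)

lemma ps_sol:
  assumes "f \<in> L2"
  shows "sol \<mu> (\<lambda>t. d 0 *s f t) (ps \<mu> f c d 0)" "sol \<mu> (\<lambda>t. ps \<mu> f c d k t + d (Suc k) *s f t) (ps \<mu> f c d (Suc k))"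
proof -
  show "sol \<mu> (\<lambda>t. d 0 *s f t) (ps \<mu> f c d 0)" by (simp add: S(1) L2_cscale assms)
  have "(\<lambda>t. 1 *s ps \<mu> f c d k t + d (Suc k) *s f t) \<in> L2" by (intro L2_add L2_cscale ps_L2 assms)
  from S(1)[OF this] show "sol \<mu> (\<lambda>t. ps \<mu> f c d k t + d (Suc k) *s f t) (ps \<mu> f c d (Suc k))" by simp
qed

text \<open>Each step of the recursion costs one application of \<open>sol_bound\<close>, hence
  geometric growth and a positive radius of convergence.\<close>

lemma ps_bound:
  fixes c :: "nat \<Rightarrow> complex^'n"
  assumes f: "f \<in> L2" and G: "\<And>k. norm (c k) \<le> G" "\<And>k. norm (d k) \<le> G"
  obtains X L where "X \<ge> 0" "L \<ge> 1" "\<And>k x. x \<in> {0..1} \<Longrightarrow> norm (ps \<mu> f c d k x) \<le> X * L ^ k"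
proof
  define E where "E = 2 * exp (2 * growth * (1 + norm \<mu>))"
  have E: "E > 0" by (simp add: E_def)
  define e where "e = norm IA"
  have e: "e \<ge> 0" by (simp add: e_def)
  have G0: "G \<ge> 0" using G(1)[of 0] norm_ge_zero order_trans by blast
  define H where "H = E * (G + e * (G * L2norm f))"
  have H: "H \<ge> 0" using E e G0 by (simp add: H_def)
  \<comment> \<open>\<open>2 * E * e\<close> closes the induction with the constant
    \<open>2 * H\<close>: one half covers the new data, the other the previous coefficient.\<close>
  define L where "L = max 1 (2 * E * e)"
  have L: "L \<ge> 1" "L \<ge> 2 * E * e" by (auto simp: L_def)
  show "2 * H \<ge> 0" using H by simp
  show "L \<ge> 1" by fact
  show "norm (ps \<mu> f c d k x) \<le> 2 * H * L ^ k" if "x \<in> {0..1}" for k x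
    using that
  proof (induction k arbitrary: x)
    case 0
    have "norm (ps \<mu> f c d 0 x) \<le> E * (norm (c 0) + e * L2norm (\<lambda>t. d 0 *s f t))"
      using sol_bound[OF ps_sol(1)[OF f] L2_cscale[OF f] 0] unfolding ps_init[OF f] E_def e_def .
    also have "\<dots> \<le> H" unfolding H_def L2norm_cscale
      using E e G by (intro mult_left_mono add_mono mult_right_mono) auto
    finally show ?case using H by simp
  next
    case (Suc k)
    let ?p = "ps \<mu> f c d k"
    have pn: "L2norm ?p \<le> 2 * H * L ^ k"
      by (rule L2norm_le_const[OF L2D(1)[OF ps_L2[OF f]]]) (use Suc.IH H L in auto)
    have "norm (ps \<mu> f c d (Suc k) x) \<le> E * (norm (c (Suc k)) + e * L2norm (\<lambda>t. ?p t + d (Suc k) *s f t))"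
      using sol_bound[OF ps_sol(2)[OF f] L2_add[OF ps_L2[OF f] L2_cscale[OF f]] Suc.prems] unfolding ps_init[OF f] E_def e_def .
    also have "\<dots> \<le> E * (G + e * (2 * H * L ^ k + G * L2norm f))"
    proof (intro mult_left_mono add_mono G order_trans[OF L2norm_triangle])
      show "L2norm (\<lambda>t. d (Suc k) *s f t) \<le> G * L2norm f"
        unfolding L2norm_cscale by (intro mult_right_mono G) auto
    qed (use pn E e f in \<open>auto intro: ps_L2 L2_cscale\<close>)
    also have "\<dots> = H + (2 * E * e) * (H * L ^ k)" by (simp add: H_def algebra_simps)
    also have "\<dots> \<le> H * L ^ Suc k + L * (H * L ^ k)"
    proof (intro add_mono mult_right_mono)
      show "H \<le> H * L ^ Suc k" using H L(1) one_le_power[OF L(1), of "Suc k"] by (simp add: mult_le_cancel_left1)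
    qed (use L H in auto)
    also have "\<dots> = 2 * H * L ^ Suc k" by simp
    finally show ?case .
  qed
qed

text \<open>Partial sums of the power series solve the equation up to a small right-hand side, so
  the a priori bound yields uniform convergence; no integral of a series is needed.\<close>

lemma ps_converges:
  fixes c :: "nat \<Rightarrow> complex^'n" and y :: "real \<Rightarrow> complex^'n"
  assumes f: "f \<in> L2" and c: "\<And>i. (\<lambda>k. c k $ i * (\<mu> - \<mu>0) ^ k) sums (y 0 $ i)"
    and d: "(\<lambda>k. d k * (\<mu> - \<mu>0) ^ k) sums dd" and y: "sol \<mu> (\<lambda>t. dd *s f t) y"
    and XL: "X \<ge> 0" "L \<ge> 1" "\<And>k x. x \<in> {0..1} \<Longrightarrow> norm (ps \<mu>0 f c d k x) \<le> X * L ^ k"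
    and \<mu>: "norm (\<mu> - \<mu>0) * L < 1"
  obtains \<epsilon> where "\<epsilon> \<longlonglongrightarrow> 0" "\<And>N x. x \<in> {0..1} \<Longrightarrow> norm (y x - (\<Sum>k\<le>N. (\<mu> - \<mu>0) ^ k *s ps \<mu>0 f c d k x)) \<le> \<epsilon> N"
proof -
  define w where "w = \<mu> - \<mu>0"
  let ?p = "ps \<mu>0 f c d"
  define P where "P N x = (\<Sum>k\<le>N. w ^ k *s ?p k x)" for N x
  define dN where "dN N = (\<Sum>k\<le>N. d k * w ^ k)" for N
  define cN where "cN N = (\<Sum>k\<le>N. w ^ k *s c k)" for N
  have P_L2: "P N \<in> L2" for N
    by (induction N) (auto simp: P_def simp del: ps.simps intro!: L2_cscale L2_add ps_L2 f)
  \<comment> \<open>The term in parentheses is the sum of \<open>w ^ Suc k *s ?p k t\<close> over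
    \<open>k < N\<close>: the shifted partial sum without its last term.\<close>
  have P_sol: "sol \<mu>0 (\<lambda>t. (w *s P N t - w ^ Suc N *s ?p N t) + dN N *s f t) (P N)" for N
  proof (induction N)
    case 0
    show ?case using ps_sol(1)[OF f, of \<mu>0 d c] by (simp add: P_def dN_def)
  next
    case (Suc N)
    have g1: "(\<lambda>t. ?p N t + d (Suc N) *s f t) \<in> L2" by (intro L2_add L2_cscale ps_L2 f)
    have g2: "(\<lambda>t. (w *s P N t - w ^ Suc N *s ?p N t) + dN N *s f t) \<in> L2"
      by (intro L2_add L2_diff L2_cscale ps_L2 f P_L2)
    have "sol \<mu>0 (\<lambda>t. w ^ Suc N *s (?p N t + d (Suc N) *s f t) + ((w *s P N t - w ^ Suc N *s ?p N t) + dN N *s f t))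
        (\<lambda>t. w ^ Suc N *s ?p (Suc N) t + P N t)"
      by (rule sol_comb[OF ps_sol(2)[OF f] Suc g1 g2])
    moreover have "(\<lambda>t. w ^ Suc N *s ?p (Suc N) t + P N t) = P (Suc N)"
      by (simp add: P_def fun_eq_iff add.commute del: ps.simps power_Suc)
    moreover have "w ^ Suc N *s (?p N t + d (Suc N) *s f t) + ((w *s P N t - w ^ Suc N *s ?p N t) + dN N *s f t)
        = (w *s P (Suc N) t - w ^ Suc (Suc N) *s ?p (Suc N) t) + dN (Suc N) *s f t" for t
      by (simp add: P_def dN_def vec_eq_iff algebra_simps del: ps.simps)
    ultimately show ?case by simp
  qed
  \<comment> \<open>Passing from \<mu>0 to \<mu> cancels \<open>w *s P N t\<close>, so that the
    error of the partial sum is a single term of order N + 1.\<close>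
  have P_sol': "sol \<mu> (\<lambda>t. (- (w ^ Suc N)) *s ?p N t + dN N *s f t) (P N)" for N
  proof -
    have "(\<lambda>t. (w *s P N t - w ^ Suc N *s ?p N t) + dN N *s f t - (\<mu> - \<mu>0) *s P N t)
      = (\<lambda>t. (- (w ^ Suc N)) *s ?p N t + dN N *s f t)"
      by (simp add: w_def vec_eq_iff fun_eq_iff algebra_simps)
    then show ?thesis using sol_shift[OF P_sol[of N], of \<mu>] by simp
  qed
  have diff_sol: "sol \<mu> (\<lambda>t. w ^ Suc N *s ?p N t + (dd - dN N) *s f t) (\<lambda>t. y t - P N t)" for N
  proof -
    have "sol \<mu> (\<lambda>t. (-1) *s ((- (w ^ Suc N)) *s ?p N t + dN N *s f t) + dd *s f t) (\<lambda>t. (-1) *s P N t + y t)"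
      by (rule sol_comb[OF P_sol' y]) (intro L2_add L2_cscale ps_L2 f)+
    moreover have "(\<lambda>t. (-1) *s ((- (w ^ Suc N)) *s ?p N t + dN N *s f t) + dd *s f t)
       = (\<lambda>t. w ^ Suc N *s ?p N t + (dd - dN N) *s f t)"
      by (simp add: vec_eq_iff fun_eq_iff algebra_simps)
    moreover have "(\<lambda>t. (-1) *s P N t + y t) = (\<lambda>t. y t - P N t)"
      by (simp add: vec_eq_iff fun_eq_iff)
    ultimately show ?thesis by simp
  qed
  define E where "E = 2 * exp (2 * growth * (1 + norm \<mu>))"
  \<comment> \<open>The a priori bound for the difference: errors of the initial value, of the last
    term and of the coefficient of \<open>f\<close>.\<close>
  define \<epsilon> where "\<epsilon> N = E * (norm (y 0 - cN N) + norm IA * (norm w * X * (norm w * L) ^ N + norm (dd - dN N) * L2norm f))" for N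
  have P0: "P N 0 = cN N" for N by (simp add: P_def cN_def ps_init[OF f])
  show ?thesis
  proof
    show "norm (y x - (\<Sum>k\<le>N. (\<mu> - \<mu>0) ^ k *s ?p k x)) \<le> \<epsilon> N" if x: "x \<in> {0..1}" for N x
    proof -
      have g1: "(\<lambda>t. w ^ Suc N *s ?p N t) \<in> L2" "(\<lambda>t. (dd - dN N) *s f t) \<in> L2"
        by (intro L2_cscale ps_L2 f)+
      have "norm (y x - P N x) \<le> E * (norm (y 0 - P N 0) + norm IA * L2norm (\<lambda>t. w ^ Suc N *s ?p N t + (dd - dN N) *s f t))"
        unfolding E_def by (rule sol_bound[OF diff_sol L2_add[OF g1] x])
      also have "\<dots> \<le> \<epsilon> N" unfolding \<epsilon>_def P0
      proof (intro mult_left_mono add_left_mono order_trans[OF L2norm_triangle[OF g1]] add_mono)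
        have "L2norm (\<lambda>t. w ^ Suc N *s ?p N t) \<le> norm w ^ Suc N * (X * L ^ N)"
          unfolding L2norm_cscale norm_power
          by (intro mult_left_mono L2norm_le_const L2D(1) ps_L2 f XL(3)) (use XL in auto)
        then show "L2norm (\<lambda>t. w ^ Suc N *s ?p N t) \<le> norm w * X * (norm w * L) ^ N"
          by (simp add: power_mult_distrib mult_ac)
        show "L2norm (\<lambda>t. (dd - dN N) *s f t) \<le> norm (dd - dN N) * L2norm f"
          by (simp only: L2norm_cscale order_refl)
      qed (auto simp: E_def)
      finally show ?thesis by (simp add: P_def w_def)
    qed
    have "cN \<longlonglongrightarrow> y 0"
    proof (rule vec_tendstoI)
      fix i
      have "(\<lambda>N. \<Sum>k\<le>N. c k $ i * (\<mu> - \<mu>0) ^ k) \<longlonglongrightarrow> y 0 $ i" using c[of i] by (simp add: sums_def_le)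
      then show "(\<lambda>N. cN N $ i) \<longlonglongrightarrow> y 0 $ i" by (simp add: cN_def w_def mult.commute)
    qed
    moreover have "dN \<longlonglongrightarrow> dd" using d by (simp add: sums_def_le dN_def[abs_def] w_def)
    moreover have "(\<lambda>N. (norm w * L) ^ N) \<longlonglongrightarrow> 0"
      by (rule LIMSEQ_realpow_zero) (use \<mu> XL in \<open>auto simp: w_def\<close>)
    ultimately have "\<epsilon> \<longlonglongrightarrow> E * (norm (y 0 - y 0) + norm IA * (norm w * X * 0 + norm (dd - dd) * L2norm f))"
      unfolding \<epsilon>_def by (intro tendsto_add tendsto_mult tendsto_norm tendsto_diff tendsto_const)
    then show "\<epsilon> \<longlonglongrightarrow> 0" by simp
  qed
qed

end

subsection \<open>The characteristic determinant\<close>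

definition bounded_functional :: "((real \<Rightarrow> complex^'n) \<Rightarrow> complex) \<Rightarrow> bool"
  where "bounded_functional l \<longleftrightarrow> (\<forall>f\<in>L2. \<forall>g\<in>L2. \<forall>c. l (\<lambda>t. c *s f t + g t) = c * l f + l g) \<and>
    (\<exists>B\<ge>0. \<forall>f\<in>L2. norm (l f) \<le> B * L2norm f)"

lemma bounded_functional_lin:
  "bounded_functional l \<Longrightarrow> f \<in> L2 \<Longrightarrow> g \<in> L2 \<Longrightarrow> l (\<lambda>t. c *s f t + g t) = c * l f + l g"
  unfolding bounded_functional_def by blast

lemma holomorphic_if: "(P \<Longrightarrow> f holomorphic_on S) \<Longrightarrow> (\<not> P \<Longrightarrow> g holomorphic_on S) \<Longrightarrow>
    (\<lambda>x. if P then f x else g x) holomorphic_on S"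
  by (cases P) auto

lemma exptype_if: "(P \<Longrightarrow> exptype f) \<Longrightarrow> (\<not> P \<Longrightarrow> exptype g) \<Longrightarrow> exptype (\<lambda>x. if P then f x else g x)"
  by (cases P) auto

lemma bounded_functional_sum:
  fixes N :: nat
  assumes l: "bounded_functional l" and p: "\<And>k. p k \<in> L2"
  shows "(\<lambda>t. \<Sum>k\<le>N. w k *s p k t) \<in> L2 \<and> l (\<lambda>t. \<Sum>k\<le>N. w k *s p k t) = (\<Sum>k\<le>N. w k * l (p k))"
proof (induction N)
  case 0
  have z: "l (\<lambda>t. 0) = 0" 
  proof -
    obtain B where "\<And>f. f \<in> L2 \<Longrightarrow> norm (l f) \<le> B * L2norm f" using l unfolding bounded_functional_def by blast
    from this[OF L2_const, of 0] show ?thesis by (simp add: L2norm_def)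
  qed
  have "l (\<lambda>t. w 0 *s p 0 t + 0) = w 0 * l (p 0) + l (\<lambda>t. 0)"
    by (rule bounded_functional_lin[OF l p L2_const])
  then show ?case using z p L2_linear[OF p bounded_linear_cvec_scale] by simp
next
  case (Suc N)
  have "l (\<lambda>t. w (Suc N) *s p (Suc N) t + (\<Sum>k\<le>N. w k *s p k t)) = w (Suc N) * l (p (Suc N)) + l (\<lambda>t. \<Sum>k\<le>N. w k *s p k t)"
    by (rule bounded_functional_lin[OF l p]) (use Suc in simp)
  moreover have "(\<lambda>t. w (Suc N) *s p (Suc N) t + (\<Sum>k\<le>N. w k *s p k t)) \<in> L2"
    by (intro L2_add L2_linear[OF p bounded_linear_cvec_scale]) (use Suc in auto)
  ultimately show ?case using Suc by (simp add: add.commute)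
qed

lemma bounded_functional_diff:
  assumes l: "bounded_functional l" and "f \<in> L2" "g \<in> L2"
  shows "l f - l g = l (\<lambda>t. f t - g t)"
proof -
  have "l (\<lambda>t. (-1) *s g t + f t) = (-1) * l g + l f"
    using assms unfolding bounded_functional_def by blast
  moreover have "(\<lambda>t. (-1) *s g t + f t) = (\<lambda>t. f t - g t)" by (simp add: vec_eq_iff fun_eq_iff)
  ultimately show ?thesis by simp
qed

text \<open>The adjugate, written by Cramer's rule: entry (k, l) replaces column k by the lth unit
  vector. Being polynomial in the entries of M, it is entire and of exponential type in \<mu>
  whenever they are.\<close>

definition adjm :: "complex^'n^'n \<Rightarrow> complex^'n^'n"
  where "adjm M = (\<chi> k l. det (\<chi> i j. if j = k then (if i = l then 1 else 0) else M $ i $ j))"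

text \<open>Cramer's rule for the columns of the inverse. At parameters where the determinant
  vanishes, the identity it serves is recovered by analytic continuation in
  \<open>U_bc\<close>.\<close>

lemma mult_adjm:
  assumes "det M \<noteq> 0"
  shows "M *v (adjm M *v v) = det M *s v"
proof -
  obtain N where N: "M ** N = mat 1" using assms invertible_det_nz[of M] unfolding invertible_def by auto
  have "adjm M $ k $ l = det M * N $ k $ l" for k l
  proof -
    define x where "x = (\<chi> k. N $ k $ l)"
    have Mx: "(M *v x) $ i = (if i = l then 1 else 0)" for i
    proof -
      have "(M *v x) $ i = (M ** N) $ i $ l" by (simp add: x_def matrix_vector_mult_def matrix_matrix_mult_def)
      then show ?thesis by (simp add: N mat_def)
    qed
    have "adjm M $ k $ l = det (\<chi> i j. if j = k then (M *v x) $ i else M $ i $ j)"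
      unfolding adjm_def Mx by simp
    also have "\<dots> = x $ k * det M" by (rule cramer_lemma)
    finally show ?thesis by (simp add: x_def mult.commute)
  qed
  then have "adjm M *v v = det M *s (N *v v)"
    by (simp add: vec_eq_iff matrix_vector_mult_def sum_distrib_left mult.assoc)
  then show ?thesis by (simp add: vec.scale matrix_vector_mul_assoc N)
qed

context bvp
begin

text \<open>Combines \<open>ps_bound\<close> and \<open>ps_converges\<close>: the data are entire,
  so their Taylor coefficients are bounded, and the solutions have a uniformly convergent expansion
  of radius 1 / L.\<close>

lemma sol_analytic:
  fixes c :: "complex \<Rightarrow> complex^'n" and y :: "complex \<Rightarrow> real \<Rightarrow> complex^'n"
  assumes f: "f \<in> L2" and c: "\<And>i. (\<lambda>\<mu>. c \<mu> $ i) holomorphic_on UNIV" and d: "d holomorphic_on UNIV"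
    and y: "\<And>\<mu>. sol \<mu> (\<lambda>t. d \<mu> *s f t) (y \<mu>)" "\<And>\<mu>. y \<mu> 0 = c \<mu>"
  obtains p r where "r > 0" "sol \<nu> (\<lambda>t. taylor d \<nu> 0 *s f t) (p 0)"
    "\<And>k. sol \<nu> (\<lambda>t. p k t + taylor d \<nu> (Suc k) *s f t) (p (Suc k))"
    "\<And>k i. p k 0 $ i = taylor (\<lambda>\<mu>. c \<mu> $ i) \<nu> k"
    "\<And>\<mu>. norm (\<mu> - \<nu>) < r \<Longrightarrow> \<exists>\<epsilon>. \<epsilon> \<longlonglongrightarrow> 0 \<and> (\<forall>N. \<forall>x\<in>{0..1}. norm (y \<mu> x - (\<Sum>k\<le>N. (\<mu> - \<nu>) ^ k *s p k x)) \<le> \<epsilon> N)"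
proof -
  define ck where "ck k = (\<chi> i. taylor (\<lambda>\<mu>. c \<mu> $ i) \<nu> k)" for k
  define dk where "dk = taylor d \<nu>"
  have "\<exists>B. \<forall>k. norm (taylor (\<lambda>\<mu>. c \<mu> $ i) \<nu> k) \<le> B" for i
    using taylor_bounded[OF c[of i]] by blast
  then obtain B where B: "\<And>i k. norm (taylor (\<lambda>\<mu>. c \<mu> $ i) \<nu> k) \<le> B i" by metis
  obtain B' where B': "B' \<ge> 0" "\<And>k. norm (dk k) \<le> B'" unfolding dk_def using taylor_bounded[OF d] by blast
  have ckb: "norm (ck k) \<le> (\<Sum>i\<in>UNIV. B i)" for k
    by (rule order_trans[OF norm_vec_sum_le]) (auto simp: ck_def intro!: sum_mono B)
  have B0: "0 \<le> (\<Sum>i\<in>UNIV. B i)" using ckb[of 0] norm_ge_zero order_trans by blast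
  define G where "G = (\<Sum>i\<in>UNIV. B i) + B'"
  have G: "norm (ck k) \<le> G" "norm (dk k) \<le> G" for k
    unfolding G_def using ckb[of k] B'(2)[of k] B'(1) B0 by linarith+
  obtain X L where XL: "X \<ge> 0" "L \<ge> 1" "\<And>k x. x \<in> {0..1} \<Longrightarrow> norm (ps \<nu> f ck dk k x) \<le> X * L ^ k"
    by (rule ps_bound[where c = ck and d = dk and G = G and \<mu> = \<nu>, OF f G]) blast
  show ?thesis
  proof (rule that[of "1 / L" "ps \<nu> f ck dk"])
    show "1 / L > 0" using XL by simp
    show "sol \<nu> (\<lambda>t. taylor d \<nu> 0 *s f t) (ps \<nu> f ck dk 0)"
      using ps_sol(1)[OF f, of \<nu> dk ck] by (simp add: dk_def)
    show "sol \<nu> (\<lambda>t. ps \<nu> f ck dk k t + taylor d \<nu> (Suc k) *s f t) (ps \<nu> f ck dk (Suc k))" for k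
      using ps_sol(2)[OF f, of \<nu> ck dk k] unfolding dk_def .
    show "ps \<nu> f ck dk k 0 $ i = taylor (\<lambda>\<mu>. c \<mu> $ i) \<nu> k" for k i
      unfolding ps_init[OF f] by (simp add: ck_def)
    fix \<mu> assume "norm (\<mu> - \<nu>) < 1 / L"
    then have \<mu>: "norm (\<mu> - \<nu>) * L < 1" using XL by (simp add: pos_less_divide_eq)
    have 1: "(\<lambda>k. ck k $ i * (\<mu> - \<nu>) ^ k) sums (y \<mu> 0 $ i)" for i
      using taylor_sums[OF c[of i], of \<nu> \<mu>] by (simp add: ck_def y(2))
    have 2: "(\<lambda>k. dk k * (\<mu> - \<nu>) ^ k) sums d \<mu>" unfolding dk_def by (rule taylor_sums[OF d])
    show "\<exists>\<epsilon>. \<epsilon> \<longlonglongrightarrow> 0 \<and> (\<forall>N. \<forall>x\<in>{0..1}. norm (y \<mu> x - (\<Sum>k\<le>N. (\<mu> - \<nu>) ^ k *s ps \<nu> f ck dk k x)) \<le> \<epsilon> N)"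
      using ps_converges[OF f 1 2 y(1) XL \<mu>] by metis
  qed
qed

text \<open>Uniform convergence on the interval survives point evaluation and every bounded
  functional. The functions \<open>p k\<close> act as Taylor coefficients of the function-valued map
  \<open>y\<close>, although only scalar functions are ever differentiated.\<close>

lemma sol_functional_analytic:
  fixes c :: "complex \<Rightarrow> complex^'n" and y :: "complex \<Rightarrow> real \<Rightarrow> complex^'n"
  assumes f: "f \<in> L2" and c: "\<And>i. (\<lambda>\<mu>. c \<mu> $ i) holomorphic_on UNIV" and d: "d holomorphic_on UNIV"
    and y: "\<And>\<mu>. sol \<mu> (\<lambda>t. d \<mu> *s f t) (y \<mu>)" "\<And>\<mu>. y \<mu> 0 = c \<mu>"
  shows "\<And>x i. x \<in> {0..1} \<Longrightarrow> (\<lambda>\<mu>. y \<mu> x $ i) holomorphic_on UNIV"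
    "\<And>l. bounded_functional l \<Longrightarrow> (\<lambda>\<mu>. l (y \<mu>)) holomorphic_on UNIV"
    "\<exists>p. sol \<nu> (\<lambda>t. taylor d \<nu> 0 *s f t) (p 0) \<and> (\<forall>k. sol \<nu> (\<lambda>t. p k t + taylor d \<nu> (Suc k) *s f t) (p (Suc k))) \<and>
      (\<forall>k. \<forall>x\<in>{0..1}. \<forall>i. p k x $ i = taylor (\<lambda>\<mu>. y \<mu> x $ i) \<nu> k) \<and>
      (\<forall>l k. bounded_functional l \<longrightarrow> l (p k) = taylor (\<lambda>\<mu>. l (y \<mu>)) \<nu> k)"
proof -
  have key: "\<exists>p r. r > 0 \<and> sol \<nu> (\<lambda>t. taylor d \<nu> 0 *s f t) (p 0) \<and> (\<forall>k. sol \<nu> (\<lambda>t. p k t + taylor d \<nu> (Suc k) *s f t) (p (Suc k))) \<and>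
      (\<forall>\<mu>. norm (\<mu> - \<nu>) < r \<longrightarrow> (\<forall>x\<in>{0..1}. \<forall>i. (\<lambda>k. p k x $ i * (\<mu> - \<nu>) ^ k) sums (y \<mu> x $ i)) \<and>
         (\<forall>l. bounded_functional l \<longrightarrow> (\<lambda>k. l (p k) * (\<mu> - \<nu>) ^ k) sums l (y \<mu>)))" for \<nu>
  proof -
    obtain p r where r: "r > 0" and s0: "sol \<nu> (\<lambda>t. taylor d \<nu> 0 *s f t) (p 0)"
      and sS: "\<And>k. sol \<nu> (\<lambda>t. p k t + taylor d \<nu> (Suc k) *s f t) (p (Suc k))"
      and conv: "\<And>\<mu>. norm (\<mu> - \<nu>) < r \<Longrightarrow> \<exists>\<epsilon>. \<epsilon> \<longlonglongrightarrow> 0 \<and> (\<forall>N. \<forall>x\<in>{0..1}. norm (y \<mu> x - (\<Sum>k\<le>N. (\<mu> - \<nu>) ^ k *s p k x)) \<le> \<epsilon> N)"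
      by (rule sol_analytic[OF f c d y, where \<nu> = \<nu>]) blast
    have pL: "p k \<in> L2" for k using s0 sS by (cases k) (auto intro: sol_L2)
    have "(\<forall>x\<in>{0..1}. \<forall>i. (\<lambda>k. p k x $ i * (\<mu> - \<nu>) ^ k) sums (y \<mu> x $ i)) \<and>
         (\<forall>l. bounded_functional l \<longrightarrow> (\<lambda>k. l (p k) * (\<mu> - \<nu>) ^ k) sums l (y \<mu>))" if \<mu>: "norm (\<mu> - \<nu>) < r" for \<mu>
    proof (intro conjI ballI allI impI)
      obtain \<epsilon> where \<epsilon>: "\<epsilon> \<longlonglongrightarrow> 0" "\<And>N x. x \<in> {0..1} \<Longrightarrow> norm (y \<mu> x - (\<Sum>k\<le>N. (\<mu> - \<nu>) ^ k *s p k x)) \<le> \<epsilon> N"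
        using conv[OF \<mu>] by blast
      have \<epsilon>0: "\<epsilon> N \<ge> 0" for N using order_trans[OF norm_ge_zero \<epsilon>(2)[of 0 N]] by simp
      {
        fix x :: real and i assume x: "x \<in> {0..1}"
        have "(\<lambda>N. y \<mu> x $ i - (\<Sum>k\<le>N. p k x $ i * (\<mu> - \<nu>) ^ k)) \<longlonglongrightarrow> 0"
        proof (rule Lim_null_comparison[OF _ \<epsilon>(1)], rule always_eventually, rule allI)
          fix N
          have "y \<mu> x $ i - (\<Sum>k\<le>N. p k x $ i * (\<mu> - \<nu>) ^ k) = (y \<mu> x - (\<Sum>k\<le>N. (\<mu> - \<nu>) ^ k *s p k x)) $ i"
            by (simp add: mult.commute)
          then show "norm (y \<mu> x $ i - (\<Sum>k\<le>N. p k x $ i * (\<mu> - \<nu>) ^ k)) \<le> \<epsilon> N"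
            using order_trans[OF Finite_Cartesian_Product.norm_nth_le \<epsilon>(2)[OF x, of N]] by simp
        qed
        from tendsto_diff[OF tendsto_const[of "y \<mu> x $ i"] this]
        show "(\<lambda>k. p k x $ i * (\<mu> - \<nu>) ^ k) sums (y \<mu> x $ i)" by (simp add: sums_def_le)
      next
        fix l :: "(real \<Rightarrow> complex^'n) \<Rightarrow> complex" assume l: "bounded_functional l"
        obtain B where B: "B \<ge> 0" "\<And>f. f \<in> L2 \<Longrightarrow> norm (l f) \<le> B * L2norm f"
          using l unfolding bounded_functional_def by blast
        have yL: "y \<mu> \<in> L2" by (rule sol_L2[OF y(1)])
        have "(\<lambda>N. l (y \<mu>) - (\<Sum>k\<le>N. l (p k) * (\<mu> - \<nu>) ^ k)) \<longlonglongrightarrow> 0"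
        proof (rule Lim_null_comparison[where g = "\<lambda>N. B * \<epsilon> N"], rule always_eventually, rule allI)
          fix N
          let ?P = "\<lambda>t. \<Sum>k\<le>N. (\<mu> - \<nu>) ^ k *s p k t"
          have P: "?P \<in> L2" "l ?P = (\<Sum>k\<le>N. l (p k) * (\<mu> - \<nu>) ^ k)"
            using bounded_functional_sum[OF l pL, where N = N and w = "\<lambda>k. (\<mu> - \<nu>) ^ k"] by (simp_all add: mult.commute)
          have "norm (l (y \<mu>) - l ?P) = norm (l (\<lambda>t. y \<mu> t - ?P t))"
            by (simp only: bounded_functional_diff[OF l yL P(1)])
          also have "\<dots> \<le> B * L2norm (\<lambda>t. y \<mu> t - ?P t)" by (rule B(2)[OF L2_diff[OF yL P(1)]])
          also have "\<dots> \<le> B * \<epsilon> N"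
            by (intro mult_left_mono L2norm_le_const L2D(1) L2_diff yL P(1) \<epsilon> \<epsilon>0 B(1))
          finally show "norm (l (y \<mu>) - (\<Sum>k\<le>N. l (p k) * (\<mu> - \<nu>) ^ k)) \<le> B * \<epsilon> N" unfolding P(2) .
        next
          show "(\<lambda>N. B * \<epsilon> N) \<longlonglongrightarrow> 0" using tendsto_mult_right_zero[OF \<epsilon>(1)] .
        qed
        from tendsto_diff[OF tendsto_const[of "l (y \<mu>)"] this]
        show "(\<lambda>k. l (p k) * (\<mu> - \<nu>) ^ k) sums l (y \<mu>)" by (simp add: sums_def_le)
      }
    qed
    with r s0 sS show ?thesis by blast
  qed
  show h1: "(\<lambda>\<mu>. y \<mu> x $ i) holomorphic_on UNIV" if x: "x \<in> {0..1}" for x i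
  proof (rule holomorphic_locally_power_series)
    fix z
    obtain p r where "r > 0" "\<forall>\<mu>. norm (\<mu> - z) < r \<longrightarrow> (\<forall>x\<in>{0..1}. \<forall>i. (\<lambda>k. p k x $ i * (\<mu> - z) ^ k) sums (y \<mu> x $ i))"
      using key[of z] by blast
    with x show "\<exists>a r. r > 0 \<and> (\<forall>w. norm (w - z) < r \<longrightarrow> (\<lambda>k. a k * (w - z) ^ k) sums (y w x $ i))"
      by (intro exI[of _ "\<lambda>k. p k x $ i"] exI[of _ r]) blast
  qed
  show h2: "(\<lambda>\<mu>. l (y \<mu>)) holomorphic_on UNIV" if l: "bounded_functional l" for l
  proof (rule holomorphic_locally_power_series)
    fix z
    obtain p r where "r > 0" "\<forall>\<mu>. norm (\<mu> - z) < r \<longrightarrow> (\<forall>l. bounded_functional l \<longrightarrow> (\<lambda>k. l (p k) * (\<mu> - z) ^ k) sums l (y \<mu>))"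
      using key[of z] by blast
    with l show "\<exists>a r. r > 0 \<and> (\<forall>w. norm (w - z) < r \<longrightarrow> (\<lambda>k. a k * (w - z) ^ k) sums l (y w))"
      by (intro exI[of _ "\<lambda>k. l (p k)"] exI[of _ r]) blast
  qed
  obtain p r where r: "r > 0" and p: "sol \<nu> (\<lambda>t. taylor d \<nu> 0 *s f t) (p 0)"
      "\<forall>k. sol \<nu> (\<lambda>t. p k t + taylor d \<nu> (Suc k) *s f t) (p (Suc k))"
      and q: "\<forall>\<mu>. norm (\<mu> - \<nu>) < r \<longrightarrow> (\<forall>x\<in>{0..1}. \<forall>i. (\<lambda>k. p k x $ i * (\<mu> - \<nu>) ^ k) sums (y \<mu> x $ i)) \<and>
         (\<forall>l. bounded_functional l \<longrightarrow> (\<lambda>k. l (p k) * (\<mu> - \<nu>) ^ k) sums l (y \<mu>))"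
    using key[of \<nu>] by blast
  have "p k x $ i = taylor (\<lambda>\<mu>. y \<mu> x $ i) \<nu> k" if "x \<in> {0..1}" for k x i
    by (rule taylor_unique[OF h1[OF that] r, symmetric]) (use q that in blast)
  moreover have "l (p k) = taylor (\<lambda>\<mu>. l (y \<mu>)) \<nu> k" if "bounded_functional l" for l k
    by (rule taylor_unique[OF h2[OF that] r, symmetric]) (use q that in blast)
  ultimately show "\<exists>p. sol \<nu> (\<lambda>t. taylor d \<nu> 0 *s f t) (p 0) \<and> (\<forall>k. sol \<nu> (\<lambda>t. p k t + taylor d \<nu> (Suc k) *s f t) (p (Suc k))) \<and>
      (\<forall>k. \<forall>x\<in>{0..1}. \<forall>i. p k x $ i = taylor (\<lambda>\<mu>. y \<mu> x $ i) \<nu> k) \<and>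
      (\<forall>l k. bounded_functional l \<longrightarrow> l (p k) = taylor (\<lambda>\<mu>. l (y \<mu>)) \<nu> k)"
    using p by blast
qed

lemma S_holomorphic: "f \<in> L2 \<Longrightarrow> x \<in> {0..1} \<Longrightarrow> (\<lambda>\<mu>. S \<mu> c f x $ i) holomorphic_on UNIV"
  by (rule sol_functional_analytic(1)[where f = f and c = "\<lambda>_. c" and d = "\<lambda>_. 1"]) (auto simp: S intro: holomorphic_intros)

lemma S_bound:
  assumes "f \<in> L2" "x \<in> {0..1}"
  shows "norm (S \<mu> c f x) \<le> 2 * exp (2 * growth * (1 + norm \<mu>)) * (norm c + norm IA * L2norm f)"
  using sol_bound[OF S(1)[OF assms(1)] assms(1,2)] S(2)[OF assms(1)] by metis

lemma exptype_growth: "exptype (\<lambda>\<mu>. 2 * exp (2 * growth * (1 + norm \<mu>)))"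
  unfolding exptype_def
proof (intro exI conjI allI)
  show "norm (2 * exp (2 * growth * (1 + norm \<mu>))) \<le> (2 * exp (2 * growth)) * exp (2 * growth * norm \<mu>)" for \<mu> :: complex
    by (simp add: distrib_left exp_add)
qed (use growth_pos in auto)

lemma exptype_S:
  assumes "f \<in> L2" "x \<in> {0..1}" shows "exptype (\<lambda>\<mu>. S \<mu> c f x)"
proof (rule exptype_mult_norm[OF exptype_growth exptype_const[of "norm c + norm IA * L2norm f"]])
  show "norm (S \<mu> c f x) \<le> norm (2 * exp (2 * growth * (1 + norm \<mu>))) * norm (norm c + norm IA * L2norm f)" for \<mu>
    using S_bound[OF assms, of \<mu> c] by (simp add: abs_of_nonneg)
qed

text \<open>The value at 1 of the fundamental matrix that is the identity at 0.\<close>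

definition Ym :: "complex \<Rightarrow> complex^'n^'n" where "Ym \<mu> = (\<chi> i j. S \<mu> (axis j 1) (\<lambda>t. 0) 1 $ i)"

text \<open>The characteristic matrix: it takes the initial value of a homogeneous solution to its
  boundary form, so its kernel describes the eigenfunctions.\<close>

definition Mm :: "complex \<Rightarrow> complex^'n^'n" where "Mm \<mu> = C + D ** Ym \<mu>"

definition \<Delta> :: "complex \<Rightarrow> complex" where "\<Delta> \<mu> = det (Mm \<mu>)"

text \<open>The initial value of the resolvent solves Mm y(0) = -D S(0, f)(1). Using the adjugate
  instead of the inverse multiplies it by the determinant and makes it entire.\<close>

definition u :: "complex \<Rightarrow> (real \<Rightarrow> complex^'n) \<Rightarrow> complex^'n"
  where "u \<mu> f = - (adjm (Mm \<mu>) *v (D *v S \<mu> 0 f 1))"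

text \<open>\<open>U\<close> is the resolvent applied to \<open>f\<close>, multiplied by the characteristic determinant: an entire
  function whose Taylor coefficients at a zero of \<open>\<Delta>\<close> are root functions up to the order of that zero.\<close>

definition U :: "complex \<Rightarrow> (real \<Rightarrow> complex^'n) \<Rightarrow> real \<Rightarrow> complex^'n"
  where "U \<mu> f = S \<mu> (u \<mu> f) (\<lambda>t. \<Delta> \<mu> *s f t)"

abbreviation bc :: "(real \<Rightarrow> complex^'n) \<Rightarrow> complex^'n" where "bc y \<equiv> C *v y 0 + D *v y 1"

lemma S_homogeneous: assumes "x \<in> {0..1}" shows "S \<mu> c (\<lambda>t. 0) x = (\<Sum>j\<in>UNIV. c $ j *s S \<mu> (axis j 1) (\<lambda>t. 0) x)"
proof -
  have s: "sol \<mu> (\<lambda>t. 0) (\<lambda>t. \<Sum>j\<in>J. c $ j *s S \<mu> (axis j 1) (\<lambda>t. 0) t)" if "finite J" for J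
    using that
  proof induction
    case empty then show ?case by (simp add: sol_zero)
  next
    case (insert j J)
    from sol_comb[OF S(1)[OF L2_zero] insert.IH L2_zero L2_zero, of "c $ j" "axis j 1"]
    show ?case using insert.hyps by simp
  qed
  have "(\<Sum>j\<in>UNIV. c $ j *s axis j 1) = c" by (rule basis_expansion)
  then have "(\<Sum>j\<in>UNIV. c $ j *s S \<mu> (axis j 1) (\<lambda>t. 0) 0) = c" by (simp add: S(2))
  with S_unique[OF L2_zero s[OF finite] assms] show ?thesis by simp
qed

lemma sol_endpoint:
  assumes y: "sol \<mu> g y" and g: "g \<in> L2" shows "y 1 = Ym \<mu> *v y 0 + S \<mu> 0 g 1"
proof -
  have "sol \<mu> (\<lambda>t. 1 *s (0::complex^'n) + g t) (\<lambda>t. 1 *s S \<mu> (y 0) (\<lambda>t. 0) t + S \<mu> 0 g t)"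
    by (rule sol_comb[OF S(1)[OF L2_zero] S(1)[OF g] L2_zero g])
  then have "sol \<mu> g (\<lambda>t. S \<mu> (y 0) (\<lambda>t. 0) t + S \<mu> 0 g t)" by simp
  from sol_unique[OF y this _ g, of 1] have "y 1 = S \<mu> (y 0) (\<lambda>t. 0) 1 + S \<mu> 0 g 1"
    by (simp add: S(2) g)
  moreover have "S \<mu> (y 0) (\<lambda>t. 0) 1 = Ym \<mu> *v y 0"
    using S_homogeneous[of 1 \<mu> "y 0"] by (simp add: Ym_def vec_eq_iff matrix_vector_mult_def mult.commute)
  ultimately show ?thesis by simp
qed

lemma bc_sol:
  assumes "sol \<mu> g y" "g \<in> L2" shows "bc y = Mm \<mu> *v y 0 + D *v S \<mu> 0 g 1"
  unfolding sol_endpoint[OF assms]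
  by (simp add: Mm_def matrix_vector_mult_add_rdistrib matrix_vector_right_distrib matrix_vector_mul_assoc add.assoc)

lemma S_rhs_scale: assumes "g \<in> L2" "x \<in> {0..1}" shows "S \<mu> 0 (\<lambda>t. c *s g t) x = c *s S \<mu> 0 g x"
  using S_unique[OF L2_cscale[OF assms(1)] sol_scale[OF S(1)[OF assms(1), of \<mu> 0] assms(1), of c] assms(2)]
  by (simp add: S(2) assms)

lemma U_sol: "f \<in> L2 \<Longrightarrow> sol \<mu> (\<lambda>t. \<Delta> \<mu> *s f t) (U \<mu> f)" "f \<in> L2 \<Longrightarrow> U \<mu> f 0 = u \<mu> f"
  unfolding U_def by (auto intro!: S L2_cscale)

lemma U_bc_nonzero: assumes f: "f \<in> L2" and "\<Delta> \<mu> \<noteq> 0" shows "bc (U \<mu> f) = 0"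
proof -
  have "bc (U \<mu> f) = Mm \<mu> *v U \<mu> f 0 + D *v S \<mu> 0 (\<lambda>t. \<Delta> \<mu> *s f t) 1"
    by (rule bc_sol[OF U_sol(1)[OF f] L2_cscale[OF f]])
  also have "\<dots> = Mm \<mu> *v u \<mu> f + \<Delta> \<mu> *s (D *v S \<mu> 0 f 1)"
    by (simp add: U_sol(2) f S_rhs_scale vec.scale)
  also have "Mm \<mu> *v u \<mu> f = - (\<Delta> \<mu> *s (D *v S \<mu> 0 f 1))"
    using mult_adjm[of "Mm \<mu>" "D *v S \<mu> 0 f 1"] assms(2) by (simp add: u_def \<Delta>_def vec.neg)
  finally show ?thesis by simp
qed

lemma Ym_holomorphic: "(\<lambda>\<mu>. Ym \<mu> $ i $ j) holomorphic_on UNIV"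
  by (simp add: Ym_def S_holomorphic)

lemma Mm_holomorphic: "(\<lambda>\<mu>. Mm \<mu> $ i $ j) holomorphic_on UNIV"
  unfolding Mm_def matrix_matrix_mult_def by (auto intro!: holomorphic_intros Ym_holomorphic)

lemma adjm_holomorphic: "(\<lambda>\<mu>. adjm (Mm \<mu>) $ i $ j) holomorphic_on UNIV"
  unfolding adjm_def by (auto intro!: holomorphic_det holomorphic_if Mm_holomorphic holomorphic_on_const)

lemma \<Delta>_holomorphic: "\<Delta> holomorphic_on UNIV"
  unfolding \<Delta>_def[abs_def] by (intro holomorphic_det Mm_holomorphic)

lemma u_holomorphic: "f \<in> L2 \<Longrightarrow> (\<lambda>\<mu>. u \<mu> f $ i) holomorphic_on UNIV"
  unfolding u_def matrix_vector_mult_def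
  by (auto intro!: holomorphic_intros adjm_holomorphic S_holomorphic)

lemma exptype_Mm: "exptype (\<lambda>\<mu>. Mm \<mu> $ i $ j)"
  unfolding Mm_def matrix_matrix_mult_def Ym_def
  by (auto intro!: exptype_add exptype_const exptype_sum exptype_mult exptype_vec_nth exptype_S)

lemma exptype_\<Delta>: "exptype \<Delta>"
  unfolding \<Delta>_def[abs_def] by (intro exptype_det exptype_Mm)

lemma exptype_adjm: "exptype (\<lambda>\<mu>. adjm (Mm \<mu>) $ i $ j)"
  unfolding adjm_def by (auto intro!: exptype_det exptype_if exptype_Mm exptype_const)

lemma exptype_u: assumes "f \<in> L2" shows "exptype (\<lambda>\<mu>. u \<mu> f)"
proof (rule exptype_vec)
  fix i
  have "exptype (\<lambda>\<mu>. (-1) * (\<Sum>j\<in>UNIV. adjm (Mm \<mu>) $ i $ j * (\<Sum>k\<in>UNIV. D $ j $ k * S \<mu> 0 f 1 $ k)))"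
    by (intro exptype_sum exptype_mult exptype_const exptype_adjm exptype_vec_nth exptype_S assms) auto
  then show "exptype (\<lambda>\<mu>. u \<mu> f $ i)" by (simp add: u_def matrix_vector_mult_def)
qed

lemma exptype_U: assumes f: "f \<in> L2" shows "exptype (\<lambda>\<mu>. L2norm (U \<mu> f))"
proof (rule exptype_mult_norm[OF exptype_growth])
  show "exptype (\<lambda>\<mu>. norm (u \<mu> f) + norm IA * (norm (\<Delta> \<mu>) * L2norm f))"
  proof (intro exptype_add)
    show "exptype (\<lambda>\<mu>. norm (u \<mu> f))" by (rule exptype_bound[OF exptype_u[OF f]]) auto
    show "exptype (\<lambda>\<mu>. norm IA * (norm (\<Delta> \<mu>) * L2norm f))"
      by (rule exptype_mult_norm[OF exptype_\<Delta> exptype_const[of "norm IA * L2norm f"]]) (auto simp: abs_mult)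
  qed
  show "norm (L2norm (U \<mu> f)) \<le> norm (2 * exp (2 * growth * (1 + norm \<mu>))) * norm (norm (u \<mu> f) + norm IA * (norm (\<Delta> \<mu>) * L2norm f))" for \<mu>
  proof -
    have "L2norm (U \<mu> f) \<le> 2 * exp (2 * growth * (1 + norm \<mu>)) * (norm (u \<mu> f) + norm IA * (norm (\<Delta> \<mu>) * L2norm f))"
      using S_bound[OF L2_cscale[OF f], of _ \<mu> "u \<mu> f" "\<Delta> \<mu>"]
      by (intro L2norm_le_const L2D(1) sol_L2[OF U_sol(1)[OF f]]) (auto simp: U_def L2norm_cscale)
    then show ?thesis by (simp add: abs_of_nonneg)
  qed
qed

text \<open>Where \<Delta> does not vanish the homogeneous boundary value problem has only the zero
  solution, applied to the difference \<open>z\<close>.\<close>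

lemma U_unique:
  assumes y: "sol \<mu> f y" "bc y = 0" and f: "f \<in> L2" and nz: "\<Delta> \<mu> \<noteq> 0" and x: "x \<in> {0..1}"
  shows "U \<mu> f x = \<Delta> \<mu> *s y x"
proof -
  define z where "z = (\<lambda>t. (- 1) *s U \<mu> f t + \<Delta> \<mu> *s y t)"
  have "sol \<mu> (\<lambda>t. (- 1) *s (\<Delta> \<mu> *s f t) + \<Delta> \<mu> *s f t) z"
    unfolding z_def by (rule sol_comb[OF U_sol(1)[OF f] sol_scale[OF y(1) f]]) (intro L2_cscale f)+
  then have z: "sol \<mu> (\<lambda>t. 0) z" by (simp add: vec.scale_minus_left)
  have "bc z = (-1) *s bc (U \<mu> f) + \<Delta> \<mu> *s bc y"
    unfolding z_def by (simp add: matrix_vector_right_distrib vec.scale vec.scale_right_distrib vec.neg algebra_simps)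
  then have "bc z = 0" using U_bc_nonzero[OF f nz] y(2) by simp
  then have "Mm \<mu> *v z 0 = 0"
    using bc_sol[OF z L2_zero] S_unique[OF L2_zero sol_zero, of 1 \<mu>] by simp
  then have "z 0 = 0" using nz unfolding \<Delta>_def
    by (metis invertible_det_nz matrix_left_invertible_ker invertible_def)
  then have "z x = 0" using sol_unique[OF z sol_zero _ L2_zero x] by simp
  then show ?thesis by (simp add: z_def vec.scale_minus_left)
qed

lemma eigenfunction_exists:
  assumes "\<Delta> \<mu> = 0"
  obtains y where "sol \<mu> (\<lambda>t. 0) y" "bc y = 0" "y 0 \<noteq> 0"
proof -
  have "\<not> invertible (Mm \<mu>)" using assms invertible_det_nz[of "Mm \<mu>"] by (simp add: \<Delta>_def)
  then obtain c where c: "Mm \<mu> *v c = 0" "c \<noteq> 0"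
    using matrix_left_invertible_ker[of "Mm \<mu>"] invertible_left_inverse[of "Mm \<mu>"] by auto
  show ?thesis
  proof
    show s: "sol \<mu> (\<lambda>t. 0) (S \<mu> c (\<lambda>t. 0))" "S \<mu> c (\<lambda>t. 0) 0 \<noteq> 0" using c by (auto simp: S)
    show "bc (S \<mu> c (\<lambda>t. 0)) = 0"
      using bc_sol[OF s(1) L2_zero] c S_unique[OF L2_zero sol_zero, of 1 \<mu>] by (simp add: S(2))
  qed
qed

text \<open>The zeros of \<Delta> are reached by analytic continuation from the open set where it
  does not vanish; one point of that set is enough.\<close>

lemma U_bc:
  assumes f: "f \<in> L2" and nz: "\<Delta> \<nu> \<noteq> 0" shows "bc (U \<mu> f) = 0"
proof -
  have h: "(\<lambda>\<mu>. U \<mu> f x $ i) holomorphic_on UNIV" if "x \<in> {0..1}" for x i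
    by (rule sol_functional_analytic(1)[OF f u_holomorphic[OF f] \<Delta>_holomorphic U_sol(1)[OF f] U_sol(2)[OF f] that])
  have "bc (U \<mu> f) $ i = 0" for i
  proof (rule analytic_continuation_open[where s = "{\<mu>. \<Delta> \<mu> \<noteq> 0}" and s' = UNIV and f = "\<lambda>\<mu>. bc (U \<mu> f) $ i" and g = "\<lambda>_. 0"])
    show "open {\<mu>. \<Delta> \<mu> \<noteq> 0}"
      by (intro open_Collect_neq holomorphic_on_imp_continuous_on \<Delta>_holomorphic continuous_on_const)
    show "(\<lambda>\<mu>. bc (U \<mu> f) $ i) holomorphic_on UNIV"
      unfolding matrix_vector_mult_def by (auto intro!: holomorphic_intros h)
  qed (use nz U_bc_nonzero[OF f] in auto)
  then show ?thesis by (simp add: vec_eq_iff)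
qed

end

subsection \<open>Density of the domain and separation in $L^2$\<close>

lemma L2norm_tendsto_zero:
  fixes s :: "nat \<Rightarrow> real \<Rightarrow> 'a::euclidean_space" and g :: "real \<Rightarrow> 'b::euclidean_space"
  assumes s: "\<And>n. s n \<in> borel_measurable leb" and g: "g \<in> L2"
    and le: "\<And>n x. x \<in> {0..1} \<Longrightarrow> norm (s n x) \<le> norm (g x)"
    and lim: "AE x in leb. (\<lambda>n. s n x) \<longlonglongrightarrow> 0"
  shows "(\<lambda>n. L2norm (s n)) \<longlonglongrightarrow> 0"
proof -
  have "(\<lambda>n. integral\<^sup>L leb (\<lambda>x. (norm (s n x))\<^sup>2)) \<longlonglongrightarrow> integral\<^sup>L leb (\<lambda>x. 0::real)"
  proof (rule integral_dominated_convergence)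
    show "integrable leb (\<lambda>x. (norm (g x))\<^sup>2)" by (rule L2D(2)[OF g])
    show "(\<lambda>x. (norm (s n x))\<^sup>2) \<in> borel_measurable leb" for n using s[of n] by measurable
    show "AE x in leb. (\<lambda>n. (norm (s n x))\<^sup>2) \<longlonglongrightarrow> 0"
      using lim
    proof eventually_elim
      case (elim x)
      from tendsto_power[OF tendsto_norm[OF elim], of 2] show ?case by simp
    qed
    show "AE x in leb. norm ((norm (s n x))\<^sup>2) \<le> (norm (g x))\<^sup>2" for n
      by (rule AE_I2) (use le[of _ n] in \<open>auto intro!: power_mono\<close>)
  qed simp
  then have "(\<lambda>n. sqrt (integral\<^sup>L leb (\<lambda>x. (norm (s n x))\<^sup>2))) \<longlonglongrightarrow> sqrt 0"
    by (intro tendsto_real_sqrt) simp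
  then show ?thesis by (simp add: L2norm_def)
qed

text \<open>Truncation by projection onto large balls; the error is dominated by \<open>f\<close>
  and is eventually 0 at every point.\<close>

lemma L2_approx_bounded:
  fixes f :: "real \<Rightarrow> 'a::euclidean_space"
  assumes f: "f \<in> L2" and e: "e > 0"
  obtains K where "K > 0" "L2norm (\<lambda>x. f x - closest_point (cball 0 K) (f x)) < e"
proof -
  let ?c = "\<lambda>n. closest_point (cball (0::'a) (real (Suc n)))"
  have m: "?c n \<in> borel_measurable borel" for n
    by (intro borel_measurable_continuous_onI continuous_on_closest_point) auto
  have "(\<lambda>n. L2norm (\<lambda>x. f x - ?c n (f x))) \<longlonglongrightarrow> 0"
  proof (rule L2norm_tendsto_zero[OF _ f])
    show "(\<lambda>x. f x - ?c n (f x)) \<in> borel_measurable leb" for n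
      by (intro borel_measurable_diff L2D(1)[OF f] measurable_compose[OF L2D(1)[OF f] m])
    show "norm (f x - ?c n (f x)) \<le> norm (f x)" for n x
      using closest_point_le[of "cball (0::'a) (real (Suc n))" 0 "f x"] by (simp add: dist_norm)
    show "AE x in leb. (\<lambda>n. f x - ?c n (f x)) \<longlonglongrightarrow> 0"
    proof (rule AE_I2)
      fix x
      obtain N where N: "norm (f x) < real N" using reals_Archimedean2 by blast
      show "(\<lambda>n. f x - ?c n (f x)) \<longlonglongrightarrow> 0"
      proof (rule tendsto_eventually, rule eventually_sequentiallyI[of N])
        fix n assume "N \<le> n"
        then have "f x \<in> cball 0 (real (Suc n))" using N by simp
        then show "f x - ?c n (f x) = 0" by (simp add: closest_point_self)
      qed
    qed
  qed
  from order_tendstoD(2)[OF this e] obtain n where "L2norm (\<lambda>x. f x - ?c n (f x)) < e"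
    by (auto simp: eventually_sequentially)
  then show ?thesis by (intro that[of "real (Suc n)"]) auto
qed

text \<open>\<open>measurable_on\<close> provides an almost everywhere limit of continuous
  functions. Projecting them onto a ball makes the convergence dominated, and a cut-off makes them
  vanish at the endpoints.\<close>

lemma L2_approx_continuous:
  fixes f :: "real \<Rightarrow> 'a::euclidean_space"
  assumes f: "f \<in> L2" and e: "e > 0"
  obtains h where "continuous_on {0..1} h" "h 0 = 0" "h 1 = 0" "L2norm (\<lambda>x. f x - h x) < e"
proof -
  obtain K where K: "K > 0" "L2norm (\<lambda>x. f x - closest_point (cball 0 K) (f x)) < e / 2"
    using L2_approx_bounded[OF f, of "e / 2"] e by auto
  let ?c = "closest_point (cball (0::'a) K)"
  have cc: "continuous_on UNIV ?c" by (rule continuous_on_closest_point) (use K in auto)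
  have cK: "norm (?c v) \<le> K" for v
    using closest_point_in_set[of "cball (0::'a) K" v] K by auto
  have fm: "f measurable_on {0..1}" using L2D(1)[OF f] by (simp add: measurable_on_iff_borel_measurable)
  then obtain N g where N: "negligible N" and g: "\<And>n. continuous_on UNIV (g n)"
    and lim: "\<And>x. x \<notin> N \<Longrightarrow> (\<lambda>n. g n x) \<longlonglongrightarrow> (if x \<in> {0..1} then f x else 0)"
    unfolding measurable_on_def by blast
  \<comment> \<open>Trapezoidal cut-offs: 0 at both ends of the interval, converging to 1
    inside.\<close>
  define \<theta> :: "nat \<Rightarrow> real \<Rightarrow> real" where "\<theta> n x = min 1 (real n * x) * min 1 (real n * (1 - x))" for n x
  have \<theta>1: "0 \<le> \<theta> n x" "\<theta> n x \<le> 1" if "x \<in> {0..1}" for n x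
    using that by (auto simp: \<theta>_def intro!: mult_nonneg_nonneg mult_le_one)
  have \<theta>lim: "(\<lambda>n. \<theta> n x) \<longlonglongrightarrow> 1" if "x \<in> {0<..<1}" for x
  proof -
    have l: "(\<lambda>n. min 1 (real n * z)) \<longlonglongrightarrow> 1" if z: "z > 0" for z
    proof -
      obtain m where m: "1 / z < real m" using reals_Archimedean2 by blast
      show ?thesis
      proof (rule tendsto_eventually, rule eventually_sequentiallyI[of m])
        fix n assume "m \<le> n"
        then have "1 / z < real n" using m by linarith
        then have "1 < real n * z" using z by (simp add: pos_divide_less_eq)
        then show "min 1 (real n * z) = 1" by simp
      qed
    qed
    have "(\<lambda>n. \<theta> n x) \<longlonglongrightarrow> 1 * 1" unfolding \<theta>_def by (intro tendsto_mult l) (use that in auto)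
    then show ?thesis by simp
  qed
  define h where "h n x = \<theta> n x *\<^sub>R ?c (g n x)" for n x
  have hc: "continuous_on UNIV (h n)" for n
    unfolding h_def \<theta>_def
    by (intro continuous_intros continuous_on_compose2[OF cc g]) auto
  have hm: "h n \<in> borel_measurable leb" for n
    by (intro measurable_leb_continuous continuous_on_subset[OF hc]) auto
  have cfm: "(\<lambda>x. ?c (f x)) \<in> borel_measurable leb"
    by (rule measurable_compose[OF L2D(1)[OF f] borel_measurable_continuous_onI[OF cc]])
  have hK: "norm (h n x) \<le> K" if "x \<in> {0..1}" for n x
    using mult_mono[OF \<theta>1(2)[OF that] cK[of "g n x"]] \<theta>1[OF that] by (simp add: h_def)
  have "(\<lambda>n. L2norm (\<lambda>x. ?c (f x) - h n x)) \<longlonglongrightarrow> 0"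
  proof (rule L2norm_tendsto_zero[where g = "\<lambda>x. 2 * K"])
    show "(\<lambda>x. ?c (f x) - h n x) \<in> borel_measurable leb" for n by (intro borel_measurable_diff cfm hm)
    show "(\<lambda>x. 2 * K) \<in> L2" by (rule L2_const)
    show "norm (?c (f x) - h n x) \<le> norm (2 * K)" if "x \<in> {0..1}" for n x
      using norm_triangle_ineq4[of "?c (f x)" "h n x"] cK[of "f x"] hK[OF that, of n] K by simp
    have "AE x in lebesgue. x \<notin> N \<and> x \<noteq> 0 \<and> x \<noteq> 1"
    proof (intro AE_conjI)
      show "AE x in lebesgue. x \<notin> N" using N by (simp add: negligible_iff_null_sets AE_not_in)
      show "AE x in lebesgue. x \<noteq> (0::real)" "AE x in lebesgue. x \<noteq> (1::real)"
        by (rule AE_completion[OF AE_lborel_singleton])+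
    qed
    then have "AE x in lebesgue. x \<in> {0..1} \<longrightarrow> (x \<notin> N \<and> x \<noteq> 0 \<and> x \<noteq> 1)"
      by (rule eventually_mono) blast
    then have "AE x in leb. x \<notin> N \<and> x \<noteq> 0 \<and> x \<noteq> 1"
      by (subst AE_restrict_space_iff) simp_all
    then show "AE x in leb. (\<lambda>n. ?c (f x) - h n x) \<longlonglongrightarrow> 0"
    proof (rule AE_mp, intro AE_I2 impI)
      fix x assume "x \<in> space leb" and x: "x \<notin> N \<and> x \<noteq> 0 \<and> x \<noteq> 1"
      then have x01: "x \<in> {0..1}" "x \<in> {0<..<1}" by auto
      have "(\<lambda>n. g n x) \<longlonglongrightarrow> f x" using lim[of x] x x01(1) by simp
      then have "(\<lambda>n. ?c (g n x)) \<longlonglongrightarrow> ?c (f x)"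
        by (rule continuous_on_tendsto_compose[OF cc]) auto
      from tendsto_scaleR[OF \<theta>lim[OF x01(2)] this] have "(\<lambda>n. h n x) \<longlonglongrightarrow> ?c (f x)" by (simp add: h_def)
      from tendsto_diff[OF tendsto_const this, of "?c (f x)"] show "(\<lambda>n. ?c (f x) - h n x) \<longlonglongrightarrow> 0" by simp
    qed
  qed
  from order_tendstoD(2)[OF this, of "e / 2"] e obtain n where n: "L2norm (\<lambda>x. ?c (f x) - h n x) < e / 2"
    by (auto simp: eventually_sequentially)
  show ?thesis
  proof
    show "continuous_on {0..1} (h n)" by (rule continuous_on_subset[OF hc]) auto
    show "h n 0 = 0" "h n 1 = 0" by (auto simp: h_def \<theta>_def)
    have cfL: "(\<lambda>x. ?c (f x)) \<in> L2" by (rule L2_bounded[OF cfm cK])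
    have hL: "h n \<in> L2" by (rule L2_bounded[OF hm hK])
    have "L2norm (\<lambda>x. (f x - ?c (f x)) + (?c (f x) - h n x)) \<le> L2norm (\<lambda>x. f x - ?c (f x)) + L2norm (\<lambda>x. ?c (f x) - h n x)"
      by (intro L2norm_triangle L2_diff f cfL hL)
    then show "L2norm (\<lambda>x. f x - h n x) < e" using K(2) n by simp
  qed
qed

text \<open>Subtracting the linear interpolant makes a polynomial vanish at the endpoints. This
  costs little since \<open>p 0\<close> and \<open>p 1\<close> are close to the zero boundary values
  of \<open>h\<close>: three errors of e/8 stay below e/2.\<close>

lemma L2_approx_polynomial:
  fixes f :: "real \<Rightarrow> 'a::euclidean_space"
  assumes f: "f \<in> L2" and e: "e > 0"
  obtains y y' where "continuous_on {0..1} y" "continuous_on {0..1} y'" "y 0 = 0" "y 1 = 0"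
    "\<And>x. (y has_vector_derivative y' x) (at x)" "L2norm (\<lambda>x. f x - y x) < e"
proof -
  obtain h where h: "continuous_on {0..1} h" "h 0 = 0" "h 1 = 0" "L2norm (\<lambda>x. f x - h x) < e / 2"
    using L2_approx_continuous[OF f, of "e / 2"] e by auto
  obtain p where p: "polynomial_function p" "\<And>x. x \<in> {0..1} \<Longrightarrow> norm (h x - p x) < e / 8"
    using Stone_Weierstrass_polynomial_function[OF _ h(1), of "e / 8"] e by auto
  obtain p' where p': "polynomial_function p'" "\<And>x. (p has_vector_derivative (p' x)) (at x)"
    by (rule has_vector_derivative_polynomial_function[OF p(1)]) blast
  define y where "y x = p x - ((1 - x) *\<^sub>R p 0 + x *\<^sub>R p 1)" for x
  define y' where "y' x = p' x - (p 1 - p 0)" for x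
  show ?thesis
  proof
    have yc: "continuous_on {0..1} y" unfolding y_def by (intro continuous_intros continuous_on_polymonial_function p)
    then show "continuous_on {0..1} y" .
    show "continuous_on {0..1} y'" unfolding y'_def by (intro continuous_intros continuous_on_polymonial_function p')
    show "y 0 = 0" "y 1 = 0" by (auto simp: y_def)
    show "(y has_vector_derivative y' x) (at x)" for x
      unfolding y_def y'_def
      by (rule derivative_eq_intros p'(2) refl | simp add: algebra_simps)+
    have "norm (h x - y x) \<le> 3 * (e / 8)" if x: "x \<in> {0..1}" for x
    proof -
      have "norm (h x - y x) = norm ((h x - p x) + ((1 - x) *\<^sub>R p 0 + x *\<^sub>R p 1))" by (simp add: y_def algebra_simps)
      also have "\<dots> \<le> norm (h x - p x) + (norm ((1 - x) *\<^sub>R p 0) + norm (x *\<^sub>R p 1))"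
        by (meson add_left_mono norm_triangle_ineq order_trans)
      also have "norm ((1 - x) *\<^sub>R p 0) \<le> 1 * norm (p 0)"
        unfolding norm_scaleR using x by (intro mult_right_mono) auto
      also have "norm (x *\<^sub>R p 1) \<le> 1 * norm (p 1)"
        unfolding norm_scaleR using x by (intro mult_right_mono) auto
      finally show ?thesis using p(2)[OF x] p(2)[of 0] p(2)[of 1] h(2,3) by simp
    qed
    then have "L2norm (\<lambda>x. h x - y x) \<le> 3 * (e / 8)"
      using e by (intro L2norm_le_const L2D(1) L2_diff L2_continuous h(1) yc) auto
    moreover have "L2norm (\<lambda>x. (f x - h x) + (h x - y x)) \<le> L2norm (\<lambda>x. f x - h x) + L2norm (\<lambda>x. h x - y x)"
      by (intro L2norm_triangle L2_diff f L2_continuous h(1) yc)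
    ultimately show "L2norm (\<lambda>x. f x - y x) < e" using h(4) e by simp
  qed
qed

text \<open>Functions vanishing at both ends satisfy every boundary condition, and those
  approximated by polynomials are smooth enough to apply the operator.\<close>

lemma (in bvp) domain_dense:
  assumes f: "f \<in> L2" and e: "e > 0"
  obtains y g where "g \<in> L2" "sol \<mu> g y" "y 0 = 0" "y 1 = 0" "L2norm (\<lambda>x. f x - y x) < e"
proof -
  obtain y y' where y: "continuous_on {0..1} y" "continuous_on {0..1} y'" "y 0 = 0" "y 1 = 0"
    "\<And>x. (y has_vector_derivative y' x) (at x)" "L2norm (\<lambda>x. f x - y x) < e"
    by (rule L2_approx_polynomial[OF f e]) blast
  \<comment> \<open>The image of \<open>y\<close> under L - \<mu>, as 1 / (i a) = -i / a.\<close>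
  define g where "g t = diag_mat (\<lambda>k. 1 / (\<i> * a k)) *v y' t + (Q t *v y t - \<mu> *s y t)" for t
  have "IA *v g t = y' t + (IA ** Q t) *v y t - diag_mat (\<lambda>k. \<mu> * (\<i> * a k)) *v y t" for t
    unfolding vec_eq_iff
  proof
    fix k
    have "((IA ** Q t) *v y t) $ k = \<i> * a k * (Q t *v y t) $ k"
      by (metis diag_mat_vec matrix_vector_mul_assoc)
    then show "(IA *v g t) $ k = (y' t + (IA ** Q t) *v y t - diag_mat (\<lambda>k. \<mu> * (\<i> * a k)) *v y t) $ k"
      using a_nz[of k] by (simp add: g_def algebra_simps)
  qed
  then have rhs: "(diag_mat (\<lambda>k. \<mu> * (\<i> * a k)) + - (IA ** Q t)) *v y t + IA *v g t = y' t" for t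
    by (simp add: matrix_vector_mult_add_rdistrib matrix_vector_mult_diff_rdistrib)
  have gL: "g \<in> L2"
    unfolding g_def
    by (intro L2_add L2_diff L2_mat_vec_continuous[OF Q y(1)] L2_cscale L2_continuous[OF y(1)]
        L2_linear[OF L2_continuous[OF y(2)] bounded_linear_mat_vec])
  have "sol \<mu> g y"
    unfolding sol_def lin_sol_def rhs
  proof (intro conjI ballI y(1))
    fix x :: real assume x: "x \<in> {0..1}"
    have "(y' has_integral (y x - y 0)) {0..x}"
      by (rule fundamental_theorem_of_calculus) (use x y(5) in \<open>auto intro: has_vector_derivative_at_within\<close>)
    then have "integral {0..x} y' = y x - y 0" by (rule integral_unique)
    moreover have "integral\<^sup>L (lebesgue_on {0..x}) y' = integral {0..x} y'"
      by (rule lebesgue_integral_eq_integral[OF integrable_leb_sub[OF L2_integrable[OF L2_continuous[OF y(2)]] x]]) simp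
    ultimately show "y x = y 0 + integral\<^sup>L (lebesgue_on {0..x}) y'" by simp
  qed
  with gL y show ?thesis by (intro that[of g y])
qed

section \<open>Separating a function from a subspace by minimizing the distance\<close>

text \<open>On complex vectors this is the real part of the Hermitian product; a real form suits the
  variational argument, and complex linearity is restored at its end.\<close>

definition rip :: "(real \<Rightarrow> 'a::euclidean_space) \<Rightarrow> (real \<Rightarrow> 'a) \<Rightarrow> real"
  where "rip f g = integral\<^sup>L leb (\<lambda>x. f x \<bullet> g x)"

lemma rip_integrable:
  fixes f g :: "real \<Rightarrow> 'a::euclidean_space"
  assumes "f \<in> L2" "g \<in> L2" shows "integrable leb (\<lambda>x. f x \<bullet> g x)"
  using L2_mult_integrable[OF assms]
  by (rule Bochner_Integration.integrable_bound)
     (auto intro!: AE_I2 borel_measurable_inner[OF L2D(1)[OF assms(1)] L2D(1)[OF assms(2)]] simp: Cauchy_Schwarz_ineq2)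

lemma rip_add: "f \<in> L2 \<Longrightarrow> g \<in> L2 \<Longrightarrow> h \<in> L2 \<Longrightarrow> rip (\<lambda>x. f x + g x) h = rip f h + rip g h"
  unfolding rip_def inner_add_left by (intro Bochner_Integration.integral_add rip_integrable)

lemma rip_scale: "rip (\<lambda>x. c *\<^sub>R f x) h = c * rip f h"
  unfolding rip_def inner_scaleR_left by simp

lemma rip_commute: "rip f g = rip g f"
  unfolding rip_def by (simp add: inner_commute)

lemma rip_self: "rip f f = (L2norm f)\<^sup>2"
  unfolding rip_def L2norm_power2 by (simp add: power2_norm_eq_inner)

lemma rip_diff:
  assumes "f \<in> L2" "g \<in> L2" "h \<in> L2" shows "rip (\<lambda>x. f x - g x) h = rip f h - rip g h"
  unfolding rip_def inner_diff_left using assms by (intro Bochner_Integration.integral_diff rip_integrable)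

lemma rip_bound: assumes "f \<in> L2" "g \<in> L2" shows "\<bar>rip f g\<bar> \<le> L2norm f * L2norm g"
proof -
  have "\<bar>rip f g\<bar> \<le> integral\<^sup>L leb (\<lambda>x. \<bar>f x \<bullet> g x\<bar>)"
    unfolding rip_def by (rule integral_abs_bound)
  also have "\<dots> \<le> integral\<^sup>L leb (\<lambda>x. norm (f x) * norm (g x))"
    by (intro integral_mono integrable_abs rip_integrable L2_mult_integrable assms Cauchy_Schwarz_ineq2)
  also have "\<dots> \<le> L2norm f * L2norm g" by (rule L2_cauchy_schwarz[OF assms])
  finally show ?thesis .
qed

text \<open>The functional is the limit of the inner products with
  \<open>f0 - g\<^sub>n\<close> along a minimizing sequence \<open>g\<^sub>n\<close>. These converge although the sequence need not,
  so completeness of \<open>L2\<close> is not used.\<close>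

lemma separating_functional:
  fixes V :: "(real \<Rightarrow> complex^'n) set"
  assumes V: "V \<subseteq> L2" "(\<lambda>t. 0) \<in> V" "\<And>c f g. f \<in> V \<Longrightarrow> g \<in> V \<Longrightarrow> (\<lambda>t. c *s f t + g t) \<in> V"
    and f0: "f0 \<in> L2" and e: "e > 0" and far: "\<And>g. g \<in> V \<Longrightarrow> L2norm (\<lambda>t. f0 t - g t) \<ge> e"
  obtains l where "bounded_functional l" "\<And>g. g \<in> V \<Longrightarrow> l g = 0" "l f0 \<noteq> 0"
proof -
  define d where "d = Inf ((\<lambda>g. (L2norm (\<lambda>t. f0 t - g t))\<^sup>2) ` V)"
  have bdd: "bdd_below ((\<lambda>g. (L2norm (\<lambda>t. f0 t - g t))\<^sup>2) ` V)" by (rule bdd_belowI[of _ 0]) auto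
  have dle: "d \<le> (L2norm (\<lambda>t. f0 t - g t))\<^sup>2" if "g \<in> V" for g
    unfolding d_def by (rule cInf_lower[OF _ bdd]) (use that in auto)
  have de: "e\<^sup>2 \<le> d"
    unfolding d_def by (rule cInf_greatest) (use V far e in \<open>auto intro!: power_mono\<close>)
  have "\<exists>g\<in>V. (L2norm (\<lambda>t. f0 t - g t))\<^sup>2 < d + 1 / real (Suc n)" for n
    using cInf_lessD[of "(\<lambda>g. (L2norm (\<lambda>t. f0 t - g t))\<^sup>2) ` V" "d + 1 / real (Suc n)"] V(2) by (auto simp: d_def)
  then obtain g where g: "\<And>n. g n \<in> V" "\<And>n. (L2norm (\<lambda>t. f0 t - g n t))\<^sup>2 < d + 1 / real (Suc n)" by metis
  define p where "p n = (\<lambda>t. f0 t - g n t)" for n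
  have gL: "g n \<in> L2" for n using g V by auto
  have pL: "p n \<in> L2" for n unfolding p_def by (intro L2_diff f0 gL)
  define \<epsilon> where "\<epsilon> n = 1 / sqrt (real (Suc n))" for n
  have \<epsilon>0: "\<epsilon> n > 0" for n by (simp add: \<epsilon>_def)
  have \<epsilon>2: "(\<epsilon> n)\<^sup>2 = 1 / real (Suc n)" for n by (simp add: \<epsilon>_def power_divide)
  have \<epsilon>lim: "\<epsilon> \<longlonglongrightarrow> 0"
  proof -
    have "(\<lambda>n. sqrt (1 / real (Suc n))) \<longlonglongrightarrow> sqrt 0"
      by (intro tendsto_real_sqrt lim_1_over_n[THEN LIMSEQ_Suc])
    then show ?thesis by (simp add: \<epsilon>_def[abs_def] real_sqrt_divide)
  qed
  have orth: "\<bar>rip (p n) h\<bar> \<le> \<epsilon> n * L2norm h" if h: "h \<in> V" for n h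
  proof -
    have hL: "h \<in> L2" using h V by auto
    \<comment> \<open>Moving \<open>g n\<close> by \<open>s\<close> times \<open>h\<close> cannot
      bring the squared distance below \<open>d\<close>, while \<open>g n\<close> exceeds it by less
      than \<open>(\<epsilon> n)\<^sup>2\<close>.\<close>
    have quad: "2 * s * rip (p n) h \<le> (\<epsilon> n)\<^sup>2 + s\<^sup>2 * (L2norm h)\<^sup>2" for s
    proof -
      have "(\<lambda>t. of_real s *s h t + g n t) \<in> V" by (rule V(3)[OF h g(1)])
      then have "d \<le> (L2norm (\<lambda>t. f0 t - (of_real s *s h t + g n t)))\<^sup>2" by (rule dle)
      also have "(\<lambda>t. f0 t - (of_real s *s h t + g n t)) = (\<lambda>t. p n t - s *\<^sub>R h t)"
        by (simp add: p_def fun_eq_iff vec_eq_iff scaleR_conv_of_real[where 'a=complex])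
      also have "(L2norm (\<lambda>t. p n t - s *\<^sub>R h t))\<^sup>2 = (L2norm (p n))\<^sup>2 - 2 * s * rip (p n) h + s\<^sup>2 * (L2norm h)\<^sup>2"
      proof -
        have sL: "(\<lambda>t. s *\<^sub>R h t) \<in> L2" by (rule L2_linear[OF hL bounded_linear_scaleR_right])
        have dL: "(\<lambda>t. p n t - s *\<^sub>R h t) \<in> L2" by (rule L2_diff[OF pL sL])
        have "rip (\<lambda>t. p n t - s *\<^sub>R h t) (\<lambda>t. p n t - s *\<^sub>R h t)
          = rip (p n) (\<lambda>t. p n t - s *\<^sub>R h t) - s * rip h (\<lambda>t. p n t - s *\<^sub>R h t)"
          unfolding rip_diff[OF pL sL dL] rip_scale ..
        also have "rip (p n) (\<lambda>t. p n t - s *\<^sub>R h t) = rip (p n) (p n) - s * rip h (p n)"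
          by (subst rip_commute) (simp only: rip_diff[OF pL sL pL] rip_scale)
        also have "rip h (\<lambda>t. p n t - s *\<^sub>R h t) = rip (p n) h - s * rip h h"
          by (subst rip_commute) (simp only: rip_diff[OF pL sL hL] rip_scale)
        also have "rip h (p n) = rip (p n) h" by (rule rip_commute)
        finally show ?thesis by (simp add: rip_self power2_eq_square algebra_simps)
      qed
      also have "(L2norm (p n))\<^sup>2 \<le> d + (\<epsilon> n)\<^sup>2" using g(2)[of n] by (simp add: p_def \<epsilon>2)
      finally show ?thesis by simp
    qed
    show ?thesis
    proof (cases "L2norm h = 0")
      case True
      then show ?thesis using rip_bound[OF pL hL, of n] by simp
    next
      case False
      define H where "H = L2norm h"
      have H: "H > 0" using False L2norm_nonneg[of h] unfolding H_def by linarith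
      define r where "r = rip (p n) h"
      \<comment> \<open>The value of \<open>s\<close> for which the quadratic inequality is
        sharpest.\<close>
      have "2 * (r / H\<^sup>2) * r \<le> (\<epsilon> n)\<^sup>2 + (r / H\<^sup>2)\<^sup>2 * H\<^sup>2" using quad[of "r / H\<^sup>2"] by (simp add: r_def H_def)
      moreover have "(r / H\<^sup>2)\<^sup>2 * H\<^sup>2 = r\<^sup>2 / H\<^sup>2" using H by (simp add: power2_eq_square field_simps)
      moreover have "2 * (r / H\<^sup>2) * r = 2 * (r\<^sup>2 / H\<^sup>2)" by (simp add: power2_eq_square)
      ultimately have "r\<^sup>2 / H\<^sup>2 \<le> (\<epsilon> n)\<^sup>2" by linarith
      then have "r\<^sup>2 \<le> (\<epsilon> n * H)\<^sup>2" using H by (simp add: pos_divide_le_eq power_mult_distrib)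
      then have "\<bar>r\<bar> \<le> \<epsilon> n * H" using H \<epsilon>0[of n] by (simp add: abs_le_square_iff[symmetric] abs_of_nonneg)
      then show ?thesis by (simp add: r_def H_def)
    qed
  qed
  have VL: "(\<lambda>t. g m t - g n t) \<in> V" for m n
  proof -
    have "(\<lambda>t. (-1) *s g n t + g m t) \<in> V" by (rule V(3)[OF g(1) g(1)])
    moreover have "(\<lambda>t. (-1) *s g n t + g m t) = (\<lambda>t. g m t - g n t)" by (simp add: fun_eq_iff vec_eq_iff)
    ultimately show ?thesis by simp
  qed
  \<comment> \<open>Differences of the \<open>p n\<close> lie in \<open>V\<close>, so
    near-orthogonality tested on the difference itself bounds its norm.\<close>
  have close: "L2norm (\<lambda>t. p n t - p m t) \<le> \<epsilon> n + \<epsilon> m" for m n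
  proof -
    define h where "h = (\<lambda>t. p n t - p m t)"
    have "h = (\<lambda>t. g m t - g n t)" by (simp add: h_def p_def)
    then have h: "h \<in> V" using VL by simp
    have hL: "h \<in> L2" using h V by auto
    have "(L2norm h)\<^sup>2 = rip (p n) h - rip (p m) h"
      unfolding rip_self[symmetric] using rip_diff[OF pL pL hL, of n m] by (simp add: h_def)
    also have "\<dots> \<le> (\<epsilon> n + \<epsilon> m) * L2norm h"
      using orth[OF h, of n] orth[OF h, of m] by (simp add: distrib_right abs_le_iff)
    finally have "L2norm h * L2norm h \<le> (\<epsilon> n + \<epsilon> m) * L2norm h" by (simp add: power2_eq_square)
    then have "L2norm h \<le> \<epsilon> n + \<epsilon> m"
      using \<epsilon>0[of n] \<epsilon>0[of m] L2norm_nonneg[of h]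
      by (cases "L2norm h = 0") (auto simp: mult_le_cancel_right)
    then show ?thesis by (simp add: h_def)
  qed
  define lr where "lr f = lim (\<lambda>n. rip f (p n))" for f
  have conv: "(\<lambda>n. rip f (p n)) \<longlonglongrightarrow> lr f" if f: "f \<in> L2" for f
  proof -
    have "Cauchy (\<lambda>n. rip f (p n))"
    proof (rule metric_CauchyI)
      fix r :: real assume r: "r > 0"
      define F where "F = L2norm f + 1"
      have F: "F > 0" "L2norm f \<le> F" by (auto simp: F_def intro: add_nonneg_pos)
      from order_tendstoD(2)[OF \<epsilon>lim, of "r / (2 * F)"] r F obtain N where N: "\<And>n. n \<ge> N \<Longrightarrow> \<epsilon> n < r / (2 * F)"
        by (auto simp: eventually_sequentially)
      have "dist (rip f (p n)) (rip f (p m)) < r" if "n \<ge> N" "m \<ge> N" for n m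
      proof -
        have "rip f (p n) - rip f (p m) = rip (\<lambda>t. p n t - p m t) f"
          unfolding rip_diff[OF pL pL f] by (simp add: rip_commute)
        also have "\<bar>\<dots>\<bar> \<le> L2norm (\<lambda>t. p n t - p m t) * L2norm f" by (rule rip_bound[OF L2_diff[OF pL pL] f])
        also have "\<dots> \<le> (\<epsilon> n + \<epsilon> m) * F" by (intro mult_mono close F) (use \<epsilon>0 in \<open>auto intro: add_nonneg_nonneg less_imp_le\<close>)
        also have "\<dots> < (r / (2 * F) + r / (2 * F)) * F" using N[OF that(1)] N[OF that(2)] F by (intro mult_strict_right_mono) auto
        also have "\<dots> = r" using F by (simp add: field_simps)
        finally show ?thesis by (simp add: dist_real_def)
      qed
      then show "\<exists>M. \<forall>m\<ge>M. \<forall>n\<ge>M. dist (rip f (p m)) (rip f (p n)) < r" by blast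
    qed
    then show ?thesis unfolding lr_def by (simp add: Cauchy_convergent_iff convergent_LIMSEQ_iff)
  qed
  define B where "B = sqrt (d + 1)"
  have pB: "L2norm (p n) \<le> B" for n
  proof -
    have "(L2norm (p n))\<^sup>2 \<le> d + 1" using g(2)[of n]
    proof -
      have "1 / real (Suc n) \<le> 1" by simp
      then show ?thesis using g(2)[of n] unfolding p_def by linarith
    qed
    then show ?thesis unfolding B_def by (rule real_le_rsqrt)
  qed
  have B0: "B \<ge> 0" using pB[of 0] order_trans[OF L2norm_nonneg] by blast
  have lr_bound: "\<bar>lr f\<bar> \<le> B * L2norm f" if f: "f \<in> L2" for f
  proof (rule LIMSEQ_le_const2[OF tendsto_rabs[OF conv[OF f]]])
    have "\<bar>rip f (p n)\<bar> \<le> B * L2norm f" for n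
      using rip_bound[OF f pL, of n] mult_right_mono[OF pB[of n] L2norm_nonneg[of f]] by (simp add: mult.commute)
    then show "\<exists>N. \<forall>n\<ge>N. \<bar>rip f (p n)\<bar> \<le> B * L2norm f" by blast
  qed
  have lr_add: "lr (\<lambda>t. f t + h t) = lr f + lr h" if "f \<in> L2" "h \<in> L2" for f h
  proof (rule LIMSEQ_unique[OF conv[OF L2_add[OF that]]])
    show "(\<lambda>n. rip (\<lambda>t. f t + h t) (p n)) \<longlonglongrightarrow> lr f + lr h"
      unfolding rip_add[OF that pL] by (intro tendsto_add conv that)
  qed
  have lr_scale: "lr (\<lambda>t. c *\<^sub>R f t) = c * lr f" if "f \<in> L2" for f c
  proof (rule LIMSEQ_unique[OF conv[OF L2_linear[OF that bounded_linear_scaleR_right]]])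
    show "(\<lambda>n. rip (\<lambda>t. c *\<^sub>R f t) (p n)) \<longlonglongrightarrow> c * lr f"
      unfolding rip_scale by (intro tendsto_mult tendsto_const conv that)
  qed
  have lrV: "lr h = 0" if h: "h \<in> V" for h
  proof (rule LIMSEQ_unique[OF conv])
    show "h \<in> L2" using h V by auto
    show "(\<lambda>n. rip h (p n)) \<longlonglongrightarrow> 0"
    proof (rule Lim_null_comparison)
      show "eventually (\<lambda>n. norm (rip h (p n)) \<le> \<epsilon> n * L2norm h) sequentially"
        using orth[OF h] by (simp add: rip_commute)
      show "(\<lambda>n. \<epsilon> n * L2norm h) \<longlonglongrightarrow> 0" using tendsto_mult_left_zero[OF \<epsilon>lim] .
    qed
  qed
  \<comment> \<open>Split \<open>f0\<close> as \<open>g n\<close> plus \<open>p n\<close>: the first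
    part is nearly orthogonal to \<open>p n\<close>, the second contributes at least
    \<open>d\<close>.\<close>
  have lrf0: "lr f0 \<ge> d"
  proof -
    have eq: "rip f0 (p n) = rip (g n) (p n) + rip (p n) (p n)" for n
      using rip_add[OF gL pL pL, of n n n] by (simp add: p_def)
    define G where "G = L2norm f0 + B"
    have gB: "L2norm (g n) \<le> G" for n
    proof -
      have "L2norm (\<lambda>t. f0 t + - p n t) \<le> L2norm f0 + L2norm (\<lambda>t. - p n t)" by (rule L2norm_triangle[OF f0 L2_uminus[OF pL]])
      moreover have "L2norm (\<lambda>t. - p n t) = L2norm (p n)" by (simp add: L2norm_def)
      moreover have "(\<lambda>t. f0 t + - p n t) = g n" by (simp add: p_def)
      ultimately show ?thesis using pB[of n] unfolding G_def by simp
    qed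
    have low: "d - \<epsilon> n * G \<le> rip f0 (p n)" for n
    proof -
      have "d \<le> rip (p n) (p n)" unfolding rip_self p_def by (rule dle[OF g(1)])
      moreover have "\<bar>rip (g n) (p n)\<bar> \<le> \<epsilon> n * G"
      proof -
        have "\<bar>rip (g n) (p n)\<bar> \<le> \<epsilon> n * L2norm (g n)" using orth[OF g(1), of n n] by (simp add: rip_commute)
        also have "\<dots> \<le> \<epsilon> n * G" using \<epsilon>0[of n] by (intro mult_left_mono gB) simp
        finally show ?thesis .
      qed
      ultimately show ?thesis unfolding eq by linarith
    qed
    have "(\<lambda>n. d - \<epsilon> n * G) \<longlonglongrightarrow> d - 0 * G" by (intro tendsto_intros \<epsilon>lim)
    then have "d - 0 * G \<le> lr f0" by (rule LIMSEQ_le[OF _ conv[OF f0]]) (use low in blast)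
    then show ?thesis by simp
  qed
  \<comment> \<open>The standard complexification of a real-linear functional.\<close>
  define l where "l f = of_real (lr f) - \<i> * of_real (lr (\<lambda>t. \<i> *s f t))" for f
  have iL: "(\<lambda>t. \<i> *s k t) \<in> L2" if "k \<in> L2" for k :: "real \<Rightarrow> complex^'n" by (rule L2_cscale[OF that])
  have lr_comb: "lr (\<lambda>t. x *\<^sub>R f t + y *\<^sub>R k t + h t) = x * lr f + y * lr k + lr h"
    if "f \<in> L2" "k \<in> L2" "h \<in> L2" for x y f k h
    using that by (simp add: lr_add lr_scale L2_add L2_linear bounded_linear_scaleR_right)
  have l_lin: "l (\<lambda>t. c *s f t + h t) = c * l f + l h" if fh: "f \<in> L2" "h \<in> L2" for c f h
  proof -
    have "(\<lambda>t. c *s f t + h t) = (\<lambda>t. Re c *\<^sub>R f t + Im c *\<^sub>R (\<i> *s f t) + h t)"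
      by (simp add: fun_eq_iff vec_eq_iff complex_eq_iff)
    then have 1: "lr (\<lambda>t. c *s f t + h t) = Re c * lr f + Im c * lr (\<lambda>t. \<i> *s f t) + lr h"
      using lr_comb[OF fh(1) iL[OF fh(1)] fh(2)] by simp
    have "(\<lambda>t. \<i> *s (c *s f t + h t)) = (\<lambda>t. (- Im c) *\<^sub>R f t + Re c *\<^sub>R (\<i> *s f t) + \<i> *s h t)"
      by (simp add: fun_eq_iff vec_eq_iff complex_eq_iff)
    then have 2: "lr (\<lambda>t. \<i> *s (c *s f t + h t)) = (- Im c) * lr f + Re c * lr (\<lambda>t. \<i> *s f t) + lr (\<lambda>t. \<i> *s h t)"
      by (simp only: lr_comb[OF fh(1) iL[OF fh(1)] iL[OF fh(2)]])
    show ?thesis unfolding l_def 1 2 by (simp add: complex_eq_iff algebra_simps)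
  qed
  show ?thesis
  proof (rule that[of l])
    have "norm (l f) \<le> 2 * B * L2norm f" if f: "f \<in> L2" for f
    proof -
      have "norm (l f) \<le> \<bar>lr f\<bar> + \<bar>lr (\<lambda>t. \<i> *s f t)\<bar>"
        unfolding l_def by (rule order_trans[OF norm_triangle_ineq4]) (simp add: norm_mult)
      then show ?thesis using lr_bound[OF f] lr_bound[OF iL[OF f]] by (simp add: L2norm_cscale)
    qed
    then show "bounded_functional l"
      unfolding bounded_functional_def using l_lin B0 by (intro conjI ballI allI exI[of _ "2 * B"]) auto
    show "l h = 0" if h: "h \<in> V" for h
      using lrV[OF h] lrV[OF V(3)[OF h V(2), of \<i>]] by (simp add: l_def)
    have "Re (l f0) > 0" using lrf0 de e by (simp add: l_def) (meson less_le_trans zero_less_power)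
    then show "l f0 \<noteq> 0" by auto
  qed
qed

subsection \<open>Taylor coefficients of entire functions\<close>

lemma taylor_lincomb:
  assumes "\<And>i. i \<in> I \<Longrightarrow> \<phi> i holomorphic_on UNIV"
  shows "taylor (\<lambda>w. \<Sum>i\<in>I. c i * \<phi> i w) z k = (\<Sum>i\<in>I. c i * taylor (\<phi> i) z k)"
proof (rule taylor_unique[where r = 1])
  show "(\<lambda>w. \<Sum>i\<in>I. c i * \<phi> i w) holomorphic_on UNIV" by (intro holomorphic_intros assms)
  show "(\<lambda>k. (\<Sum>i\<in>I. c i * taylor (\<phi> i) z k) * (w - z) ^ k) sums (\<Sum>i\<in>I. c i * \<phi> i w)" for w
  proof -
    have "(\<lambda>k. \<Sum>i\<in>I. c i * (taylor (\<phi> i) z k * (w - z) ^ k)) sums (\<Sum>i\<in>I. c i * \<phi> i w)"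
      by (intro sums_sum sums_mult taylor_sums assms)
    then show ?thesis by (simp add: sum_distrib_right mult.assoc)
  qed
qed simp

text \<open>The quotient is the Taylor series shifted by \<open>m\<close>; it converges everywhere
  because the original series does.\<close>

lemma taylor_factor:
  assumes \<phi>: "\<phi> holomorphic_on UNIV" and z: "\<And>k. k < m \<Longrightarrow> taylor \<phi> z k = 0"
  obtains G where "G holomorphic_on UNIV" "\<And>w. \<phi> w = (w - z) ^ m * G w" "G z = taylor \<phi> z m"
proof -
  define G where "G w = (\<Sum>k. taylor \<phi> z (k + m) * (w - z) ^ k)" for w
  have G: "(\<lambda>k. taylor \<phi> z (k + m) * (w - z) ^ k) sums G w \<and> \<phi> w = (w - z) ^ m * G w" for w
  proof (cases "w = z")
    case True
    have s0: "(\<lambda>k. taylor \<phi> z (k + m) * 0 ^ k) sums taylor \<phi> z (0 + m)" by (rule powser_sums_zero)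
    have "(\<lambda>k. taylor \<phi> z k * 0 ^ k) sums taylor \<phi> z 0" by (rule powser_sums_zero)
    then have "\<phi> z = taylor \<phi> z 0" using taylor_sums[OF \<phi>, of z z] sums_unique2 by fastforce
    then show ?thesis using True s0 z[of 0] sums_unique[OF s0] by (cases "m = 0") (auto simp: G_def)
  next
    case False
    have "(\<lambda>k. taylor \<phi> z (k + m) * (w - z) ^ (k + m)) sums (\<phi> w - (\<Sum>k<m. taylor \<phi> z k * (w - z) ^ k))"
      by (rule sums_split_initial_segment[OF taylor_sums[OF \<phi>]])
    also have "(\<Sum>k<m. taylor \<phi> z k * (w - z) ^ k) = 0" using z by simp
    finally have "(\<lambda>k. inverse ((w - z) ^ m) * (taylor \<phi> z (k + m) * (w - z) ^ (k + m))) sums (inverse ((w - z) ^ m) * (\<phi> w - 0))"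
      by (rule sums_mult)
    moreover have "inverse ((w - z) ^ m) * (taylor \<phi> z (k + m) * (w - z) ^ (k + m)) = taylor \<phi> z (k + m) * (w - z) ^ k" for k
      using False by (simp add: power_add field_simps)
    ultimately have s: "(\<lambda>k. taylor \<phi> z (k + m) * (w - z) ^ k) sums (inverse ((w - z) ^ m) * \<phi> w)" by simp
    then have "G w = inverse ((w - z) ^ m) * \<phi> w" unfolding G_def by (rule sums_unique[symmetric])
    with s False show ?thesis by simp
  qed
  show ?thesis
  proof (rule that[of G])
    have "G holomorphic_on ball z r" for r
      by (rule power_series_holomorphic[of z r "\<lambda>k. taylor \<phi> z (k + m)"]) (use G in blast)
    then have "G field_differentiable at w" for w
      using holomorphic_on_imp_differentiable_at[OF _ open_ball, of G z "dist z w + 1" w] by simp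
    then show "G holomorphic_on UNIV" by (simp add: holomorphic_on_def field_differentiable_at_within)
    show "\<phi> w = (w - z) ^ m * G w" for w using G by blast
    have "(\<lambda>k. taylor \<phi> z (k + m) * 0 ^ k) sums taylor \<phi> z (0 + m)" by (rule powser_sums_zero)
    then show "G z = taylor \<phi> z m" using G[of z] sums_unique2 by fastforce
  qed
qed

text \<open>In the Leibniz formula every term contains a derivative of \<psi> of order at most k <
  m.\<close>

lemma taylor_vanish_product:
  assumes \<phi>: "\<phi> holomorphic_on UNIV" and \<psi>: "\<psi> holomorphic_on UNIV" and \<zeta>: "\<zeta> holomorphic_on ball z r" and r: "r > 0"
    and eq: "\<And>w. w \<in> ball z r \<Longrightarrow> \<phi> w = \<psi> w * \<zeta> w" and v: "\<And>k. k < m \<Longrightarrow> taylor \<psi> z k = 0" and k: "k < m"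
  shows "taylor \<phi> z k = 0"
proof -
  have "(deriv ^^ k) \<phi> z = (deriv ^^ k) (\<lambda>w. \<psi> w * \<zeta> w) z"
    by (rule higher_deriv_transform_within_open[where S = "ball z r"])
       (use \<phi> \<psi> \<zeta> eq r in \<open>auto intro!: holomorphic_intros intro: holomorphic_on_subset\<close>)
  also have "\<dots> = (\<Sum>i = 0..k. of_nat (k choose i) * (deriv ^^ i) \<psi> z * (deriv ^^ (k - i)) \<zeta> z)"
    by (rule higher_deriv_mult[where S = "ball z r"]) (use \<psi> \<zeta> r in \<open>auto intro: holomorphic_on_subset\<close>)
  also have "\<dots> = 0" using v k by (intro sum.neutral) (auto simp: taylor_def)
  finally show ?thesis by (simp add: taylor_def)
qed

lemma taylor_order:
  assumes "\<psi> holomorphic_on UNIV" "\<psi> w \<noteq> 0"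
  obtains m where "taylor \<psi> z m \<noteq> 0" "\<And>k. k < m \<Longrightarrow> taylor \<psi> z k = 0"
proof -
  have "\<exists>m. taylor \<psi> z m \<noteq> 0"
  proof (rule ccontr)
    assume "\<not> ?thesis"
    then have "(\<lambda>k. 0) sums \<psi> w" using taylor_sums[OF assms(1), of z w] by simp
    then have "\<psi> w = 0" using sums_zero sums_unique2 by blast
    with assms(2) show False by simp
  qed
  then have "taylor \<psi> z (LEAST m. taylor \<psi> z m \<noteq> 0) \<noteq> 0" by (rule LeastI_ex)
  then show ?thesis by (rule that) (use not_less_Least in blast)
qed

text \<open>At each point the full power of (w - z) contained in \<psi> also divides
  \<open>N\<close>, so the quotient extends locally across the zero.\<close>

lemma entire_quotient:
  assumes N: "N holomorphic_on UNIV" and \<psi>: "\<psi> holomorphic_on UNIV" "\<psi> w0 \<noteq> 0"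
    and ord: "\<And>z m. (\<And>k. k < m \<Longrightarrow> taylor \<psi> z k = 0) \<Longrightarrow> (\<And>k. k < m \<Longrightarrow> taylor N z k = 0)"
  obtains F where "F holomorphic_on UNIV" "\<And>w. N w = F w * \<psi> w"
proof -
  have loc: "\<exists>f r. r > 0 \<and> f holomorphic_on ball z r \<and> (\<forall>w\<in>ball z r. N w = f w * \<psi> w) \<and> (\<forall>w\<in>ball z r - {z}. \<psi> w \<noteq> 0)" for z
  proof -
    obtain m where m: "taylor \<psi> z m \<noteq> 0" "\<And>k. k < m \<Longrightarrow> taylor \<psi> z k = 0" by (rule taylor_order[OF \<psi>]) blast
    obtain D where D: "D holomorphic_on UNIV" "\<And>w. \<psi> w = (w - z) ^ m * D w" "D z = taylor \<psi> z m"
      by (rule taylor_factor[where m = m and z = z, OF \<psi>(1) m(2)]) blast+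
    obtain G where G: "G holomorphic_on UNIV" "\<And>w. N w = (w - z) ^ m * G w"
      by (rule taylor_factor[where m = m and z = z, OF N]) (use ord[where m = m and z = z] m(2) in blast)+
    have "open {w. D w \<noteq> 0}"
      by (intro open_Collect_neq holomorphic_on_imp_continuous_on D continuous_on_const)
    moreover have "z \<in> {w. D w \<noteq> 0}" using D(3) m(1) by simp
    ultimately obtain r where r: "r > 0" "ball z r \<subseteq> {w. D w \<noteq> 0}" by (meson open_contains_ball)
    show ?thesis
    proof (intro exI conjI ballI)
      show "r > 0" by fact
      show "(\<lambda>w. G w / D w) holomorphic_on ball z r"
        by (intro holomorphic_intros holomorphic_on_subset[OF G(1)] holomorphic_on_subset[OF D(1)]) (use r in auto)
      show "N w = G w / D w * \<psi> w" if "w \<in> ball z r" for w using r that D(2)[of w] G(2)[of w] by auto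
      show "\<psi> w \<noteq> 0" if "w \<in> ball z r - {z}" for w using r that D(2)[of w] by auto
    qed
  qed
  then obtain f r where fr: "\<And>z. r z > 0" "\<And>z. f z holomorphic_on ball z (r z)"
    "\<And>z w. w \<in> ball z (r z) \<Longrightarrow> N w = f z w * \<psi> w" "\<And>z w. w \<in> ball z (r z) - {z} \<Longrightarrow> \<psi> w \<noteq> 0"
    by metis
  \<comment> \<open>The local quotients are glued by taking each at its own centre; off the centre
    \<psi> does not vanish, so they agree there.\<close>
  define F where "F z = f z z" for z
  have NF: "N w = F w * \<psi> w" for w using fr(3)[of w w] fr(1)[of w] by (simp add: F_def)
  have "F holomorphic_on UNIV"
  proof -
    have "F field_differentiable at z" for z
    proof -
      have "F w = f z w" if "w \<in> ball z (r z)" for w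
      proof (cases "w = z")
        case True then show ?thesis by (simp add: F_def)
      next
        case False
        then have "\<psi> w \<noteq> 0" using fr(4)[of w z] that by simp
        moreover have "F w * \<psi> w = f z w * \<psi> w" by (rule trans[OF NF[symmetric] fr(3)[OF that]])
        ultimately show ?thesis by (metis mult_right_cancel)
      qed
      then have "F holomorphic_on ball z (r z) \<longleftrightarrow> f z holomorphic_on ball z (r z)"
        by (intro holomorphic_cong) auto
      then have "F holomorphic_on ball z (r z)" using fr(2)[of z] by simp
      then show ?thesis using fr(1)[of z] by (auto intro: holomorphic_on_imp_differentiable_at)
    qed
    then show ?thesis by (simp add: holomorphic_on_def field_differentiable_at_within)
  qed
  with NF show ?thesis by (intro that[of F]) auto
qed

text \<open>\<phi> vanishes at z to at least the order of \<psi>, so \<phi> / \<psi> has no pole and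
  its principal part is zero. Denominators are cleared: a polynomial of degree below K that vanishes
  to order K at z is 0.\<close>

lemma principal_part_zero:
  assumes \<phi>: "\<phi> holomorphic_on UNIV" and \<psi>: "\<psi> holomorphic_on UNIV"
    and m: "taylor \<psi> z m \<noteq> 0" "\<And>k. k < m \<Longrightarrow> taylor \<psi> z k = 0" "\<And>k. k < m \<Longrightarrow> taylor \<phi> z k = 0"
    and eq: "\<And>w. w \<noteq> z \<Longrightarrow> \<phi> w = \<psi> w * (\<Sum>j<K. c j / (w - z) ^ Suc j)" and j: "j < K"
  shows "c j = 0"
proof -
  obtain D where D: "D holomorphic_on UNIV" "\<And>w. \<psi> w = (w - z) ^ m * D w" "D z = taylor \<psi> z m"
    by (rule taylor_factor[where m = m and z = z, OF \<psi> m(2)]) blast+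
  obtain G where G: "G holomorphic_on UNIV" "\<And>w. \<phi> w = (w - z) ^ m * G w"
    by (rule taylor_factor[where m = m and z = z, OF \<phi> m(3)]) blast+
  \<comment> \<open>The principal part multiplied by (w - z)^K, with its coefficients
    reversed.\<close>
  define P where "P w = (\<Sum>i<K. c (K - Suc i) * (w - z) ^ i)" for w
  have P: "P holomorphic_on UNIV" unfolding P_def by (intro holomorphic_intros)
  have DP: "D w * P w = (w - z) ^ K * G w" if "w \<noteq> z" for w
  proof -
    have "(w - z) ^ K * (\<Sum>j<K. c j / (w - z) ^ Suc j) = (\<Sum>j<K. c j * (w - z) ^ (K - Suc j))"
      unfolding sum_distrib_left
    proof (rule sum.cong[OF refl])
      fix j assume "j \<in> {..<K}"
      then have "(w - z) ^ K = (w - z) ^ (K - Suc j) * (w - z) ^ Suc j" by (simp flip: power_add del: power_Suc)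
      then show "(w - z) ^ K * (c j / (w - z) ^ Suc j) = c j * (w - z) ^ (K - Suc j)" using that by simp
    qed
    also have "\<dots> = P w" unfolding P_def by (rule sum.reindex_bij_witness[of _ "\<lambda>i. K - Suc i" "\<lambda>i. K - Suc i"]) auto
    finally have "(w - z) ^ m * (D w * P w) = (w - z) ^ K * \<phi> w"
      using eq[OF that] D(2)[of w] by (simp add: mult_ac)
    then have "(w - z) ^ m * (D w * P w) = (w - z) ^ m * ((w - z) ^ K * G w)" using G(2)[of w] by (simp add: mult_ac)
    then show ?thesis using that by simp
  qed
  have DPz: "D w * P w = (w - z) ^ K * G w" for w
  proof -
    have "D w * P w - (w - z) ^ K * G w = 0"
    proof (rule analytic_continuation_open[where s = "UNIV - {z}" and s' = UNIV and g = "\<lambda>_. 0"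
          and f = "\<lambda>w. D w * P w - (w - z) ^ K * G w"])
      show "UNIV - {z} \<noteq> {}" by (metis Diff_eq_empty_iff UNIV_I insertE empty_iff subset_iff zero_neq_one)
      show "(\<lambda>w. D w * P w - (w - z) ^ K * G w) holomorphic_on UNIV" by (intro holomorphic_intros D P G)
    qed (use DP in auto)
    then show ?thesis by simp
  qed
  have "open {w. D w \<noteq> 0}"
    by (intro open_Collect_neq holomorphic_on_imp_continuous_on D continuous_on_const)
  moreover have "z \<in> {w. D w \<noteq> 0}" using D(3) m(1) by simp
  ultimately obtain r where r: "r > 0" "ball z r \<subseteq> {w. D w \<noteq> 0}" by (meson open_contains_ball)
  have mono: "taylor (\<lambda>w. (w - z) ^ K) z k = 0" if "k < K" for k
  proof -
    have "taylor (\<lambda>w. (w - z) ^ K) z k = (if k = K then 1 else 0)"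
    proof (rule taylor_unique[where r = 1])
      have "(\<lambda>k. if k = K then (w - z) ^ k else 0) sums (w - z) ^ K" for w by (rule sums_single)
      then show "(\<lambda>k. (if k = K then 1 else 0) * (w - z) ^ k) sums (w - z) ^ K" for w
        by (simp add: if_distrib[of "\<lambda>x. x * _"] cong: if_cong)
    qed (auto intro!: holomorphic_intros)
    then show ?thesis using that by simp
  qed
  have "taylor P z i = 0" if "i < K" for i
  proof (rule taylor_vanish_product[OF P, of "\<lambda>w. (w - z) ^ K" "\<lambda>w. G w / D w" z r K])
    show "(\<lambda>w. G w / D w) holomorphic_on ball z r"
      by (intro holomorphic_intros holomorphic_on_subset[OF G(1)] holomorphic_on_subset[OF D(1)]) (use r in auto)
    show "P w = (w - z) ^ K * (G w / D w)" if "w \<in> ball z r" for w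
      using DPz[of w] r that by (auto simp: field_simps)
  qed (use r mono that in \<open>auto intro!: holomorphic_intros\<close>)
  moreover have "taylor P z i = (if i < K then c (K - Suc i) else 0)" for i
  proof (rule taylor_unique[OF P, where r = 1])
    fix w
    have "(\<lambda>i. (if i < K then c (K - Suc i) else 0) * (w - z) ^ i) sums (\<Sum>i<K. (if i < K then c (K - Suc i) else 0) * (w - z) ^ i)"
      by (rule sums_finite) auto
    then show "(\<lambda>i. (if i < K then c (K - Suc i) else 0) * (w - z) ^ i) sums P w" by (simp add: P_def)
  qed simp
  ultimately have "c (K - Suc (K - Suc j)) = 0" using j by (metis diff_Suc_less gr_implies_not0 not_gr_zero)
  then show ?thesis using j by simp
qed

text \<open>A functional vanishing on the common kernel of finitely many others is a combination of
  them. The induction removes one functional at a time by restricting to its kernel.\<close>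

lemma (in vector_space) linear_functional_combination:
  fixes c :: "'i \<Rightarrow> 'b \<Rightarrow> 'a"
  assumes "finite I" "subspace W"
    and "\<And>i f g z. i \<in> I \<Longrightarrow> f \<in> W \<Longrightarrow> g \<in> W \<Longrightarrow> c i (scale z f + g) = z * c i f + c i g"
    and "\<And>f g z. f \<in> W \<Longrightarrow> g \<in> W \<Longrightarrow> \<theta> (scale z f + g) = z * \<theta> f + \<theta> g"
    and "\<And>f. f \<in> W \<Longrightarrow> (\<And>i. i \<in> I \<Longrightarrow> c i f = 0) \<Longrightarrow> \<theta> f = 0"
  shows "\<exists>\<alpha>. \<forall>f\<in>W. \<theta> f = (\<Sum>i\<in>I. \<alpha> i * c i f)"
  using assms
proof (induction I arbitrary: W rule: finite_induct)
  case empty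
  then show ?case by auto
next
  case (insert i I)
  note sub = insert.prems(1) and clin = insert.prems(2) and tlin = insert.prems(3) and ker = insert.prems(4)
  have zero: "c j 0 = 0" if "j \<in> insert i I" for j
    using clin[OF that subspace_0[OF sub] subspace_0[OF sub], of "- 1"] by simp
  define W' where "W' = {f \<in> W. c i f = 0}"
  have W'W: "W' \<subseteq> W" by (auto simp: W'_def)
  have W': "subspace W'"
  proof (rule subspaceI)
    show "0 \<in> W'" using subspace_0[OF sub] zero by (simp add: W'_def)
    show "f + g \<in> W'" if "f \<in> W'" "g \<in> W'" for f g
      using that clin[of i f g 1] subspace_add[OF sub] by (auto simp: W'_def)
    show "scale z f \<in> W'" if "f \<in> W'" for z f
      using that clin[of i f 0 z] subspace_scale[OF sub] subspace_0[OF sub] zero[of i] by (auto simp: W'_def)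
  qed
  have "\<exists>\<alpha>. \<forall>f\<in>W'. \<theta> f = (\<Sum>j\<in>I. \<alpha> j * c j f)"
  proof (rule insert.IH[OF W'])
    show "\<theta> f = 0" if "f \<in> W'" "\<And>j. j \<in> I \<Longrightarrow> c j f = 0" for f
      by (rule ker) (use that in \<open>auto simp: W'_def\<close>)
    show "c j (scale z f + g) = z * c j f + c j g" if "j \<in> I" "f \<in> W'" "g \<in> W'" for j f g z
      using clin[of j f g z] that W'W by blast
    show "\<theta> (scale z f + g) = z * \<theta> f + \<theta> g" if "f \<in> W'" "g \<in> W'" for f g z
      using tlin[of f g z] that W'W by blast
  qed
  then obtain \<alpha> where \<alpha>: "\<And>f. f \<in> W' \<Longrightarrow> \<theta> f = (\<Sum>j\<in>I. \<alpha> j * c j f)" by blast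
  show ?case
  proof (cases "\<exists>e\<in>W. c i e \<noteq> 0")
    case False
    then have "W' = W" by (auto simp: W'_def)
    with False \<alpha> insert.hyps show ?thesis by (intro exI[of _ \<alpha>]) auto
  next
    case True
    then obtain e where e: "e \<in> W" "c i e \<noteq> 0" by auto
    \<comment> \<open>The coefficient that corrects the combination on a vector \<open>e\<close>
      outside the kernel of \<open>c i\<close>; every vector of \<open>W\<close> differs from one of
      \<open>W'\<close> by a multiple of \<open>e\<close>.\<close>
    define \<beta> where "\<beta> = (\<theta> e - (\<Sum>j\<in>I. \<alpha> j * c j e)) / c i e"
    have res: "\<theta> f = (\<Sum>j\<in>insert i I. (if j = i then \<beta> else \<alpha> j) * c j f)" if f: "f \<in> W" for f
    proof -
      define s where "s = - (c i f / c i e)"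
      have gW: "scale s e + f \<in> W" using e f subspace_add[OF sub] subspace_scale[OF sub] by auto
      have "c i (scale s e + f) = 0" using clin[OF _ e(1) f, of i s] e by (simp add: s_def)
      then have "\<theta> (scale s e + f) = (\<Sum>j\<in>I. \<alpha> j * c j (scale s e + f))" by (intro \<alpha>) (simp add: W'_def gW)
      also have "\<dots> = (\<Sum>j\<in>I. \<alpha> j * (s * c j e + c j f))"
        by (rule sum.cong) (use clin[OF _ e(1) f] in auto)
      also have "\<dots> = s * (\<Sum>j\<in>I. \<alpha> j * c j e) + (\<Sum>j\<in>I. \<alpha> j * c j f)"
        by (simp add: sum_distrib_left sum.distrib algebra_simps)
      finally have eq: "s * \<theta> e + \<theta> f = s * (\<Sum>j\<in>I. \<alpha> j * c j e) + (\<Sum>j\<in>I. \<alpha> j * c j f)"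
        unfolding tlin[OF e(1) f] .
      have "\<theta> f = (s * \<theta> e + \<theta> f) - s * \<theta> e" by simp
      also have "\<dots> = (\<Sum>j\<in>I. \<alpha> j * c j f) + (- s) * (\<theta> e - (\<Sum>j\<in>I. \<alpha> j * c j e))"
        unfolding eq by (simp add: algebra_simps)
      also have "- s = c i f / c i e" by (simp add: s_def)
      also have "(c i f / c i e) * (\<theta> e - (\<Sum>j\<in>I. \<alpha> j * c j e)) = \<beta> * c i f" by (simp add: \<beta>_def)
      also have "(\<Sum>j\<in>I. \<alpha> j * c j f) = (\<Sum>j\<in>I. (if j = i then \<beta> else \<alpha> j) * c j f)"
        by (rule sum.cong) (use insert.hyps in auto)
      finally show ?thesis using insert.hyps by simp
    qed
    show ?thesis
      by (rule exI[of _ "\<lambda>j. if j = i then \<beta> else \<alpha> j"], rule ballI, rule res)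
  qed
qed

subsection \<open>Root subspaces as chains\<close>

lemma lin_sol_cong:
  fixes P :: "real \<Rightarrow> complex^'n^'n"
  assumes "lin_sol P g y" and eq: "\<And>t. t \<in> {0..1} \<Longrightarrow> g t = h t" "\<And>t. t \<in> {0..1} \<Longrightarrow> y t = z t"
  shows "lin_sol P h z"
  unfolding lin_sol_def
proof (intro conjI ballI)
  show "continuous_on {0..1} z"
    using assms(1) eq(2) unfolding lin_sol_def by (blast intro: continuous_on_eq)
  fix x :: real assume x: "x \<in> {0..1}"
  have "y x = y 0 + integral\<^sup>L (lebesgue_on {0..x}) (\<lambda>t. P t *v y t + g t)"
    using assms(1) x unfolding lin_sol_def by blast
  also have "integral\<^sup>L (lebesgue_on {0..x}) (\<lambda>t. P t *v y t + g t) = integral\<^sup>L (lebesgue_on {0..x}) (\<lambda>t. P t *v z t + h t)"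
    by (rule Bochner_Integration.integral_cong) (use x eq in auto)
  finally show "z x = z 0 + integral\<^sup>L (lebesgue_on {0..x}) (\<lambda>t. P t *v z t + h t)"
    using eq(2)[of x] eq(2)[of 0] x by simp
qed

lemma AE_leb_sub:
  assumes "AE t in leb. P t" "x \<in> {0..1}" shows "AE t in lebesgue_on {0..x}. P t"
proof -
  have "AE t in lebesgue. t \<in> {0..1} \<longrightarrow> P t" using assms(1) by (subst (asm) AE_restrict_space_iff) simp_all
  then have "AE t in lebesgue. t \<in> {0..x} \<longrightarrow> P t" by (rule eventually_mono) (use assms(2) in auto)
  then show ?thesis by (subst AE_restrict_space_iff) simp_all
qed

text \<open>Representatives differ arbitrarily outside \<open>{0..1}\<close>; the norm bound makes
  functionals blind to this.\<close>

lemma bounded_functional_cong: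
  assumes l: "bounded_functional l" and "f \<in> L2" "g \<in> L2" "\<And>t. t \<in> {0..1} \<Longrightarrow> f t = g t"
  shows "l f = l g"
proof -
  obtain B where B: "\<And>f. f \<in> L2 \<Longrightarrow> norm (l f) \<le> B * L2norm f" using l unfolding bounded_functional_def by blast
  have "L2norm (\<lambda>t. f t - g t) \<le> 0"
    by (rule L2norm_le_const[OF L2D(1)[OF L2_diff[OF assms(2,3)]]]) (use assms(4) in auto)
  then have "L2norm (\<lambda>t. f t - g t) = 0" using L2norm_nonneg by (rule antisym)
  then have "norm (l f - l g) \<le> 0" using B[OF L2_diff[OF assms(2,3)]] by (simp add: bounded_functional_diff[OF assms(1-3)])
  then show ?thesis by simp
qed

lemma scalar_rhs_iff:
  fixes a :: complex
  assumes a: "a \<noteq> 0"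
  shows "h = - \<i> * (inverse a * g) + q - \<mu> * y \<longleftrightarrow> \<i> * a * (\<mu> * y - q + h) = g"
proof
  assume "h = - \<i> * (inverse a * g) + q - \<mu> * y"
  then have "\<mu> * y - q + h = - \<i> * (inverse a * g)" by simp
  then show "\<i> * a * (\<mu> * y - q + h) = g" using a by (simp add: mult_ac)
next
  assume "\<i> * a * (\<mu> * y - q + h) = g"
  then have "inverse a * g = \<i> * (\<mu> * y - q + h)" using a by auto
  then have "- \<i> * (inverse a * g) = \<mu> * y - q + h" by (simp only: mult.assoc[symmetric]) simp
  then show "h = - \<i> * (inverse a * g) + q - \<mu> * y" by simp
qed

context bvp
begin

abbreviation Bm :: "complex^'n^'n" where "Bm \<equiv> diag_mat (\<lambda>k. inverse (a k))"

abbreviation opm :: "complex \<Rightarrow> ((real \<Rightarrow> complex^'n) \<times> (real \<Rightarrow> complex^'n)) set"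
  where "opm \<equiv> op_minus Bm C D Q"

lemma sol_cong:
  assumes "sol \<mu> f y" "\<And>t. t \<in> {0..1} \<Longrightarrow> f t = g t" "\<And>t. t \<in> {0..1} \<Longrightarrow> y t = z t"
  shows "sol \<mu> g z"
  using assms(1) unfolding sol_def by (rule lin_sol_cong) (use assms(2,3) in auto)

lemma rhs_component:
  "((diag_mat (\<lambda>k. \<mu> * (\<i> * a k)) + - (IA ** Q t)) *v y + IA *v h) $ k = \<i> * a k * (\<mu> * y $ k - (Q t *v y) $ k + h $ k)"
proof -
  have "((IA ** Q t) *v y) $ k = \<i> * a k * (Q t *v y) $ k"
    by (metis diag_mat_vec matrix_vector_mul_assoc)
  moreover have "- (IA ** Q t) *v y = - ((IA ** Q t) *v y)"
    by (simp add: vec_eq_iff matrix_vector_mult_def sum_negf)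
  ultimately show ?thesis by (simp add: matrix_vector_mult_add_rdistrib algebra_simps)
qed

lemma rhs_iff:
  "h = (- \<i>) *s (Bm *v g) + Q t *v y - \<mu> *s y \<longleftrightarrow>
    (diag_mat (\<lambda>k. \<mu> * (\<i> * a k)) + - (IA ** Q t)) *v y + IA *v h = g"
proof -
  have "h $ k = ((- \<i>) *s (Bm *v g) + Q t *v y - \<mu> *s y) $ k \<longleftrightarrow>
    ((diag_mat (\<lambda>k. \<mu> * (\<i> * a k)) + - (IA ** Q t)) *v y + IA *v h) $ k = g $ k" for k
    unfolding rhs_component using scalar_rhs_iff[OF a_nz[of k], of "h $ k" "g $ k" "(Q t *v y) $ k" \<mu> "y $ k"] by simp
  then show ?thesis unfolding vec_eq_iff by simp
qed

text \<open>The derivative in the graph equals the solved right-hand side only almost everywhere,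
  but the primitives coincide, which turns the graph relation into the integral equation.\<close>

lemma opmD:
  assumes "(y, h) \<in> opm \<mu>"
  shows "sol \<mu> h y" "bc y = 0" "h \<in> L2" "\<And>x. x \<notin> {0..1} \<Longrightarrow> y x = 0"
proof -
  let ?r = "\<lambda>t. (diag_mat (\<lambda>k. \<mu> * (\<i> * a k)) + - (IA ** Q t)) *v y t + IA *v h t"
  have dom: "y \<in> W12" "bc y = 0" "h \<in> L2"
    using assms by (auto simp: op_minus_def op_domain_def)
  then show "bc y = 0" "h \<in> L2" "\<And>x. x \<notin> {0..1} \<Longrightarrow> y x = 0" by (auto simp: W12_def)
  obtain g where g: "has_L2_derivative y g"
    "AE x in leb. h x = (- \<i>) *s (Bm *v g x) + Q x *v y x - \<mu> *s y x"
    using assms by (auto simp: op_minus_def)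
  have gL: "g \<in> L2" and yg: "\<And>x. x \<in> {0..1} \<Longrightarrow> y x = y 0 + integral\<^sup>L (lebesgue_on {0..x}) g"
    using g(1) unfolding has_L2_derivative_def by blast+
  have "continuous_on {0..1} (\<lambda>x. y 0 + integral\<^sup>L (lebesgue_on {0..x}) g)"
    by (intro continuous_intros continuous_on_primitive L2_integrable gL)
  then have yc: "continuous_on {0..1} y" by (rule continuous_on_eq) (use yg in metis)
  have ri: "integrable leb ?r" by (rule lin_sol_integrand[OF coeff_L2 IAf[OF dom(3)] yc])
  have ae: "AE x in leb. g x = ?r x" using g(2) unfolding rhs_iff by (rule eventually_mono) simp
  show "sol \<mu> h y" unfolding sol_def lin_sol_def
  proof (intro conjI ballI yc)
    fix x :: real assume x: "x \<in> {0..1}"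
    have "integral\<^sup>L (lebesgue_on {0..x}) g = integral\<^sup>L (lebesgue_on {0..x}) ?r"
      by (rule integral_cong_AE[OF borel_measurable_integrable[OF integrable_leb_sub[OF L2_integrable[OF gL] x]]
          borel_measurable_integrable[OF integrable_leb_sub[OF ri x]] AE_leb_sub[OF ae x]])
    then show "y x = y 0 + integral\<^sup>L (lebesgue_on {0..x}) ?r" using yg[OF x] by metis
  qed
qed

lemma opmI:
  assumes y: "sol \<mu> h y" and "bc y = 0" "h \<in> L2" "\<And>x. x \<notin> {0..1} \<Longrightarrow> y x = 0"
  shows "(y, h) \<in> opm \<mu>"
proof -
  let ?r = "\<lambda>t. (diag_mat (\<lambda>k. \<mu> * (\<i> * a k)) + - (IA ** Q t)) *v y t + IA *v h t"
  have "?r \<in> L2"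
    by (intro L2_add IAf assms(3) L2_mat_vec_continuous coeff_L2 sol_continuous[OF y])
  then have r: "has_L2_derivative y ?r"
    using y unfolding has_L2_derivative_def sol_def lin_sol_def by blast
  moreover have "h x = (- \<i>) *s (Bm *v ?r x) + Q x *v y x - \<mu> *s y x" for x
    by (subst rhs_iff) (rule refl)
  ultimately show ?thesis
    using assms(2-4) unfolding op_minus_def op_domain_def W12_def by blast
qed

lemma opm_lin:
  assumes "(y, h) \<in> opm \<mu>" "(z, k) \<in> opm \<mu>"
  shows "(cscale c y + z, cscale c h + k) \<in> opm \<mu>"
proof -
  note y = opmD[OF assms(1)] and z = opmD[OF assms(2)]
  have eq: "cscale c u + v = (\<lambda>t. c *s u t + v t)" for u v :: "real \<Rightarrow> complex^'n"
    by (simp add: cscale_def fun_eq_iff)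
  show ?thesis unfolding eq
  proof (rule opmI[OF sol_comb[OF y(1) z(1) y(3) z(3)]])
    have "bc (\<lambda>t. c *s y t + z t) = c *s bc y + bc z"
      by (simp add: matrix_vector_right_distrib vec.scale vec.scale_right_distrib algebra_simps)
    then show "bc (\<lambda>t. c *s y t + z t) = 0" using y(2) z(2) by simp
    show "(\<lambda>t. c *s h t + k t) \<in> L2" by (intro L2_add L2_cscale y(3) z(3))
    show "c *s y x + z x = 0" if "x \<notin> {0..1}" for x using y(4)[OF that] z(4)[OF that] by simp
  qed
qed

lemma opm_zero: "(0, 0) \<in> opm \<mu>"
proof -
  have "((\<lambda>t. 0), (\<lambda>t. 0)) \<in> opm \<mu>" by (rule opmI[OF sol_zero]) auto
  then show ?thesis by (simp add: zero_fun_def)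
qed

text \<open>Jordan chains under L - \<mu>, padded by zeros to infinite sequences so that chains of
  different lengths can be added termwise. Images are exact functions, each again in the
  domain.\<close>

definition chain :: "complex \<Rightarrow> (real \<Rightarrow> complex^'n) set"
  where "chain \<mu> = {y. \<exists>Y K. Y 0 = y \<and> (\<forall>j. (Y j, Y (Suc j)) \<in> opm \<mu>) \<and> (\<forall>j\<ge>K. Y j = 0)}"

lemma chainE:
  assumes "y \<in> chain \<mu>"
  obtains Y K where "Y 0 = y" "\<And>j. (Y j, Y (Suc j)) \<in> opm \<mu>" "\<And>j. j \<ge> K \<Longrightarrow> Y j = 0"
  using assms unfolding chain_def by blast

lemma chain_L2: "y \<in> chain \<mu> \<Longrightarrow> y \<in> L2"
  by (metis chainE opmD(1) sol_L2)

lemma chain_lin: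
  assumes "y \<in> chain \<mu>" "z \<in> chain \<mu>" shows "cscale c y + z \<in> chain \<mu>"
proof -
  obtain Y K where Y: "Y 0 = y" "\<And>j. (Y j, Y (Suc j)) \<in> opm \<mu>" "\<And>j. j \<ge> K \<Longrightarrow> Y j = 0" by (rule chainE[OF assms(1)]) blast
  obtain Z L where Z: "Z 0 = z" "\<And>j. (Z j, Z (Suc j)) \<in> opm \<mu>" "\<And>j. j \<ge> L \<Longrightarrow> Z j = 0" by (rule chainE[OF assms(2)]) blast
  show ?thesis unfolding chain_def
  proof (intro CollectI exI conjI allI impI)
    show "(\<lambda>j. cscale c (Y j) + Z j) 0 = cscale c y + z" using Y(1) Z(1) by simp
    show "(cscale c (Y j) + Z j, cscale c (Y (Suc j)) + Z (Suc j)) \<in> opm \<mu>" for j by (rule opm_lin[OF Y(2) Z(2)])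
    show "cscale c (Y j) + Z j = 0" if "max K L \<le> j" for j using Y(3)[of j] Z(3)[of j] that by simp
  qed
qed

lemma chain_zero: "0 \<in> chain \<mu>"
  unfolding chain_def using opm_zero by (intro CollectI exI[of _ "\<lambda>j. 0"] exI[of _ 0]) auto

lemma chain_subspace: "cfun.subspace (chain \<mu>)"
proof (rule cfun.subspaceI)
  show "0 \<in> chain \<mu>" by (rule chain_zero)
  show "y + z \<in> chain \<mu>" if "y \<in> chain \<mu>" "z \<in> chain \<mu>" for y z
    using chain_lin[OF that, of 1] by simp
  show "cscale c y \<in> chain \<mu>" if "y \<in> chain \<mu>" for c y
    using chain_lin[OF that chain_zero, of c] by simp
qed

lemma ker_pow_chain:
  assumes "k \<ge> 1" "y \<in> ker_pow Bm C D Q \<mu> k" shows "y \<in> chain \<mu>"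
proof -
  obtain h where h: "(y, h) \<in> opm \<mu> ^^ k" "AE x in leb. h x = 0" using assms(2) by (auto simp: ker_pow_def)
  then obtain f where f: "f 0 = y" "f k = h" "\<And>i. i < k \<Longrightarrow> (f i, f (Suc i)) \<in> opm \<mu>"
    unfolding relpow_fun_conv by blast
  define Y where "Y j = (if j < k then f j else 0)" for j
  \<comment> \<open>The last image is zero only almost everywhere; the graph contains all
    representatives, so it may be replaced by the zero function.\<close>
  have last: "(f j, 0) \<in> opm \<mu>" if "Suc j = k" for j
  proof -
    have "(f j, h) \<in> opm \<mu>" using f(3)[of j] f(2) that by auto
    then obtain g where g: "f j \<in> op_domain C D" "has_L2_derivative (f j) g"
      "AE x in leb. h x = (- \<i>) *s (Bm *v g x) + Q x *v f j x - \<mu> *s f j x"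
      unfolding op_minus_def by blast
    have "AE x in leb. (0 :: real \<Rightarrow> complex^'n) x = (- \<i>) *s (Bm *v g x) + Q x *v f j x - \<mu> *s f j x"
      using g(3) h(2) by eventually_elim simp
    moreover have "(0 :: real \<Rightarrow> complex^'n) \<in> L2" using L2_zero by (simp add: zero_fun_def)
    ultimately show ?thesis using g(1,2) unfolding op_minus_def by blast
  qed
  have "(Y j, Y (Suc j)) \<in> opm \<mu>" for j
    using f(3)[of j] last[of j] opm_zero by (cases "Suc j < k"; cases "Suc j = k") (auto simp: Y_def)
  moreover have "Y 0 = y" using assms(1) f(1) by (simp add: Y_def)
  moreover have "\<forall>j\<ge>k. Y j = 0" by (simp add: Y_def)
  ultimately show ?thesis unfolding chain_def by blast
qed

lemma chain_ker_pow:
  assumes "y \<in> chain \<mu>" shows "\<exists>k\<ge>1. y \<in> ker_pow Bm C D Q \<mu> k"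
proof -
  obtain Y K where Y: "Y 0 = y" "\<And>j. (Y j, Y (Suc j)) \<in> opm \<mu>" "\<And>j. j \<ge> K \<Longrightarrow> Y j = 0" by (rule chainE[OF assms]) blast
  have "(y, Y (Suc K)) \<in> opm \<mu> ^^ Suc K" unfolding relpow_fun_conv using Y by blast
  then have "y \<in> ker_pow Bm C D Q \<mu> (Suc K)" unfolding ker_pow_def using Y(3)[of "Suc K"] by auto
  then show ?thesis by (intro exI[of _ "Suc K"]) simp
qed

text \<open>The union of the kernels is already a subspace, because padded chains are closed under
  combinations; taking the span adds nothing.\<close>

lemma root_subspace_eq: "root_subspace Bm C D Q \<mu> = chain \<mu>"
proof -
  have "(\<Union>k\<in>{1..}. ker_pow Bm C D Q \<mu> k) = chain \<mu>"
    using ker_pow_chain chain_ker_pow by fastforce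
  then show ?thesis unfolding root_subspace_def
    using chain_subspace by (simp add: cfun.span_eq_iff)
qed

text \<open>The Laurent expansion of the resolvent on a chain. As (L - \<mu>) maps Y j to Y (j+1) -
  (\<mu> - \<nu>) Y j, the sum telescopes, and it ends because the chain does.\<close>

lemma chain_resolvent:
  assumes Y: "\<And>j. (Y j, Y (Suc j)) \<in> opm \<nu>" "\<And>j. j \<ge> K \<Longrightarrow> Y j = 0" and \<mu>: "\<mu> \<noteq> \<nu>"
  defines "z \<equiv> \<lambda>t. \<Sum>j<K. (- (1 / (\<mu> - \<nu>) ^ Suc j)) *s Y j t"
  shows "sol \<mu> (Y 0) z" "bc z = 0"
proof -
  define w where "w = \<mu> - \<nu>"
  have w: "w \<noteq> 0" using \<mu> by (simp add: w_def)
  note Yop = opmD[OF Y(1)]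
  have YL: "Y j \<in> L2" for j by (rule sol_L2[OF Yop(1)])
  have "sol \<mu> (\<lambda>t. Y 0 t - (1 / w ^ n) *s Y n t) (\<lambda>t. \<Sum>j<n. (- (1 / w ^ Suc j)) *s Y j t)" for n
  proof (induction n)
    case 0
    show ?case using sol_zero by simp
  next
    case (Suc n)
    have s: "sol \<mu> (\<lambda>t. Y (Suc n) t - w *s Y n t) (Y n)"
      using sol_shift[OF Yop(1)[of n], of \<mu>] by (simp add: w_def)
    have s': "sol \<mu> (\<lambda>t. (- (1 / w ^ Suc n)) *s (Y (Suc n) t - w *s Y n t) + (Y 0 t - (1 / w ^ n) *s Y n t))
      (\<lambda>t. (- (1 / w ^ Suc n)) *s Y n t + (\<Sum>j<n. (- (1 / w ^ Suc j)) *s Y j t))"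
      by (rule sol_comb[OF s Suc]) (intro L2_diff L2_cscale YL)+
    have e1: "(- (1 / w ^ Suc n)) *s (Y (Suc n) t - w *s Y n t) + (Y 0 t - (1 / w ^ n) *s Y n t)
      = Y 0 t - (1 / w ^ Suc n) *s Y (Suc n) t" for t
      using w by (simp add: vec_eq_iff field_simps)
    have e2: "(- (1 / w ^ Suc n)) *s Y n t + (\<Sum>j<n. (- (1 / w ^ Suc j)) *s Y j t)
      = (\<Sum>j<Suc n. (- (1 / w ^ Suc j)) *s Y j t)" for t
      by (simp add: add.commute del: power_Suc)
    show ?case using s' unfolding e1 e2 .
  qed
  from this[of K] show "sol \<mu> (Y 0) z" using Y(2)[of K] by (simp add: z_def w_def)
  have "bc (\<lambda>t. \<Sum>j<n. (- (1 / (\<mu> - \<nu>) ^ Suc j)) *s Y j t) = 0" for n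
  proof (induction n)
    case (Suc n)
    have "bc (\<lambda>t. \<Sum>j<Suc n. (- (1 / (\<mu> - \<nu>) ^ Suc j)) *s Y j t)
      = bc (\<lambda>t. \<Sum>j<n. (- (1 / (\<mu> - \<nu>) ^ Suc j)) *s Y j t) + (- (1 / (\<mu> - \<nu>) ^ Suc n)) *s bc (Y n)"
      by (simp add: matrix_vector_right_distrib vec.scale vec.scale_right_distrib vec.neg algebra_simps del: power_Suc)
    then show ?case using Suc Yop(2)[of n] by simp
  qed simp
  then show "bc z = 0" by (simp add: z_def)
qed

text \<open>Evaluates the Laurent expansion at 0 and multiplies by \<Delta>. The identity is clear
  where \<Delta> does not vanish and extends over the punctured plane, which is connected.\<close>

lemma u_chain:
  assumes Y: "\<And>j. (Y j, Y (Suc j)) \<in> opm \<nu>" "\<And>j. j \<ge> K \<Longrightarrow> Y j = 0" and \<mu>: "\<mu> \<noteq> \<nu>"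
    and nd: "\<kappa> \<noteq> \<nu>" "\<Delta> \<kappa> \<noteq> 0"
  shows "u \<mu> (Y 0) $ i = \<Delta> \<mu> * (\<Sum>j<K. (- (Y j 0 $ i)) / (\<mu> - \<nu>) ^ Suc j)"
proof -
  have YL: "Y 0 \<in> L2" by (rule sol_L2[OF opmD(1)[OF Y(1)]])
  have eq: "u \<mu> (Y 0) $ i = \<Delta> \<mu> * (\<Sum>j<K. (- (Y j 0 $ i)) / (\<mu> - \<nu>) ^ Suc j)" if "\<mu> \<noteq> \<nu>" "\<Delta> \<mu> \<noteq> 0" for \<mu>
  proof -
    have "U \<mu> (Y 0) 0 = \<Delta> \<mu> *s (\<Sum>j<K. (- (1 / (\<mu> - \<nu>) ^ Suc j)) *s Y j 0)"
      by (rule U_unique[OF chain_resolvent[where Y = Y and K = K, OF Y that(1)] YL that(2)]) simp_all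
    then show ?thesis unfolding U_sol(2)[OF YL] by (simp del: power_Suc)
  qed
  show ?thesis
  proof (rule analytic_continuation_open[where s = "{\<mu>. \<mu> \<noteq> \<nu>} \<inter> {\<mu>. \<Delta> \<mu> \<noteq> 0}" and s' = "- {\<nu>}"
        and f = "\<lambda>\<mu>. u \<mu> (Y 0) $ i" and g = "\<lambda>\<mu>. \<Delta> \<mu> * (\<Sum>j<K. (- (Y j 0 $ i)) / (\<mu> - \<nu>) ^ Suc j)"])
    show "open ({\<mu>. \<mu> \<noteq> \<nu>} \<inter> {\<mu>. \<Delta> \<mu> \<noteq> 0})"
      by (intro open_Int open_Collect_neq holomorphic_on_imp_continuous_on \<Delta>_holomorphic continuous_intros)
    show "connected (- {\<nu>})" by (rule connected_punctured_universe) simp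
    show "(\<lambda>\<mu>. u \<mu> (Y 0) $ i) holomorphic_on - {\<nu>}"
      by (rule holomorphic_on_subset[OF u_holomorphic[OF YL]]) simp
    show "(\<lambda>\<mu>. \<Delta> \<mu> * (\<Sum>j<K. (- (Y j 0 $ i)) / (\<mu> - \<nu>) ^ Suc j)) holomorphic_on - {\<nu>}"
      by (intro holomorphic_intros holomorphic_on_subset[OF \<Delta>_holomorphic]) auto
  qed (use nd \<mu> eq in auto)
qed

text \<open>The coefficient functionals below the order of \<open>\<nu>\<close> as a zero of \<open>\<Delta>\<close> annihilate the root
  subspaces of all other eigenvalues and separate the points of the root subspace of \<open>\<nu>\<close>.\<close>

lemma coeff_other_chain:
  assumes y: "y \<in> chain \<nu>'" and ne: "\<nu>' \<noteq> \<nu>" and nd: "\<kappa> \<noteq> \<nu>'" "\<Delta> \<kappa> \<noteq> 0"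
    and v: "\<And>k. k < m \<Longrightarrow> taylor \<Delta> \<nu> k = 0" and k: "k < m"
  shows "taylor (\<lambda>\<mu>. u \<mu> y $ i) \<nu> k = 0"
proof -
  obtain Y K where Y: "Y 0 = y" "\<And>j. (Y j, Y (Suc j)) \<in> opm \<nu>'" "\<And>j. j \<ge> K \<Longrightarrow> Y j = 0" by (rule chainE[OF y]) blast
  show ?thesis
  proof (rule taylor_vanish_product[OF u_holomorphic[OF chain_L2[OF y]] \<Delta>_holomorphic])
    \<comment> \<open>The radius keeps the pole at \<open>\<nu>'\<close> outside the ball.\<close>
    show "(\<lambda>\<mu>. \<Sum>j<K. (- (Y j 0 $ i)) / (\<mu> - \<nu>') ^ Suc j) holomorphic_on ball \<nu> (dist \<nu> \<nu>')"
      by (intro holomorphic_intros) auto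
    show "dist \<nu> \<nu>' > 0" using ne by simp
    show "u w y $ i = \<Delta> w * (\<Sum>j<K. (- (Y j 0 $ i)) / (w - \<nu>') ^ Suc j)" if "w \<in> ball \<nu> (dist \<nu> \<nu>')" for w
      using u_chain[where Y = Y and K = K, OF Y(2,3) _ nd, where \<mu> = w and i = i] that by (auto simp: Y(1))
  qed (use v k in auto)
qed

lemma coeff_separate:
  assumes y: "y \<in> chain \<nu>" and nd: "\<kappa> \<noteq> \<nu>" "\<Delta> \<kappa> \<noteq> 0"
    and m: "taylor \<Delta> \<nu> m \<noteq> 0" "\<And>k. k < m \<Longrightarrow> taylor \<Delta> \<nu> k = 0"
    and z: "\<And>k i. k < m \<Longrightarrow> taylor (\<lambda>\<mu>. u \<mu> y $ i) \<nu> k = 0"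
  shows "y = 0"
proof -
  obtain Y K where Y: "Y 0 = y" "\<And>j. (Y j, Y (Suc j)) \<in> opm \<nu>" "\<And>j. j \<ge> K \<Longrightarrow> Y j = 0" by (rule chainE[OF y]) blast
  \<comment> \<open>The vanishing Taylor coefficients remove the pole of u / \<Delta>, so its
    principal part, made of the initial values of the chain, is zero.\<close>
  have "- (Y j 0 $ i) = 0" if "j < K" for j i
    by (rule principal_part_zero[OF u_holomorphic[OF chain_L2[OF y], of i] \<Delta>_holomorphic m z])
       (use u_chain[where Y = Y and K = K, OF Y(2,3) _ nd, where i = i] that Y(1) in auto)
  then have init: "Y j 0 = 0" for j using Y(3)[of j] by (cases "j < K") (auto simp: vec_eq_iff)
  \<comment> \<open>Downwards along the chain: if the next element is 0, this one solves the
    homogeneous equation with zero initial value. Once \<open>n\<close> reaches \<open>K\<close>,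
    truncated subtraction makes the step trivial.\<close>
  have "Y (K - n) = 0" for n
  proof (induction n)
    case 0 then show ?case using Y(3) by simp
  next
    case (Suc n)
    show ?case
    proof (cases "n < K")
      case True
      then have S: "Suc (K - Suc n) = K - n" by simp
      note op = opmD[OF Y(2)[of "K - Suc n"], unfolded S Suc]
      have "Y (K - Suc n) x = 0" for x
      proof (cases "x \<in> {0..1}")
        case True
        have "sol \<nu> (\<lambda>t. 0) (Y (K - Suc n))" using op(1) by (simp add: zero_fun_def)
        from sol_unique[OF this sol_zero _ L2_zero True] init show ?thesis by simp
      qed (rule op(4))
      then show ?thesis by (simp add: fun_eq_iff)
    next
      case False then show ?thesis using Suc by simp
    qed
  qed
  from this[of K] show ?thesis using Y(1) by simp
qed

text \<open>Linearity comes from uniqueness of solutions. The norm bound is Cauchy's estimate on the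
  unit circle about \<nu>, where \<open>sol_bound\<close> is uniform.\<close>

lemma coeff_bounded: "bounded_functional (\<lambda>f. taylor (\<lambda>\<mu>. u \<mu> f $ i) \<nu> k)"
  unfolding bounded_functional_def
proof (intro conjI ballI allI)
  fix f g :: "real \<Rightarrow> complex^'n" and c assume f: "f \<in> L2" and g: "g \<in> L2"
  have "u \<mu> (\<lambda>t. c *s f t + g t) = c *s u \<mu> f + u \<mu> g" for \<mu>
  proof -
    have "S \<mu> 0 (\<lambda>t. c *s f t + g t) 1 = c *s S \<mu> 0 f 1 + S \<mu> 0 g 1"
      using S_unique[OF L2_add[OF L2_cscale[OF f] g] sol_comb[OF S(1)[OF f] S(1)[OF g] f g], of 1 c \<mu> 0 0]
      by (simp add: S(2) f g)
    then show ?thesis by (simp add: u_def matrix_vector_right_distrib vec.scale)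
  qed
  \<comment> \<open>The two-term combination is written as a sum over booleans to fit
    \<open>taylor_lincomb\<close>.\<close>
  then have "(\<lambda>\<mu>. u \<mu> (\<lambda>t. c *s f t + g t) $ i) = (\<lambda>\<mu>. \<Sum>b\<in>UNIV. (if b then c else 1) * (if b then u \<mu> f $ i else u \<mu> g $ i))"
    by (simp add: UNIV_bool fun_eq_iff)
  moreover have "taylor (\<lambda>\<mu>. \<Sum>b\<in>UNIV. (if b then c else 1) * (if b then u \<mu> f $ i else u \<mu> g $ i)) \<nu> k
    = (\<Sum>b\<in>UNIV. (if b then c else 1) * taylor (\<lambda>\<mu>. if b then u \<mu> f $ i else u \<mu> g $ i) \<nu> k)"
    by (rule taylor_lincomb) (auto intro!: holomorphic_if u_holomorphic f g)
  ultimately show "taylor (\<lambda>\<mu>. u \<mu> (\<lambda>t. c *s f t + g t) $ i) \<nu> k = c * taylor (\<lambda>\<mu>. u \<mu> f $ i) \<nu> k + taylor (\<lambda>\<mu>. u \<mu> g $ i) \<nu> k"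
    by (simp add: UNIV_bool)
next
  have "exptype (\<lambda>\<mu>. adjm (Mm \<mu>))" by (intro exptype_vec exptype_adjm)
  then obtain A B where AB: "A \<ge> 0" "B \<ge> 0" "\<And>\<mu>. norm (adjm (Mm \<mu>)) \<le> A * exp (B * norm \<mu>)"
    unfolding exptype_def by blast
  define R where "R = norm \<nu> + 1"
  define X where "X = A * exp (B * R) * (norm D * (2 * exp (2 * growth * (1 + R)) * norm IA))"
  have X: "X \<ge> 0" using AB by (simp add: X_def)
  have "norm (taylor (\<lambda>\<mu>. u \<mu> f $ i) \<nu> k) \<le> X * L2norm f" if f: "f \<in> L2" for f
  proof (rule taylor_bound[OF u_holomorphic[OF f]])
    fix \<mu> assume "norm (\<mu> - \<nu>) = 1"
    then have \<mu>: "norm \<mu> \<le> R" using norm_triangle_ineq[of "\<mu> - \<nu>" \<nu>] by (simp add: R_def)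
    have "norm (S \<mu> 0 f 1) \<le> 2 * exp (2 * growth * (1 + norm \<mu>)) * (norm IA * L2norm f)"
      using S_bound[OF f, of 1 \<mu> 0] by simp
    also have "\<dots> \<le> 2 * exp (2 * growth * (1 + R)) * (norm IA * L2norm f)"
      using \<mu> growth_pos by (intro mult_right_mono mult_left_mono) auto
    finally have s: "norm (S \<mu> 0 f 1) \<le> 2 * exp (2 * growth * (1 + R)) * (norm IA * L2norm f)" .
    have "A * exp (B * norm \<mu>) \<le> A * exp (B * R)"
      using \<mu> AB by (intro mult_left_mono) (auto intro: mult_left_mono)
    then have ad: "norm (adjm (Mm \<mu>)) \<le> A * exp (B * R)" using AB(3)[of \<mu>] by linarith
    have "norm (u \<mu> f $ i) \<le> norm (u \<mu> f)" by (rule Finite_Cartesian_Product.norm_nth_le)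
    also have "\<dots> \<le> norm (adjm (Mm \<mu>)) * (norm D * norm (S \<mu> 0 f 1))"
      unfolding u_def norm_minus_cancel
      by (rule order_trans[OF norm_matrix_vector_le]) (intro mult_left_mono norm_matrix_vector_le norm_ge_zero)
    also have "\<dots> \<le> (A * exp (B * R)) * (norm D * (2 * exp (2 * growth * (1 + R)) * (norm IA * L2norm f)))"
      by (intro mult_mono ad s mult_nonneg_nonneg) (use AB in auto)
    also have "\<dots> = X * L2norm f" by (simp add: X_def mult_ac)
    finally show "norm (u \<mu> f $ i) \<le> X * L2norm f" .
  qed
  with X show "\<exists>B\<ge>0. \<forall>f\<in>L2. norm (taylor (\<lambda>\<mu>. u \<mu> f $ i) \<nu> k) \<le> B * L2norm f" by blast
qed

end

subsection \<open>Completeness and minimality\<close>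

context bvp
begin

text \<open>The solution with nonzero initial value is extended by zero, as membership in
  \<open>W12\<close> demands.\<close>

lemma eigenvalue_chain_nontrivial:
  assumes "\<Delta> \<mu> = 0" shows "\<mu> \<in> eigenvalues Bm C D Q"
proof -
  obtain y where y: "sol \<mu> (\<lambda>t. 0) y" "bc y = 0" "y 0 \<noteq> 0" by (rule eigenfunction_exists[OF assms]) blast
  define z where "z x = (if x \<in> {0..1} then y x else 0)" for x :: real
  have "(z, (\<lambda>t. 0)) \<in> opm \<mu>"
    by (rule opmI[OF sol_cong[OF y(1)]]) (use y(2) in \<open>auto simp: z_def\<close>)
  then have "z \<in> ker_pow Bm C D Q \<mu> 1" by (auto simp: ker_pow_def)
  moreover have "z \<noteq> 0" using y(3) by (auto simp: z_def fun_eq_iff intro!: exI[of _ 0])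
  ultimately show ?thesis unfolding eigenvalues_def by blast
qed

text \<open>The Taylor coefficients of \<open>U\<close> below the order of the zero form a chain of root functions.\<close>

lemma functional_kills_U:
  assumes f: "f \<in> L2" and nz: "\<Delta> \<kappa> \<noteq> 0" and l: "bounded_functional l"
    and kill: "\<And>\<nu> y. \<Delta> \<nu> = 0 \<Longrightarrow> y \<in> chain \<nu> \<Longrightarrow> l y = 0"
    and v: "\<And>k. k < m \<Longrightarrow> taylor \<Delta> \<nu> k = 0" and k: "k < m"
  shows "taylor (\<lambda>\<mu>. l (U \<mu> f)) \<nu> k = 0"
proof -
  obtain p where p: "sol \<nu> (\<lambda>t. taylor \<Delta> \<nu> 0 *s f t) (p 0)"
      "\<And>k. sol \<nu> (\<lambda>t. p k t + taylor \<Delta> \<nu> (Suc k) *s f t) (p (Suc k))"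
      "\<And>k x i. x \<in> {0..1} \<Longrightarrow> p k x $ i = taylor (\<lambda>\<mu>. U \<mu> f x $ i) \<nu> k"
      "\<And>l k. bounded_functional l \<Longrightarrow> l (p k) = taylor (\<lambda>\<mu>. l (U \<mu> f)) \<nu> k"
    using sol_functional_analytic(3)[OF f u_holomorphic[OF f] \<Delta>_holomorphic U_sol(1)[OF f] U_sol(2)[OF f], of \<nu>] by blast
  have pbc: "bc (p k) = 0" for k
  proof -
    have h: "(\<lambda>\<mu>. U \<mu> f x $ i) holomorphic_on UNIV" if "x \<in> {0..1}" for x i
      by (rule sol_functional_analytic(1)[OF f u_holomorphic[OF f] \<Delta>_holomorphic U_sol(1)[OF f] U_sol(2)[OF f] that])
    have "bc (p k) $ i = 0" for i
    proof -
      \<comment> \<open>Both endpoints and all components are merged into one index set, so that the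
        boundary form is a single linear combination for \<open>taylor_lincomb\<close>.\<close>
      define E where "E = (\<lambda>b::bool. if b then C else D)"
      define x where "x = (\<lambda>b::bool. if b then 0 else 1 :: real)"
      have x: "x b \<in> {0..1}" for b by (simp add: x_def)
      have bcs: "bc y $ i = (\<Sum>s\<in>UNIV. E (fst s) $ i $ snd s * y (x (fst s)) $ snd s)" for y
      proof -
        have "(\<Sum>s\<in>UNIV. E (fst s) $ i $ snd s * y (x (fst s)) $ snd s)
          = (\<Sum>b\<in>UNIV. \<Sum>j\<in>UNIV. E b $ i $ j * y (x b) $ j)"
          unfolding UNIV_Times_UNIV[symmetric] sum.cartesian_product by (simp add: case_prod_unfold)
        then show ?thesis by (simp add: UNIV_bool E_def x_def matrix_vector_mult_def add.commute)
      qed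
      have "bc (p k) $ i = (\<Sum>s\<in>UNIV. E (fst s) $ i $ snd s * taylor (\<lambda>\<mu>. U \<mu> f (x (fst s)) $ snd s) \<nu> k)"
        unfolding bcs by (simp add: p(3)[OF x])
      also have "\<dots> = taylor (\<lambda>\<mu>. \<Sum>s\<in>UNIV. E (fst s) $ i $ snd s * U \<mu> f (x (fst s)) $ snd s) \<nu> k"
        by (rule taylor_lincomb[symmetric]) (rule h[OF x])
      also have "(\<lambda>\<mu>. \<Sum>s\<in>UNIV. E (fst s) $ i $ snd s * U \<mu> f (x (fst s)) $ snd s) = (\<lambda>\<mu>. 0)"
        unfolding bcs[symmetric] U_bc[OF f nz] by simp
      also have "taylor (\<lambda>\<mu>. 0) \<nu> k = 0"
        using taylor_lincomb[of "{}" undefined undefined \<nu> k] by simp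
      finally show ?thesis .
    qed
    then show ?thesis by (simp add: vec_eq_iff)
  qed
  define q where "q k x = (if x \<in> {0..1} then p k x else 0)" for k and x :: real
  \<comment> \<open>The coefficients are traversed downwards, because L - \<nu> takes each to its
    predecessor: below the order of the zero the \<Delta> terms of the recursion are absent.\<close>
  define Y where "Y j = (if j \<le> k then q (k - j) else 0)" for j
  have q_sol: "(q j, (if j = 0 then 0 else q (j - 1))) \<in> opm \<nu>" if "j \<le> k" for j
  proof (cases j)
    case 0
    have "taylor \<Delta> \<nu> 0 = 0" using v k by simp
    then have "sol \<nu> (\<lambda>t. 0) (p 0)" using p(1) by simp
    then have "(q 0, (\<lambda>t. 0)) \<in> opm \<nu>"
      by (intro opmI[OF sol_cong]) (use pbc[of 0] in \<open>auto simp: q_def\<close>)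
    then show ?thesis using 0 by (simp add: zero_fun_def)
  next
    case (Suc i)
    have "taylor \<Delta> \<nu> (Suc i) = 0" using v k that Suc by simp
    then have s: "sol \<nu> (p i) (p (Suc i))" using p(2)[of i] by simp
    have "continuous_on {0..1} (p i)" by (cases i) (use p(1,2) in \<open>auto intro: sol_continuous\<close>)
    then have "continuous_on {0..1} (q i)" by (rule continuous_on_eq) (simp add: q_def)
    then have "q i \<in> L2" by (rule L2_continuous)
    then have "(q (Suc i), q i) \<in> opm \<nu>"
      by (intro opmI[OF sol_cong[OF s]]) (use pbc[of "Suc i"] in \<open>auto simp: q_def\<close>)
    then show ?thesis using Suc by simp
  qed
  have "(Y j, Y (Suc j)) \<in> opm \<nu>" for j
  proof (cases "j \<le> k")
    case True
    then show ?thesis using q_sol[of "k - j"] by (cases "j = k") (auto simp: Y_def)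
  next
    case False
    then show ?thesis using opm_zero by (simp add: Y_def)
  qed
  moreover have "\<forall>j\<ge>Suc k. Y j = 0" by (simp add: Y_def)
  ultimately have ch: "Y 0 \<in> chain \<nu>" unfolding chain_def by blast
  have "\<Delta> \<nu> = 0"
  proof -
    have "taylor \<Delta> \<nu> 0 = 0" using v k by simp
    then show ?thesis by (simp add: taylor_def)
  qed
  then have "l (q k) = 0" using kill ch by (simp add: Y_def)
  moreover have "l (p k) = l (q k)"
  proof (rule bounded_functional_cong[OF l])
    show "p k \<in> L2" by (cases k) (use p(1,2) in \<open>auto intro: sol_L2\<close>)
    show "q k \<in> L2" using chain_L2[OF ch] by (simp add: Y_def)
  qed (simp add: q_def)
  ultimately show ?thesis using p(4)[OF l] by metis
qed

definition good_ray :: "complex \<Rightarrow> bool"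
  where "good_ray \<omega> \<longleftrightarrow> (\<exists>t0 K. t0 > 0 \<and> K \<ge> 0 \<and> (\<forall>t f y x. t \<ge> t0 \<longrightarrow> f \<in> L2 \<longrightarrow> sol (of_real t * \<omega>) f y \<longrightarrow> bc y = 0 \<longrightarrow> x \<in> {0..1}
    \<longrightarrow> norm (y x) \<le> K * L2norm f / sqrt t))"

text \<open>A zero of \<Delta> would give an eigenfunction with nonzero initial value, contradicting
  the estimate with \<open>f = 0\<close>.\<close>

lemma good_ray_nonzero:
  assumes "good_ray \<omega>" obtains t0 where "t0 > 0" "\<And>t. t \<ge> t0 \<Longrightarrow> \<Delta> (of_real t * \<omega>) \<noteq> 0"
proof -
  obtain t0 K where t0: "t0 > 0" and K: "\<And>t f y x. t \<ge> t0 \<Longrightarrow> f \<in> L2 \<Longrightarrow> sol (of_real t * \<omega>) f y \<Longrightarrow> bc y = 0 \<Longrightarrow> x \<in> {0..1}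
    \<Longrightarrow> norm (y x) \<le> K * L2norm f / sqrt t" using assms unfolding good_ray_def by blast
  have "\<Delta> (of_real t * \<omega>) \<noteq> 0" if "t \<ge> t0" for t
  proof
    assume "\<Delta> (of_real t * \<omega>) = 0"
    then obtain y where y: "sol (of_real t * \<omega>) (\<lambda>t. 0) y" "bc y = 0" "y 0 \<noteq> 0" by (rule eigenfunction_exists) blast
    from K[OF that L2_zero y(1,2), of 0] y(3) show False by simp
  qed
  then show ?thesis by (rule that[OF t0])
qed

text \<open>Once \<open>l\<close> vanishes on all values of \<open>U\<close>, it vanishes on the
  domain: with g the image of y under L - \<kappa>, \<open>U \<kappa> g\<close> is the nonzero
  multiple \<open>\<Delta> \<kappa>\<close> of y. Density then gives l = 0.\<close>

lemma functional_zero: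
  assumes int: "0 \<in> interior (convex hull {\<omega>1, \<omega>2, \<omega>3})" and ray: "\<And>\<omega>. \<omega> \<in> {\<omega>1, \<omega>2, \<omega>3} \<Longrightarrow> good_ray \<omega>"
    and l: "bounded_functional l" and kill: "\<And>\<nu> y. \<Delta> \<nu> = 0 \<Longrightarrow> y \<in> chain \<nu> \<Longrightarrow> l y = 0"
    and h: "h \<in> L2"
  shows "l h = 0"
proof -
  have "good_ray \<omega>1" by (rule ray) simp
  then obtain t1 where t1: "t1 > 0" "\<And>t. t \<ge> t1 \<Longrightarrow> \<Delta> (of_real t * \<omega>1) \<noteq> 0" by (rule good_ray_nonzero) blast
  define \<kappa> where "\<kappa> = of_real t1 * \<omega>1"
  have \<kappa>: "\<Delta> \<kappa> \<noteq> 0" using t1(2)[of t1] by (simp add: \<kappa>_def)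
  obtain B where B: "B \<ge> 0" "\<And>f. f \<in> L2 \<Longrightarrow> norm (l f) \<le> B * L2norm f"
    using l unfolding bounded_functional_def by blast
  have lU: "l (U \<mu> f) = 0" if f: "f \<in> L2" for \<mu> f
  proof -
    define N where "N \<mu> = l (U \<mu> f)" for \<mu>
    have N: "N holomorphic_on UNIV" unfolding N_def
      by (rule sol_functional_analytic(2)[OF f u_holomorphic[OF f] \<Delta>_holomorphic U_sol(1)[OF f] U_sol(2)[OF f] l])
    obtain F where F: "F holomorphic_on UNIV" "\<And>w. N w = F w * \<Delta> w"
    proof (rule entire_quotient[OF N \<Delta>_holomorphic \<kappa>])
      show "taylor N z k = 0" if "\<And>k. k < m \<Longrightarrow> taylor \<Delta> z k = 0" "k < m" for z m k
        using functional_kills_U[OF f \<kappa> l kill that] by (simp add: N_def[abs_def])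
    qed blast
    have "exptype N"
    proof (rule exptype_mult_norm[OF exptype_const[of B] exptype_U[OF f]])
      show "norm (N \<mu>) \<le> norm B * norm (L2norm (U \<mu> f))" for \<mu>
        using B(2)[OF sol_L2[OF U_sol(1)[OF f]], of \<mu>] B(1) by (simp add: N_def)
    qed
    then obtain A1 B1 where 1: "A1 \<ge> 0" "B1 \<ge> 0" "\<And>\<mu>. norm (N \<mu>) \<le> A1 * exp (B1 * norm \<mu>)"
      unfolding exptype_def by blast
    obtain A2 B2 where 2: "A2 \<ge> 0" "B2 \<ge> 0" "\<And>\<mu>. norm (\<Delta> \<mu>) \<le> A2 * exp (B2 * norm \<mu>)"
      using exptype_\<Delta> unfolding exptype_def by blast
    \<comment> \<open>Common constants for numerator and denominator; the 1 makes the factor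
      positive.\<close>
    define A0 B0 where "A0 = A1 + A2 + 1" and "B0 = B1 + B2"
    have up: "a' * exp (b' * norm \<mu>) \<le> A0 * exp (B0 * norm \<mu>)" if "0 \<le> a'" "a' \<le> A0" "b' \<le> B0" for a' b' and \<mu> :: complex
      using that by (intro mult_mono) (auto intro: mult_right_mono)
    obtain A' B' where AB: "A' \<ge> 0" "B' \<ge> 0" "\<And>z. norm (F z) \<le> A' * exp (B' * norm z)"
    proof (rule quotient_exponential_type[OF F(1) \<Delta>_holomorphic \<kappa>])
      show "A0 > 0" "B0 \<ge> 0" using 1 2 by (auto simp: A0_def B0_def)
      show "norm (\<Delta> z) \<le> A0 * exp (B0 * norm z)" for z
        by (rule order_trans[OF 2(3) up]) (use 1 2 in \<open>auto simp: A0_def B0_def\<close>)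
      show "norm (F z * \<Delta> z) \<le> A0 * exp (B0 * norm z)" for z
        unfolding F(2)[symmetric] by (rule order_trans[OF 1(3) up]) (use 1 2 in \<open>auto simp: A0_def B0_def\<close>)
    qed blast
    have "F z = 0" for z
    proof (rule exponential_type_three_rays[OF F(1) int AB(3,2)])
      fix \<omega> assume "\<omega> \<in> {\<omega>1, \<omega>2, \<omega>3}"
      then have gr: "good_ray \<omega>" by (rule ray)
      obtain t0 K where t0: "t0 > 0" and K: "K \<ge> 0" "\<And>t f y x. t \<ge> t0 \<Longrightarrow> f \<in> L2 \<Longrightarrow> sol (of_real t * \<omega>) f y \<Longrightarrow> bc y = 0 \<Longrightarrow> x \<in> {0..1}
        \<Longrightarrow> norm (y x) \<le> K * L2norm f / sqrt t" using gr unfolding good_ray_def by blast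
      obtain t2 where t2: "t2 > 0" "\<And>t. t \<ge> t2 \<Longrightarrow> \<Delta> (of_real t * \<omega>) \<noteq> 0" by (rule good_ray_nonzero[OF gr]) blast
      have bound: "norm (F (of_real t * \<omega>)) \<le> B * (K * L2norm f) / sqrt t" if t: "t \<ge> max t0 t2" for t
      proof -
        let ?\<mu> = "of_real t * \<omega>"
        have nz: "\<Delta> ?\<mu> \<noteq> 0" using t2(2)[of t] t by simp
        \<comment> \<open>The true resolvent at the ray point, to which the ray estimate applies;
          \<open>l y\<close> is the value of \<open>F\<close>.\<close>
        define y where "y = (\<lambda>x. inverse (\<Delta> ?\<mu>) *s U ?\<mu> f x)"
        have "sol ?\<mu> (\<lambda>x. inverse (\<Delta> ?\<mu>) *s (\<Delta> ?\<mu> *s f x)) y"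
          unfolding y_def by (rule sol_scale[OF U_sol(1)[OF f] L2_cscale[OF f]])
        then have ys: "sol ?\<mu> f y" using nz by simp
        have "bc y = inverse (\<Delta> ?\<mu>) *s bc (U ?\<mu> f)"
          by (simp add: y_def vec.scale vec.scale_right_distrib)
        then have "bc y = 0" using U_bc[OF f nz] by simp
        then have yb: "norm (y x) \<le> K * L2norm f / sqrt t" if "x \<in> {0..1}" for x
          using K(2)[OF _ f ys _ that] t by simp
        have yL: "y \<in> L2" by (rule sol_L2[OF ys])
        have "L2norm y \<le> K * L2norm f / sqrt t"
          by (rule L2norm_le_const[OF L2D(1)[OF yL] yb]) (use K(1) t t0 in auto)
        then have ly: "norm (l y) \<le> B * (K * L2norm f / sqrt t)"
          using order_trans[OF B(2)[OF yL] mult_left_mono[OF _ B(1)]] by blast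
        have "l (\<lambda>x. inverse (\<Delta> ?\<mu>) *s U ?\<mu> f x + 0) = inverse (\<Delta> ?\<mu>) * l (U ?\<mu> f) + l (\<lambda>x. 0)"
          by (rule bounded_functional_lin[OF l sol_L2[OF U_sol(1)[OF f]] L2_zero])
        moreover have "l (\<lambda>x. 0) = 0" using B(2)[OF L2_zero] by simp
        ultimately have "l y = inverse (\<Delta> ?\<mu>) * N ?\<mu>" by (simp add: y_def N_def)
        also have "\<dots> = F ?\<mu>" using F(2)[of ?\<mu>] nz by simp
        finally show ?thesis using ly by simp
      qed
      show "((\<lambda>t. F (of_real t * \<omega>)) \<longlongrightarrow> 0) at_top"
      proof (rule Lim_null_comparison)
        show "eventually (\<lambda>t. norm (F (of_real t * \<omega>)) \<le> B * (K * L2norm f) / sqrt t) at_top"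
          unfolding eventually_at_top_linorder by (intro exI[of _ "max t0 t2"] allI impI bound)
        show "((\<lambda>t. B * (K * L2norm f) / sqrt t) \<longlongrightarrow> 0) at_top"
          by (intro tendsto_divide_0[OF tendsto_const] filterlim_at_top_imp_at_infinity sqrt_at_top)
      qed
    qed
    then show ?thesis using F(2)[of \<mu>] by (simp add: N_def)
  qed
  have "norm (l h) \<le> e" if e: "e > 0" for e
  proof -
    have "e / (B + 1) > 0" using e B(1) by simp
    then obtain y g where y: "g \<in> L2" "sol \<kappa> g y" "y 0 = 0" "y 1 = 0" "L2norm (\<lambda>x. h x - y x) < e / (B + 1)"
      by (rule domain_dense[OF h]) blast
    have yL: "y \<in> L2" by (rule sol_L2[OF y(2)])
    have "bc y = 0" using y by simp
    then have Uy: "U \<kappa> g x = \<Delta> \<kappa> *s y x" if "x \<in> {0..1}" for x by (rule U_unique[OF y(2) _ y(1) \<kappa> that])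
    have "l (U \<kappa> g) = l (\<lambda>x. \<Delta> \<kappa> *s y x)"
      by (rule bounded_functional_cong[OF l sol_L2[OF U_sol(1)[OF y(1)]] L2_cscale[OF yL] Uy])
    then have "l (\<lambda>x. \<Delta> \<kappa> *s y x) = 0" using lU[OF y(1)] by simp
    moreover have "l (\<lambda>x. \<Delta> \<kappa> *s y x + 0) = \<Delta> \<kappa> * l y + l (\<lambda>x. 0)"
      by (rule bounded_functional_lin[OF l yL L2_zero])
    moreover have "l (\<lambda>x. 0) = 0" using B(2)[OF L2_zero] by simp
    ultimately have "l y = 0" using \<kappa> by simp
    then have "norm (l h) = norm (l (\<lambda>x. h x - y x))" using bounded_functional_diff[OF l h yL] by simp
    also have "\<dots> \<le> B * L2norm (\<lambda>x. h x - y x)" by (rule B(2)[OF L2_diff[OF h yL]])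
    also have "\<dots> \<le> (B + 1) * (e / (B + 1))" using y(5) B(1) by (intro mult_mono) auto
    finally show ?thesis using B(1) by simp
  qed
  then have "norm (l h) \<le> 0" by (rule field_le_epsilon[of _ 0, simplified])
  then show ?thesis by simp
qed

lemma root_function_system_closed_linear:
  assumes "root_function_system Bm C D Q \<Phi>"
  shows "\<Phi> \<subseteq> L2" "\<And>f g c. f \<in> cfun.span \<Phi> \<Longrightarrow> g \<in> cfun.span \<Phi> \<Longrightarrow> (\<lambda>t. c *s f t + g t) \<in> cfun.span \<Phi>"
    "cfun.span \<Phi> \<subseteq> L2"
proof -
  obtain \<beta> where \<beta>: "\<And>\<mu>. \<mu> \<in> eigenvalues Bm C D Q \<Longrightarrow> cfun.span (\<beta> \<mu>) = chain \<mu>"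
    "\<Phi> = (\<Union>\<mu>\<in>eigenvalues Bm C D Q. \<beta> \<mu>)"
    using assms unfolding root_function_system_def root_subspace_eq by blast
  show 1: "\<Phi> \<subseteq> L2" using \<beta> cfun.span_superset chain_L2 by blast
  have eq: "(\<lambda>t. c *s f t + g t) = cscale c f + g" for c f and g :: "real \<Rightarrow> complex^'n"
    by (simp add: cscale_def fun_eq_iff)
  show "(\<lambda>t. c *s f t + g t) \<in> cfun.span \<Phi>" if "f \<in> cfun.span \<Phi>" "g \<in> cfun.span \<Phi>" for f g c
    unfolding eq by (intro cfun.span_add cfun.span_scale that)
  have "cfun.subspace (L2 :: (real \<Rightarrow> complex^'n) set)"
  proof (rule cfun.subspaceI)
    show "(0 :: real \<Rightarrow> complex^'n) \<in> L2" using L2_zero by (simp add: zero_fun_def)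
    show "f + g \<in> L2" if "f \<in> L2" "g \<in> L2" for f g :: "real \<Rightarrow> complex^'n"
      using L2_add[OF that] by (simp add: plus_fun_def)
    show "cscale c f \<in> L2" if "f \<in> L2" for c and f :: "real \<Rightarrow> complex^'n"
      using L2_cscale[OF that] by (simp add: cscale_def)
  qed
  then show "cfun.span \<Phi> \<subseteq> L2" using 1 by (simp add: cfun.span_minimal)
qed

theorem root_functions_complete:
  assumes int: "0 \<in> interior (convex hull {\<omega>1, \<omega>2, \<omega>3})" and ray: "\<And>\<omega>. \<omega> \<in> {\<omega>1, \<omega>2, \<omega>3} \<Longrightarrow> good_ray \<omega>"
    and \<Phi>: "root_function_system Bm C D Q \<Phi>"
  shows "complete_system \<Phi>"
proof -
  note lin = root_function_system_closed_linear[OF \<Phi>]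
  obtain \<beta> where \<beta>: "\<And>\<mu>. \<mu> \<in> eigenvalues Bm C D Q \<Longrightarrow> cfun.span (\<beta> \<mu>) = chain \<mu>"
    "\<Phi> = (\<Union>\<mu>\<in>eigenvalues Bm C D Q. \<beta> \<mu>)"
    using \<Phi> unfolding root_function_system_def root_subspace_eq by blast
  have ch: "chain \<nu> \<subseteq> cfun.span \<Phi>" if "\<Delta> \<nu> = 0" for \<nu>
  proof -
    have \<nu>: "\<nu> \<in> eigenvalues Bm C D Q" by (rule eigenvalue_chain_nontrivial[OF that])
    then have "\<beta> \<nu> \<subseteq> \<Phi>" using \<beta>(2) by blast
    then show ?thesis using \<beta>(1)[OF \<nu>] cfun.span_mono by metis
  qed
  have "\<exists>g\<in>cfun.span \<Phi>. L2norm (f - g) < e" if f: "f \<in> L2" and e: "e > 0" for f e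
  proof (rule ccontr)
    assume "\<not> ?thesis"
    then have far: "L2norm (\<lambda>t. f t - g t) \<ge> e" if "g \<in> cfun.span \<Phi>" for g
      using that by (auto simp: fun_diff_def not_less)
    have z: "(\<lambda>t. 0) \<in> cfun.span \<Phi>" using cfun.span_zero[of \<Phi>] by (simp add: zero_fun_def)
    obtain l where l: "bounded_functional l" "\<And>g. g \<in> cfun.span \<Phi> \<Longrightarrow> l g = 0" "l f \<noteq> 0"
      by (rule separating_functional[OF lin(3) z _ f e]) (use lin(2) far in blast)+
    have "l f = 0" by (rule functional_zero[OF int ray l(1) _ f]) (use l(2) ch in blast)+
    with l(3) show False by simp
  qed
  then show ?thesis unfolding complete_system_def L2_closure_def by blast
qed

text \<open>The coordinate functional of \<phi> in its root subspace vanishes on the common kernel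
  of the coefficient functionals, so it is a combination of them. This combination is bounded on L2,
  is 1 at \<phi> and 0 at all other members, which keeps \<phi> away from their closed span.\<close>

theorem root_functions_minimal:
  assumes nd: "\<And>R. \<exists>\<kappa>. norm \<kappa> > R \<and> \<Delta> \<kappa> \<noteq> 0"
    and \<Phi>: "root_function_system Bm C D Q \<Phi>"
  shows "minimal_system \<Phi>"
  unfolding minimal_system_def
proof (intro ballI notI)
  fix \<phi> assume \<phi>: "\<phi> \<in> \<Phi>" and cl: "\<phi> \<in> L2_closure (cfun.span (\<Phi> - {\<phi>}))"
  note lin = root_function_system_closed_linear[OF \<Phi>]
  obtain \<beta> where \<beta>: "\<And>\<mu>. \<mu> \<in> eigenvalues Bm C D Q \<Longrightarrow> cfun.independent (\<beta> \<mu>)"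
    "\<And>\<mu>. \<mu> \<in> eigenvalues Bm C D Q \<Longrightarrow> cfun.span (\<beta> \<mu>) = chain \<mu>"
    "\<Phi> = (\<Union>\<mu>\<in>eigenvalues Bm C D Q. \<beta> \<mu>)"
    using \<Phi> unfolding root_function_system_def root_subspace_eq by blast
  obtain \<nu> where \<nu>: "\<nu> \<in> eigenvalues Bm C D Q" "\<phi> \<in> \<beta> \<nu>" using \<phi> \<beta>(3) by blast
  \<comment> \<open>Gives the point different from the eigenvalue that continuation on the punctured
    plane starts from.\<close>
  have nd': "\<exists>\<kappa>. \<kappa> \<noteq> z \<and> \<Delta> \<kappa> \<noteq> 0" for z using nd[of "norm z"] by auto
  obtain \<kappa>0 where "\<Delta> \<kappa>0 \<noteq> 0" using nd by blast
  then obtain m where m: "taylor \<Delta> \<nu> m \<noteq> 0" "\<And>k. k < m \<Longrightarrow> taylor \<Delta> \<nu> k = 0"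
    by (rule taylor_order[OF \<Delta>_holomorphic, where z = \<nu>]) blast
  define c where "c s f = taylor (\<lambda>\<mu>. u \<mu> f $ snd s) \<nu> (fst s)" for s :: "nat \<times> 'n" and f
  define I where "I = {..<m} \<times> (UNIV :: 'n set)"
  have cb: "bounded_functional (c s)" for s unfolding c_def by (rule coeff_bounded)
  have eq: "cscale z f + g = (\<lambda>t. z *s f t + g t)" for z f and g :: "real \<Rightarrow> complex^'n"
    by (simp add: cscale_def fun_eq_iff)
  define \<theta> where "\<theta> f = cfun.representation (\<beta> \<nu>) f \<phi>" for f
  note ind = \<beta>(1)[OF \<nu>(1)] and sp = \<beta>(2)[OF \<nu>(1)]
  have "\<exists>\<alpha>. \<forall>f\<in>chain \<nu>. \<theta> f = (\<Sum>s\<in>I. \<alpha> s * c s f)"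
  proof (rule cfun.linear_functional_combination)
    show "finite I" by (simp add: I_def)
    show "cfun.subspace (chain \<nu>)" by (rule chain_subspace)
    show "c s (cscale z f + g) = z * c s f + c s g" if "f \<in> chain \<nu>" "g \<in> chain \<nu>" for s f g z
      unfolding eq by (rule bounded_functional_lin[OF cb chain_L2[OF that(1)] chain_L2[OF that(2)]])
    show "\<theta> (cscale z f + g) = z * \<theta> f + \<theta> g" if "f \<in> chain \<nu>" "g \<in> chain \<nu>" for f g z
      using that unfolding sp[symmetric] \<theta>_def
      by (simp add: cfun.representation_add[OF ind] cfun.representation_scale[OF ind] cfun.span_scale)
    show "\<theta> f = 0" if f: "f \<in> chain \<nu>" and z: "\<And>s. s \<in> I \<Longrightarrow> c s f = 0" for f
    proof -
      obtain \<kappa> where "\<kappa> \<noteq> \<nu>" "\<Delta> \<kappa> \<noteq> 0" using nd' by blast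
      then have "f = 0" by (rule coeff_separate[OF f _ _ m]) (use z in \<open>auto simp: c_def I_def\<close>)
      then show ?thesis by (simp add: \<theta>_def cfun.representation_zero)
    qed
  qed
  then obtain \<alpha> where \<alpha>: "\<And>f. f \<in> chain \<nu> \<Longrightarrow> \<theta> f = (\<Sum>s\<in>I. \<alpha> s * c s f)" by blast
  define l where "l f = (\<Sum>s\<in>I. \<alpha> s * c s f)" for f
  have l: "bounded_functional l"
    unfolding bounded_functional_def
  proof (intro conjI ballI allI)
    show "l (\<lambda>t. z *s f t + g t) = z * l f + l g" if "f \<in> L2" "g \<in> L2" for f g z
      unfolding l_def bounded_functional_lin[OF cb that]
      by (simp add: sum_distrib_left sum.distrib algebra_simps)
    have "\<exists>B\<ge>0. \<forall>f\<in>L2. norm (c s f) \<le> B * L2norm f" for s using cb[of s] unfolding bounded_functional_def by blast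
    then obtain B where B: "\<And>s. B s \<ge> 0" "\<And>s f. f \<in> L2 \<Longrightarrow> norm (c s f) \<le> B s * L2norm f" by metis
    have "norm (l f) \<le> (\<Sum>s\<in>I. norm (\<alpha> s) * B s) * L2norm f" if "f \<in> L2" for f
    proof -
      have "norm (l f) \<le> (\<Sum>s\<in>I. norm (\<alpha> s) * (B s * L2norm f))"
        unfolding l_def by (rule sum_norm_le) (auto simp: norm_mult intro!: mult_left_mono B that)
      then show ?thesis by (simp add: sum_distrib_right mult.assoc)
    qed
    then show "\<exists>B\<ge>0. \<forall>f\<in>L2. norm (l f) \<le> B * L2norm f"
      using B(1) by (intro exI[of _ "\<Sum>s\<in>I. norm (\<alpha> s) * B s"]) (auto intro: sum_nonneg)
  qed
  have in_chain: "f \<in> chain \<mu>" if "f \<in> \<beta> \<mu>" "\<mu> \<in> eigenvalues Bm C D Q" for f \<mu>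
    using that \<beta>(2) cfun.span_base by blast
  have l\<phi>: "l \<phi> = 1"
    using \<alpha>[OF in_chain[OF \<nu>(2,1)]] cfun.representation_basis[OF ind \<nu>(2)] by (simp add: l_def \<theta>_def)
  have lz: "l f = 0" if f: "f \<in> \<Phi> - {\<phi>}" for f
  proof -
    obtain \<nu>' where \<nu>': "\<nu>' \<in> eigenvalues Bm C D Q" "f \<in> \<beta> \<nu>'" using f \<beta>(3) by blast
    show ?thesis
    proof (cases "\<nu>' = \<nu>")
      case True
      then show ?thesis
        using \<alpha>[OF in_chain[OF \<nu>'(2,1)[unfolded True]]] cfun.representation_basis[OF ind, of f] \<nu>' f
        by (auto simp: l_def \<theta>_def)
    next
      case False
      obtain \<kappa> where \<kappa>: "\<kappa> \<noteq> \<nu>'" "\<Delta> \<kappa> \<noteq> 0" using nd' by blast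
      have "c s f = 0" if "s \<in> I" for s
        unfolding c_def by (rule coeff_other_chain[OF in_chain[OF \<nu>'(2,1)] False \<kappa> m(2)]) (use that in \<open>auto simp: I_def\<close>)
      then show ?thesis by (simp add: l_def)
    qed
  qed
  have l0: "l 0 = 0"
  proof -
    obtain B where "\<And>f. f \<in> L2 \<Longrightarrow> norm (l f) \<le> B * L2norm f" using l unfolding bounded_functional_def by blast
    from this[OF L2_zero] show ?thesis by (simp add: zero_fun_def)
  qed
  have "l g = 0 \<and> g \<in> L2" if "g \<in> cfun.span (\<Phi> - {\<phi>})" for g
    using that
  proof (induction rule: cfun.span_induct_alt)
    case base
    show ?case using l0 L2_zero by (simp add: zero_fun_def)
  next
    case (step z f g)
    have f: "f \<in> L2" using step(1) lin(1) by blast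
    show ?case unfolding eq
      using bounded_functional_lin[OF l f, of g z] step lz[OF step(1)] f by (auto intro: L2_add L2_cscale)
  qed
  then have span: "l g = 0" "g \<in> L2" if "g \<in> cfun.span (\<Phi> - {\<phi>})" for g using that by auto
  obtain B where B: "B \<ge> 0" "\<And>f. f \<in> L2 \<Longrightarrow> norm (l f) \<le> B * L2norm f" using l unfolding bounded_functional_def by blast
  have \<phi>L: "\<phi> \<in> L2" using \<phi> lin(1) by blast
  \<comment> \<open>An approximation this good would make |l \<phi>| at most B / (B + 1) <
    1.\<close>
  have "1 / (B + 1) > 0" using B(1) by simp
  then obtain g where g: "g \<in> cfun.span (\<Phi> - {\<phi>})" "L2norm (\<phi> - g) < 1 / (B + 1)"
    using cl unfolding L2_closure_def by blast
  have "1 = norm (l \<phi> - l g)" using l\<phi> span(1)[OF g(1)] by simp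
  also have "\<dots> = norm (l (\<lambda>t. \<phi> t - g t))" by (simp only: bounded_functional_diff[OF l \<phi>L span(2)[OF g(1)]])
  also have "\<dots> \<le> B * L2norm (\<phi> - g)"
    using B(2)[OF L2_diff[OF \<phi>L span(2)[OF g(1)]]] by (simp add: fun_diff_def)
  also have "\<dots> \<le> B * (1 / (B + 1))" using g(2) B(1) by (intro mult_left_mono) auto
  also have "\<dots> < 1" using B(1) by simp
  finally show False by simp
qed

end

section \<open>Rays supplied by weak regularity\<close>

context bvp
begin

text \<open>Since z / a = z cnj(a) / |a|^2, the growth rate along the ray has the sign opposite to
  the diagonal entry of zB. Hence \<open>T_mat\<close> takes a column of C exactly for the modes
  that decay away from 0.\<close>

lemma good_ray_of_T_mat:
  assumes nz: "\<And>k. Re (map_matrix ((*) z) Bm $ k $ k) \<noteq> 0" and det: "det (T_mat (map_matrix ((*) z) Bm) C D) \<noteq> 0"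
  shows "good_ray (\<i> * cnj z)"
proof -
  have entry: "map_matrix ((*) z) Bm $ k $ k = z * inverse (a k)" for k
    by (simp add: map_matrix_def diag_mat_def)
  have eq: "Re (\<i> * cnj z * (\<i> * a k)) = - (cmod (a k))\<^sup>2 * Re (z * inverse (a k))" for k
  proof -
    have "Re (\<i> * cnj z * (\<i> * a k)) = - Re (cnj z * a k)" by simp
    also have "Re (cnj z * a k) = Re (z * cnj (a k))" by simp
    also have "z * cnj (a k) = of_real ((cmod (a k))\<^sup>2) * (z * inverse (a k))"
      unfolding complex_norm_square using a_nz[of k] by (simp add: field_simps)
    also have "Re \<dots> = (cmod (a k))\<^sup>2 * Re (z * inverse (a k))" by (simp only: times_complex.sel Re_complex_of_real Im_complex_of_real mult_zero_left diff_zero)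
    finally show ?thesis by simp
  qed
  define \<delta> where "\<delta> = Min (range (\<lambda>k. \<bar>Re (\<i> * cnj z * (\<i> * a k))\<bar>))"
  have "\<bar>Re (\<i> * cnj z * (\<i> * a k))\<bar> > 0" for k
    using nz[of k] a_nz[of k] unfolding eq entry by simp
  then have "\<delta> > 0" unfolding \<delta>_def by (subst Min_gr_iff) auto
  moreover have "\<bar>Re (\<i> * cnj z * (\<i> * a k))\<bar> \<ge> \<delta>" for k unfolding \<delta>_def by (rule Min_le) auto
  moreover have "T_mat (map_matrix ((*) z) Bm) C D = (\<chi> i k. if Re (\<i> * cnj z * (\<i> * a k)) < 0 then C $ i $ k else D $ i $ k)"
  proof -
    have "Re (\<i> * cnj z * (\<i> * a k)) < 0 \<longleftrightarrow> Re (map_matrix ((*) z) Bm $ k $ k) > 0" for k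
      using a_nz[of k] unfolding eq entry by (simp add: zero_less_mult_iff)
    then show ?thesis unfolding T_mat_def by presburger
  qed
  then have "det (\<chi> i k. if Re (\<i> * cnj z * (\<i> * a k)) < 0 then C $ i $ k else D $ i $ k) \<noteq> 0" using det by simp
  ultimately obtain t0 K where "t0 > 0" "K \<ge> 0" "\<And>t f y x. \<lbrakk>t \<ge> t0; f \<in> L2; sol (of_real t * (\<i> * cnj z)) f y; bc y = 0; x \<in> {0..1}\<rbrakk>
    \<Longrightarrow> norm (y x) \<le> K * L2norm f / sqrt t"
    by (rule ray_estimate) blast
  then show ?thesis unfolding good_ray_def by blast
qed

text \<open>Conjugation followed by a quarter turn is an injective real-linear map, so it carries
  the triangle with 0 in its interior to another one.\<close>

lemma weakly_regular_rays:
  assumes "weakly_regular Bm C D"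
  obtains \<omega>1 \<omega>2 \<omega>3 where "0 \<in> interior (convex hull {\<omega>1, \<omega>2, \<omega>3})" "\<And>\<omega>. \<omega> \<in> {\<omega>1, \<omega>2, \<omega>3} \<Longrightarrow> good_ray \<omega>" "\<omega>1 \<noteq> 0"
proof -
  obtain z1 z2 z3 where int: "0 \<in> interior (convex hull {z1, z2, z3})"
    and z: "\<And>z k. z \<in> {z1, z2, z3} \<Longrightarrow> Re (map_matrix ((*) z) Bm $ k $ k) \<noteq> 0"
      "\<And>z. z \<in> {z1, z2, z3} \<Longrightarrow> det (T_mat (map_matrix ((*) z) Bm) C D) \<noteq> 0"
    using assms unfolding weakly_regular_def by blast
  define g where "g z = \<i> * cnj z" for z
  have lin: "linear g" unfolding g_def by (rule linearI) (auto simp: algebra_simps)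
  have inj: "inj g" by (rule injI) (simp add: g_def)
  have "g 0 \<in> g ` interior (convex hull {z1, z2, z3})" using int by (rule imageI)
  also have "\<dots> = interior (convex hull {g z1, g z2, g z3})"
    unfolding interior_injective_linear_image[OF lin inj, symmetric] convex_hull_linear_image[OF lin] by simp
  finally have "0 \<in> interior (convex hull {g z1, g z2, g z3})" by (simp add: g_def)
  moreover have gr: "good_ray (g w)" if "w \<in> {z1, z2, z3}" for w
    unfolding g_def by (rule good_ray_of_T_mat[OF z(1)[OF that] z(2)[OF that]])
  have "good_ray \<omega>" if "\<omega> \<in> {g z1, g z2, g z3}" for \<omega> using gr that by auto
  moreover have "g z1 \<noteq> 0" using z(1)[of z1] by (auto simp: g_def map_matrix_def)
  ultimately show ?thesis by (rule that)
qed

lemma good_ray_unbounded: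
  assumes "good_ray \<omega>" "\<omega> \<noteq> 0" shows "\<exists>\<kappa>. norm \<kappa> > R \<and> \<Delta> \<kappa> \<noteq> 0"
proof -
  obtain t0 where t0: "t0 > 0" "\<And>t. t \<ge> t0 \<Longrightarrow> \<Delta> (of_real t * \<omega>) \<noteq> 0" by (rule good_ray_nonzero[OF assms(1)]) blast
  define t where "t = max t0 ((\<bar>R\<bar> + 1) / norm \<omega>)"
  have "(\<bar>R\<bar> + 1) / norm \<omega> * norm \<omega> \<le> t * norm \<omega>" unfolding t_def by (rule mult_right_mono) auto
  then have "\<bar>R\<bar> + 1 \<le> t * norm \<omega>" using assms(2) by simp
  moreover have "norm (of_real t * \<omega>) = t * norm \<omega>" using t0(1) by (simp add: norm_mult t_def)
  ultimately have "norm (of_real t * \<omega>) > R" by linarith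
  moreover have "\<Delta> (of_real t * \<omega>) \<noteq> 0" by (rule t0(2)) (simp add: t_def)
  ultimately show ?thesis by blast
qed

end

theorem theorem1p2:
  fixes r :: nat and b :: "nat \<Rightarrow> complex" and blk :: "'n::finite \<Rightarrow> nat"
    and C D :: "complex^'n^'n" and Q :: "real \<Rightarrow> complex^'n^'n" and \<Phi> :: "(real \<Rightarrow> complex^'n) set"
  assumes "range blk = {1..r}"
    and "\<forall>j\<in>{1..r}. b j \<noteq> 0"
    and "inj_on b {1..r}"
    and "rank (row_block C D) = CARD('n)"
    and "Q \<in> L2"
    and "weakly_regular (block_diag b blk) C D"
    and "root_function_system (block_diag b blk) C D Q \<Phi>"
  shows "complete_system \<Phi> \<and> minimal_system \<Phi>"
proof -
  define a where "a k = b (blk k)" for k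
  have a_nz: "a k \<noteq> 0" for k using assms(1,2) unfolding a_def by blast
  interpret bvp a C D Q by (rule bvp.intro[OF assms(5) a_nz])
  have B: "Bm = block_diag b blk" by (simp add: block_diag_def diag_mat_def a_def)
  obtain \<omega>1 \<omega>2 \<omega>3 where \<omega>: "0 \<in> interior (convex hull {\<omega>1, \<omega>2, \<omega>3})" "\<And>\<omega>. \<omega> \<in> {\<omega>1, \<omega>2, \<omega>3} \<Longrightarrow> good_ray \<omega>" "\<omega>1 \<noteq> 0"
    using assms(6) unfolding B[symmetric] by (rule weakly_regular_rays) blast
  have \<Phi>: "root_function_system Bm C D Q \<Phi>" using assms(7) unfolding B .
  have "complete_system \<Phi>" by (rule root_functions_complete[OF \<omega>(1,2) \<Phi>])
  moreover have "minimal_system \<Phi>"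
    by (rule root_functions_minimal[OF good_ray_unbounded[OF \<omega>(2) \<omega>(3)] \<Phi>]) simp
  ultimately show ?thesis by blast
qed

end
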